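(* Let $N\ge 2$ and consider an FT$N$S system on $\mathbb{R}^3$. The following are equivalent: (i) the system is FT$N$S strongly hyperbolic, i.e. there exist a constant $M_N>0$ and a family of Hermitian matrices $H_N(s)$, indexed by the unit vectors $s\in\mathbb{R}^3$, such that for all $s$ $$H_N(s)P_N^s=(P_N^s)^\dagger H_N(s),\qquad M_N^{-1}I\le H_N(s)\le M_N I;$$ (ii) there exists an FT$(N-1)$S reduction of the system (i.e. a choice of reduction parameters) which, regarded as an FT$(N-1)$S system, is FT$(N-1)$S strongly hyperbolic; (iii) there exists an iterated first order reduction of the system, obtained by successive reductions FT$N$S $\to$ FT$(N-1)$S $\to\dots\to$ FT1S, which is strongly hyperbolic as a first order (FT1S) system.
   Context: Space is $\mathbb{R}^3$ with coordinates $x^i$, $i=1,2,3$, and Euclidean metric; repeated spatial indices are summed; $(\dots)$ around indices denotes symmetrization with total weight one. All coefficient matrices are constant and complex. For Hermitian matrices, $A\le B$ means $v^\dagger A v\le v^\dagger B v$ for all $v$. **FT$N$S systems** ($N\ge1$). The unknowns are vectors of fields $v^0,\dots,v^{N-1}$ (each $v^\mu$ has finitely many components) depending on $t$ and $x$. The equations are, for $\mu=0,\dots,N-1$, $$\partial_t v^\mu=\sum_{\nu=0}^{\min(\mu+1,N-1)}\hat A^\mu{}_\nu v^\nu+\sum_{\nu=0}^{\mu}\sum_{\rho=1}^{\mu-\nu+1}\hat B^\mu{}_{\rho\,\nu}v^\nu+s^\mu,$$ where $\hat A^\mu{}_\nu=(A^\mu{}_\nu)^{i_1\dots i_{\mu-\nu+1}}\partial_{i_1}\cdots\partial_{i_{\mu-\nu+1}}$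 and $\hat B^\mu{}_{\rho\,\nu}=(B^\mu{}_{\rho\,\nu})^{i_1\dots i_{\mu-\nu-\rho+1}}\partial_{i_1}\cdots\partial_{i_{\mu-\nu-\rho+1}}$ (with zero indices these are just multiplication by a matrix), and the $s^\mu$ are given source terms independent of the fields. An FT1S system is a first order system $\partial_t v^0=(A^0{}_0)^i\partial_i v^0+B^0{}_{1\,0}v^0+s^0$. **Principal symbol.** For a unit vector $s\in\mathbb{R}^3$, $P_N^s$ is the block matrix with $(\mu,\nu)$ block, $\mu,\nu=0,\dots,N-1$, equal to $(A^\mu{}_\nu)^{k_1\dots k_{\mu-\nu+1}}s_{k_1}\cdots s_{k_{\mu-\nu+1}}$ for $\nu\le\mu+1$ (equal to $A^\mu{}_{\mu+1}$ if $\nu=\mu+1$), and zero for $\nu>\mu+1$. **Strong hyperbolicity.** For every $M\ge1$, an FT$M$S system is called FT$M$S strongly hyperbolic if there exist a constant $C>0$ and a family of Hermitian matrices $H(s)$, $s$ ranging over unit vectors, with $H(s)P_M^s=(P_M^s)^\dagger H(s)$ and $C^{-1}I\le H(s)\le C I$ for all $s$. For $M=1$ this is the standard definition for first order systems. **FT$(N-1)$S reductions** ($N\ge2$). Introduce new variables $d_i$, $i=1,2,3$ (each a vector of the size of $v^0$), replacing $\partial_i v^0$, and the auxiliary constraints $c_i=\partial_i v^0-d_i$ and $c_{ij}=\tfrac12(\partial_i d_j-\partial_j d_i)$. An FT$(N-1)$S reduction is any system of the form $$\partial_t v^0=(A^0{}_0)^k\partial_k v^0+A^0{}_1v^1+B^0{}_{1\,0}v^0+s^0+(D^0)^kc_k+(\bar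 D^0)^{kj}c_{kj},$$ $$\partial_t d_i=(A^0{}_0)^j\partial_i d_j+A^0{}_1\partial_i v^1+B^0{}_{1\,0}\partial_i v^0+\partial_i s^0+(D)_i{}^kc_k+(\bar D)_i{}^{kj}c_{kj},$$ and for $\mu=1,\dots,N-1$ $$\partial_t v^\mu=(A^\mu{}_0)^{k_1\dots k_{\mu+1}}\partial_{k_1}\cdots\partial_{k_\mu}d_{k_{\mu+1}}+\sum_{\nu=1}^{\min(\mu+1,N-1)}\hat A^\mu{}_\nu v^\nu+\sum_{\nu=0}^{\mu}\sum_{\rho=1}^{\mu-\nu+1}\hat B^\mu{}_{\rho\,\nu}v^\nu+s^\mu$$ $$\qquad+(D^\mu)^{k_1\dots k_\mu}\partial_{k_1}\cdots\partial_{k_{\mu-1}}c_{k_\mu}+(\bar D^\mu)^{k_1\dots k_{\mu+1}}\partial_{k_1}\cdots\partial_{k_{\mu-1}}c_{k_\mu k_{\mu+1}}.$$ The constant complex matrices $D^0,D,D^\mu,\bar D^0,\bar D,\bar D^\mu$ (the reduction parameters) are arbitrary, except that each $\bar D$ is taken antisymmetric in its last two (upper) indices. After inserting the definitions of $c_i,c_{ij}$, such a system is regarded as an FT$(N-1)$S system for the fields $w^0=(v^0,d_1,d_2,d_3,v^1)$ and $w^{\kappa}=v^{\kappa+1}$ for $\kappa=1,\dots,N-2$; its principal symbol $P_{N-1}^s$ is the one of that FT$(N-1)$S system. **Iterated first order reduction.** A system $\Sigma_1$ for which there is a chain $\Sigma_N,\Sigma_{N-1},\dots,\Sigma_1$ with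 $\Sigma_N$ the given FT$N$S system and, for each $M=N,\dots,2$, $\Sigma_{M-1}$ an FT$(M-1)$S reduction of $\Sigma_M$. *)

theory Defs
  imports "HOL-Analysis.Analysis" "Jordan_Normal_Form.Schur_Decomposition"
begin

section \<open>Fields and partial derivatives\<close>

text \<open>The spatial index \<open>i = 1, 2, 3\<close> is an element of the three-element type \<^typ>\<open>3\<close>
  (in which \<open>3 = 0\<close>). A field with \<open>n\<close> components is a function of type \<open>nat \<Rightarrow> scalar_field\<close>
  of which only the arguments \<open>a < n\<close> matter.\<close>

type_synonym scalar_field = "real^3 \<Rightarrow> complex"

definition pderiv_dir :: "3 \<Rightarrow> scalar_field \<Rightarrow> scalar_field" where
  "pderiv_dir i f = (\<lambda>x. frechet_derivative f (at x) (axis i 1))"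

text \<open>\<open>pderivs [k\<^sub>1, \<dots>, k\<^sub>m] f\<close> is \<open>\<partial>\<^bsub>k\<^sub>1\<^esub> \<cdots> \<partial>\<^bsub>k\<^sub>m\<^esub> f\<close>.\<close>

primrec pderivs :: "3 list \<Rightarrow> scalar_field \<Rightarrow> scalar_field" where
  "pderivs [] f = f"
| "pderivs (k # ks) f = pderiv_dir k (pderivs ks f)"

definition smooth_field :: "scalar_field \<Rightarrow> bool" where
  "smooth_field f \<longleftrightarrow> (\<forall>ks x. pderivs ks f differentiable (at x))"

definition multi_indices :: "nat \<Rightarrow> 3 list set" where
  "multi_indices m = {ks. length ks = m}"

definition mat_app :: "complex mat \<Rightarrow> (nat \<Rightarrow> scalar_field) \<Rightarrow> nat \<Rightarrow> scalar_field" where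
  "mat_app M u a x = (\<Sum>b<dim_col M. M $$ (a, b) * u b x)"

text \<open>\<open>C\<^bsup>k\<^sub>1\<dots>k\<^sub>m\<^esup> \<partial>\<^bsub>k\<^sub>1\<^esub> \<cdots> \<partial>\<^bsub>k\<^sub>m\<^esub> u\<close>, summed over all indices.
  The tensor \<open>C\<close> need not be symmetric.\<close>

definition diff_op ::
    "nat \<Rightarrow> (3 list \<Rightarrow> complex mat) \<Rightarrow> (nat \<Rightarrow> scalar_field) \<Rightarrow> nat \<Rightarrow> scalar_field" where
  "diff_op m C u a x = (\<Sum>ks\<in>multi_indices m. mat_app (C ks) (\<lambda>b. pderivs ks (u b)) a x)"


section \<open>FT$N$S systems\<close>

text \<open>The order \<open>N\<close> is kept outside the record. \<open>coefA \<mu> \<nu> ks\<close> is \<open>(A\<^sup>\<mu>\<^sub>\<nu>)\<^bsup>ks\<^esup>\<close>,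
  \<open>coefB \<mu> \<rho> \<nu> ks\<close> is \<open>(B\<^sup>\<mu>\<^sub>\<rho>\<^sub>\<nu>)\<^bsup>ks\<^esup>\<close> and \<open>source \<mu> t a x\<close> is the component \<open>a\<close>
  of \<open>s\<^sup>\<mu>(t, x)\<close>.\<close>

record ft_system =
  ncomp :: "nat \<Rightarrow> nat"
  coefA :: "nat \<Rightarrow> nat \<Rightarrow> 3 list \<Rightarrow> complex mat"
  coefB :: "nat \<Rightarrow> nat \<Rightarrow> nat \<Rightarrow> 3 list \<Rightarrow> complex mat"
  source :: "nat \<Rightarrow> real \<Rightarrow> nat \<Rightarrow> scalar_field"

definition is_ft_system :: "nat \<Rightarrow> ft_system \<Rightarrow> bool" where
  "is_ft_system N S \<longleftrightarrow> N \<ge> 1 \<and>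
     (\<forall>\<mu><N. \<forall>\<nu>\<le>min (\<mu> + 1) (N - 1). \<forall>ks\<in>multi_indices (\<mu> + 1 - \<nu>).
        coefA S \<mu> \<nu> ks \<in> carrier_mat (ncomp S \<mu>) (ncomp S \<nu>)) \<and>
     (\<forall>\<mu><N. \<forall>\<nu>\<le>\<mu>. \<forall>\<rho>\<in>{1..\<mu> - \<nu> + 1}. \<forall>ks\<in>multi_indices (\<mu> + 1 - \<nu> - \<rho>).
        coefB S \<mu> \<rho> \<nu> ks \<in> carrier_mat (ncomp S \<mu>) (ncomp S \<nu>))"

text \<open>The system is \<open>\<partial>\<^sub>t v\<^sup>\<mu> = ft_rhs N S t v \<mu>\<close>, where \<open>v\<close> stands for the fields at time \<open>t\<close>.\<close>

definition ft_rhs ::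
    "nat \<Rightarrow> ft_system \<Rightarrow> real \<Rightarrow> (nat \<Rightarrow> nat \<Rightarrow> scalar_field) \<Rightarrow> nat \<Rightarrow> nat \<Rightarrow> scalar_field" where
  "ft_rhs N S t v \<mu> a x =
     (\<Sum>\<nu>=0..min (\<mu> + 1) (N - 1). diff_op (\<mu> + 1 - \<nu>) (coefA S \<mu> \<nu>) (v \<nu>) a x)
   + (\<Sum>\<nu>=0..\<mu>. \<Sum>\<rho>=1..\<mu> - \<nu> + 1. diff_op (\<mu> + 1 - \<nu> - \<rho>) (coefB S \<mu> \<rho> \<nu>) (v \<nu>) a x)
   + source S \<mu> t a x"


section \<open>Principal symbol and strong hyperbolicity\<close>

text \<open>The list of all pairs \<open>(\<mu>, a)\<close> of a block number and a component within the block.\<close>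

definition block_indices :: "nat \<Rightarrow> (nat \<Rightarrow> nat) \<Rightarrow> (nat \<times> nat) list" where
  "block_indices N n = concat (map (\<lambda>\<mu>. map (Pair \<mu>) [0..<n \<mu>]) [0..<N])"

definition total_dim :: "nat \<Rightarrow> ft_system \<Rightarrow> nat" where
  "total_dim N S = (\<Sum>\<mu><N. ncomp S \<mu>)"

definition symbol_block :: "ft_system \<Rightarrow> real^3 \<Rightarrow> nat \<Rightarrow> nat \<Rightarrow> nat \<Rightarrow> nat \<Rightarrow> complex" where
  "symbol_block S s \<mu> \<nu> a b =
     (if \<nu> \<le> \<mu> + 1
      then \<Sum>ks\<in>multi_indices (\<mu> + 1 - \<nu>).
             coefA S \<mu> \<nu> ks $$ (a, b) * complex_of_real (\<Prod>k\<leftarrow>ks. vec_nth s k)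
      else 0)"

definition principal_symbol :: "nat \<Rightarrow> ft_system \<Rightarrow> real^3 \<Rightarrow> complex mat" where
  "principal_symbol N S s =
     Matrix.mat (total_dim N S) (total_dim N S)
       (\<lambda>(i, j). case (block_indices N (ncomp S) ! i, block_indices N (ncomp S) ! j) of
          ((\<mu>, a), (\<nu>, b)) \<Rightarrow> symbol_block S s \<mu> \<nu> a b)"

definition hermitian_mat :: "nat \<Rightarrow> complex mat \<Rightarrow> bool" where
  "hermitian_mat d A \<longleftrightarrow> A \<in> carrier_mat d d \<and> mat_adjoint A = A"

text \<open>Only used for Hermitian matrices, for which \<open>v\<^sup>\<dagger> A v = (A v) \<bullet>c v\<close> is real.\<close>

definition mat_le :: "nat \<Rightarrow> complex mat \<Rightarrow> complex mat \<Rightarrow> bool" where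
  "mat_le d A B \<longleftrightarrow>
     (\<forall>v\<in>carrier_vec d. Re ((A *\<^sub>v v) \<bullet>c v) \<le> Re ((B *\<^sub>v v) \<bullet>c v))"

definition strongly_hyperbolic :: "nat \<Rightarrow> ft_system \<Rightarrow> bool" where
  "strongly_hyperbolic N S \<longleftrightarrow>
     (\<exists>(C::real) (H :: real^3 \<Rightarrow> complex mat). C > 0 \<and>
        (\<forall>s. norm s = 1 \<longrightarrow>
           hermitian_mat (total_dim N S) (H s) \<and>
           H s * principal_symbol N S s = mat_adjoint (principal_symbol N S s) * H s \<and>
           mat_le (total_dim N S)
             (complex_of_real (inverse C) \<cdot>\<^sub>m 1\<^sub>m (total_dim N S)) (H s) \<and>
           mat_le (total_dim N S)
             (H s) (complex_of_real C \<cdot>\<^sub>m 1\<^sub>m (total_dim N S))))"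


section \<open>FT$(N-1)$S reductions\<close>

text \<open>In this order: \<open>(D\<^sup>0)\<^sup>k\<close>, \<open>(Dbar\<^sup>0)\<^sup>k\<^sup>j\<close>, \<open>(D)\<^sub>i\<^sup>k\<close>, \<open>(Dbar)\<^sub>i\<^sup>k\<^sup>j\<close>, and, for \<open>\<mu> \<ge> 1\<close>,
  \<open>(D\<^sup>\<mu>)\<^bsup>ks\<^esup>\<close>, \<open>(Dbar\<^sup>\<mu>)\<^bsup>ks\<^esup>\<close>.\<close>

record reduction_params =
  parD0 :: "3 \<Rightarrow> complex mat"
  parDbar0 :: "3 \<Rightarrow> 3 \<Rightarrow> complex mat"
  parD :: "3 \<Rightarrow> 3 \<Rightarrow> complex mat"
  parDbar :: "3 \<Rightarrow> 3 \<Rightarrow> 3 \<Rightarrow> complex mat"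
  parDmu :: "nat \<Rightarrow> 3 list \<Rightarrow> complex mat"
  parDbarmu :: "nat \<Rightarrow> 3 list \<Rightarrow> complex mat"

definition is_reduction_params :: "nat \<Rightarrow> ft_system \<Rightarrow> reduction_params \<Rightarrow> bool" where
  "is_reduction_params N S D \<longleftrightarrow>
     (\<forall>k. parD0 D k \<in> carrier_mat (ncomp S 0) (ncomp S 0)) \<and>
     (\<forall>k j. parDbar0 D k j \<in> carrier_mat (ncomp S 0) (ncomp S 0)) \<and>
     (\<forall>i k. parD D i k \<in> carrier_mat (ncomp S 0) (ncomp S 0)) \<and>
     (\<forall>i k j. parDbar D i k j \<in> carrier_mat (ncomp S 0) (ncomp S 0)) \<and>
     (\<forall>\<mu>\<in>{1..<N}. \<forall>ks\<in>multi_indices \<mu>.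
        parDmu D \<mu> ks \<in> carrier_mat (ncomp S \<mu>) (ncomp S 0)) \<and>
     (\<forall>\<mu>\<in>{1..<N}. \<forall>ks\<in>multi_indices (\<mu> + 1).
        parDbarmu D \<mu> ks \<in> carrier_mat (ncomp S \<mu>) (ncomp S 0)) \<and>
     (\<forall>k j. parDbar0 D j k = - parDbar0 D k j) \<and>
     (\<forall>i k j. parDbar D i j k = - parDbar D i k j) \<and>
     (\<forall>\<mu>\<in>{1..<N}. \<forall>ks\<in>multi_indices (\<mu> - 1). \<forall>k j.
        parDbarmu D \<mu> (ks @ [j, k]) = - parDbarmu D \<mu> (ks @ [k, j]))"

definition constr1 ::
    "(nat \<Rightarrow> scalar_field) \<Rightarrow> (3 \<Rightarrow> nat \<Rightarrow> scalar_field) \<Rightarrow> 3 \<Rightarrow> nat \<Rightarrow> scalar_field" where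
  "constr1 v0 d i a x = pderiv_dir i (v0 a) x - d i a x"

definition constr2 :: "(3 \<Rightarrow> nat \<Rightarrow> scalar_field) \<Rightarrow> 3 \<Rightarrow> 3 \<Rightarrow> nat \<Rightarrow> scalar_field" where
  "constr2 d i j a x = (1/2) * (pderiv_dir i (d j a) x - pderiv_dir j (d i a) x)"

definition red_rhs_v0 ::
    "ft_system \<Rightarrow> reduction_params \<Rightarrow> real \<Rightarrow> (nat \<Rightarrow> nat \<Rightarrow> scalar_field) \<Rightarrow>
     (3 \<Rightarrow> nat \<Rightarrow> scalar_field) \<Rightarrow> nat \<Rightarrow> scalar_field" where
  "red_rhs_v0 S D t v d a x =
     (\<Sum>k\<in>UNIV. mat_app (coefA S 0 0 [k]) (\<lambda>b. pderiv_dir k (v 0 b)) a x)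
   + mat_app (coefA S 0 1 []) (v 1) a x
   + mat_app (coefB S 0 1 0 []) (v 0) a x
   + source S 0 t a x
   + (\<Sum>k\<in>UNIV. mat_app (parD0 D k) (constr1 (v 0) d k) a x)
   + (\<Sum>k\<in>UNIV. \<Sum>j\<in>UNIV. mat_app (parDbar0 D k j) (constr2 d k j) a x)"

definition red_rhs_d ::
    "ft_system \<Rightarrow> reduction_params \<Rightarrow> real \<Rightarrow> (nat \<Rightarrow> nat \<Rightarrow> scalar_field) \<Rightarrow>
     (3 \<Rightarrow> nat \<Rightarrow> scalar_field) \<Rightarrow> 3 \<Rightarrow> nat \<Rightarrow> scalar_field" where
  "red_rhs_d S D t v d i a x =
     (\<Sum>j\<in>UNIV. mat_app (coefA S 0 0 [j]) (\<lambda>b. pderiv_dir i (d j b)) a x)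
   + mat_app (coefA S 0 1 []) (\<lambda>b. pderiv_dir i (v 1 b)) a x
   + mat_app (coefB S 0 1 0 []) (\<lambda>b. pderiv_dir i (v 0 b)) a x
   + pderiv_dir i (source S 0 t a) x
   + (\<Sum>k\<in>UNIV. mat_app (parD D i k) (constr1 (v 0) d k) a x)
   + (\<Sum>k\<in>UNIV. \<Sum>j\<in>UNIV. mat_app (parDbar D i k j) (constr2 d k j) a x)"

definition red_rhs_vmu ::
    "nat \<Rightarrow> ft_system \<Rightarrow> reduction_params \<Rightarrow> real \<Rightarrow> (nat \<Rightarrow> nat \<Rightarrow> scalar_field) \<Rightarrow>
     (3 \<Rightarrow> nat \<Rightarrow> scalar_field) \<Rightarrow> nat \<Rightarrow> nat \<Rightarrow> scalar_field" where
  "red_rhs_vmu N S D t v d \<mu> a x =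
     (\<Sum>ks\<in>multi_indices \<mu>. \<Sum>k\<in>UNIV.
        mat_app (coefA S \<mu> 0 (ks @ [k])) (\<lambda>b. pderivs ks (d k b)) a x)
   + (\<Sum>\<nu>=1..min (\<mu> + 1) (N - 1). diff_op (\<mu> + 1 - \<nu>) (coefA S \<mu> \<nu>) (v \<nu>) a x)
   + (\<Sum>\<nu>=0..\<mu>. \<Sum>\<rho>=1..\<mu> - \<nu> + 1. diff_op (\<mu> + 1 - \<nu> - \<rho>) (coefB S \<mu> \<rho> \<nu>) (v \<nu>) a x)
   + source S \<mu> t a x
   + (\<Sum>ks\<in>multi_indices (\<mu> - 1). \<Sum>k\<in>UNIV.
        mat_app (parDmu D \<mu> (ks @ [k])) (\<lambda>b. pderivs ks (constr1 (v 0) d k b)) a x)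
   + (\<Sum>ks\<in>multi_indices (\<mu> - 1). \<Sum>k\<in>UNIV. \<Sum>j\<in>UNIV.
        mat_app (parDbarmu D \<mu> (ks @ [k, j])) (\<lambda>b. pderivs ks (constr2 d k j b)) a x)"

definition red_rhs_v ::
    "nat \<Rightarrow> ft_system \<Rightarrow> reduction_params \<Rightarrow> real \<Rightarrow> (nat \<Rightarrow> nat \<Rightarrow> scalar_field) \<Rightarrow>
     (3 \<Rightarrow> nat \<Rightarrow> scalar_field) \<Rightarrow> nat \<Rightarrow> nat \<Rightarrow> scalar_field" where
  "red_rhs_v N S D t v d \<mu> =
     (if \<mu> = 0 then red_rhs_v0 S D t v d else red_rhs_vmu N S D t v d \<mu>)"

text \<open>\<open>w\<^sup>0 = (v\<^sup>0, d\<^sub>1, d\<^sub>2, d\<^sub>3, v\<^sup>1)\<close> and \<open>w\<^sup>\<kappa> = v\<^bsup>\<kappa>+1\<^esup>\<close> for \<open>\<kappa> \<ge> 1\<close>; \<open>n \<mu>\<close> is the size of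
  \<open>v\<^sup>\<mu>\<close>. The right-hand sides are regrouped in the same way as the fields.\<close>

definition regroup ::
    "(nat \<Rightarrow> nat) \<Rightarrow> (nat \<Rightarrow> nat \<Rightarrow> scalar_field) \<Rightarrow> (3 \<Rightarrow> nat \<Rightarrow> scalar_field) \<Rightarrow>
     nat \<Rightarrow> nat \<Rightarrow> scalar_field" where
  "regroup n v d \<kappa> a =
     (if \<kappa> = 0
      then (map (v 0) [0..<n 0] @ map (d 1) [0..<n 0] @ map (d 2) [0..<n 0] @
            map (d 3) [0..<n 0] @ map (v 1) [0..<n 1]) ! a
      else v (\<kappa> + 1) a)"

text \<open>\<open>S'\<close> has the form of a reduction of \<open>S\<close>: both sides are the same differential operator
  (with the same source) on all smooth fields \<open>v\<^sup>\<mu>, d\<^sub>i\<close>. These fields are independent of each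
  other: the constraints are not imposed.\<close>

definition is_ft_reduction :: "nat \<Rightarrow> ft_system \<Rightarrow> ft_system \<Rightarrow> bool" where
  "is_ft_reduction N S S' \<longleftrightarrow>
     is_ft_system (N - 1) S' \<and>
     ncomp S' 0 = 4 * ncomp S 0 + ncomp S 1 \<and>
     (\<forall>\<kappa>\<in>{1..<N - 1}. ncomp S' \<kappa> = ncomp S (\<kappa> + 1)) \<and>
     (\<exists>D. is_reduction_params N S D \<and>
        (\<forall>t v d. (\<forall>\<mu> a. smooth_field (v \<mu> a)) \<longrightarrow> (\<forall>i a. smooth_field (d i a)) \<longrightarrow>
           (\<forall>\<kappa><N - 1. \<forall>a<ncomp S' \<kappa>. \<forall>x.
              ft_rhs (N - 1) S' t (regroup (ncomp S) v d) \<kappa> a x =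
              regroup (ncomp S) (red_rhs_v N S D t v d) (red_rhs_d S D t v d) \<kappa> a x)))"

definition is_iterated_reduction :: "nat \<Rightarrow> ft_system \<Rightarrow> ft_system \<Rightarrow> bool" where
  "is_iterated_reduction N S T \<longleftrightarrow>
     (\<exists>\<Sigma> :: nat \<Rightarrow> ft_system. \<Sigma> N = S \<and> \<Sigma> 1 = T \<and>
        (\<forall>M\<in>{2..N}. is_ft_reduction M (\<Sigma> M) (\<Sigma> (M - 1))))"

end

theory Submission
  imports Defs
begin

text \<open>
  Let \<open>M\<close> be the symbol of a reduction and \<open>P\<close> that of the original system. The isometry
  \<open>J : (v\<^sup>0, v\<^sup>1, \<dots>) \<mapsto> (0, s\<^sub>i v\<^sup>0, v\<^sup>1, \<dots>)\<close> satisfies \<open>M J = J P\<close> for every choice of parameters: on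
  plane waves \<open>exp (\<tau> s \<bullet> x)\<close> with \<open>d\<close> the gradient of \<open>v\<^sup>0\<close> the constraints vanish, and the leading
  orders in \<open>\<tau> \<rightarrow> \<infinity>\<close> of the two systems agree. Hence \<open>J\<^sup>\<dagger> H J\<close> symmetrizes \<open>P\<close> if \<open>H\<close> symmetrizes \<open>M\<close>.

  Conversely, parameters exist for which \<open>v\<^sup>0\<close> drops out of the principal part and the part of \<open>d\<close>
  tangential to the wave front is governed by \<open>\<i> l curl\<close> alone. The symbol \<open>R\<close> of the latter is
  Hermitian with tangential eigenvalues \<open>\<plusminus>l\<close>. If \<open>l\<close> exceeds a uniform bound on \<open>P\<close>, the spectra of \<open>P\<close>
  and of the tangential block are uniformly separated, so \<open>M\<close> can be block diagonalized by a uniformly bounded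
  solution of a Sylvester equation. Iterating gives the statement about first order reductions.
\<close>

section \<open>Symmetrizers\<close>

text \<open>The tangential part of \<open>d\<close> is where a reduction can fail. It feeds back
  into the other fields through the coefficients of \<open>S\<close>, so the symbol of the reduction
  is only block triangular. An eigenvalue shared by both diagonal blocks could create a Jordan
  block; one that is nearly shared as \<open>s\<close> varies could ruin the uniform bounds. The
  parameters reach the tangential block only through the curl of \<open>d\<close>, whose symbol is
  the cross product with \<open>s\<close>, a real antisymmetric matrix. The factor
  \<open>\<i>\<close> makes its imaginary eigenvalues real, and this is where complex parameters
  enter. The eigenvalue 0 of \<open>v^0\<close> may also belong to \<open>P\<close> but is harmless:
  for the chosen parameters \<open>v^0\<close> has no principal part and occurs in none.

  Two features of the definitions shape the rest. A reduction is given by equality of differential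
  operators, which leaves the non-symmetric parts of the coefficient tensors of \<open>S'\<close>
  undetermined; hence symbols are compared through plane waves. Strong hyperbolicity asks for no
  regularity of \<open>H\<close> in \<open>s\<close>, so each direction is treated alone, with
  constants independent of \<open>s\<close>.\<close>

definition vnorm :: "complex Matrix.vec \<Rightarrow> real" where
  "vnorm v = L2_set (\<lambda>i. cmod (vec_index v i)) {0..<dim_vec v}"

lemma vnorm_nonneg: "0 \<le> vnorm v"
  by (simp add: vnorm_def)

lemma vnorm_add:
  assumes "v \<in> carrier_vec n" "w \<in> carrier_vec n"
  shows "vnorm (v + w) \<le> vnorm v + vnorm w"
proof -
  have d: "dim_vec v = n" "dim_vec w = n" using assms by auto
  have "vnorm (v + w) \<le> L2_set (\<lambda>i. cmod (vec_index v i) + cmod (vec_index w i)) {0..<n}"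
    unfolding vnorm_def using d by (auto intro!: L2_set_mono norm_triangle_ineq)
  also have "\<dots> \<le> vnorm v + vnorm w"
    unfolding vnorm_def using d L2_set_triangle_ineq by auto
  finally show ?thesis .
qed

lemma vnorm_smult: "vnorm (c \<cdot>\<^sub>v v) = cmod c * vnorm v"
  unfolding vnorm_def by (auto simp: L2_set_right_distrib norm_mult intro!: L2_set_cong)

lemma vnorm_uminus: "vnorm (- v) = vnorm v"
  unfolding vnorm_def by (auto intro!: L2_set_cong)

lemma vnorm_minus:
  assumes "v \<in> carrier_vec n" "w \<in> carrier_vec n"
  shows "vnorm (v - w) \<le> vnorm v + vnorm w"
  using vnorm_add[of v n "- w"] assms
  by (simp add: vnorm_uminus minus_add_uminus_vec[of v n w])

lemma cscalar_prod_eq_vnorm: "v \<bullet>c v = complex_of_real ((vnorm v)\<^sup>2)"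
  unfolding vnorm_def scalar_prod_def L2_set_def
  by (simp add: sum_nonneg complex_norm_square[symmetric] del: of_real_power)

lemma vnorm_zero_iff: assumes "v \<in> carrier_vec n" shows "vnorm v = 0 \<longleftrightarrow> v = 0\<^sub>v n"
  using conjugate_square_eq_0_vec[OF assms] by (simp add: cscalar_prod_eq_vnorm)

text \<open>A crude bound by dimensions times largest entry. Only uniformity in \<open>s\<close>
  matters later, so the sharp operator norm is avoided.\<close>

lemma vnorm_mult_mat_vec_le:
  assumes A: "A \<in> carrier_mat m n" and v: "v \<in> carrier_vec n"
    and b: "\<And>i j. i < m \<Longrightarrow> j < n \<Longrightarrow> cmod (A $$ (i, j)) \<le> b" and b0: "0 \<le> b"
  shows "vnorm (A *\<^sub>v v) \<le> (real m * real n * b) * vnorm v"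
proof -
  have c: "cmod (vec_index v j) \<le> vnorm v" if "j < n" for j
    unfolding vnorm_def using that v by (intro member_le_L2_set) auto
  have e: "cmod (vec_index (A *\<^sub>v v) i) \<le> real n * (b * vnorm v)" if "i < m" for i
  proof -
    have "cmod (vec_index (A *\<^sub>v v) i) = cmod (\<Sum>j = 0..<n. A $$ (i, j) * vec_index v j)"
      using that A v by (simp add: scalar_prod_def)
    also have "\<dots> \<le> (\<Sum>j = 0..<n. b * vnorm v)"
      by (rule order_trans[OF norm_sum sum_mono])
        (auto simp: norm_mult that intro!: mult_mono b c b0)
    finally show ?thesis by simp
  qed
  have "vnorm (A *\<^sub>v v) \<le> (\<Sum>i = 0..<m. cmod (vec_index (A *\<^sub>v v) i))"
    unfolding vnorm_def using A L2_set_le_sum[of "{0..<m}" "\<lambda>i. cmod (vec_index (A *\<^sub>v v) i)"] by auto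
  also have "\<dots> \<le> (\<Sum>i = 0..<m. real n * (b * vnorm v))"
    by (intro sum_mono e) auto
  finally show ?thesis by (simp add: mult.assoc)
qed

section \<open>Adjoint matrices and isometries\<close>

lemma dim_mat_adjoint [simp]:
  "dim_row (mat_adjoint A) = dim_col A" "dim_col (mat_adjoint A) = dim_row A"
  unfolding mat_adjoint_def by auto

lemma index_mat_adjoint [simp]:
  assumes "i < dim_col A" "j < dim_row A"
  shows "mat_adjoint A $$ (i, j) = conjugate (A $$ (j, i))"
  unfolding mat_adjoint_def using assms by (simp add: mat_of_rows_def)

lemma carrier_mat_adjoint [simp, intro]:
  "A \<in> carrier_mat m n \<Longrightarrow> mat_adjoint A \<in> carrier_mat n m"
  by auto

lemma mat_adjoint_adjoint [simp]: "mat_adjoint (mat_adjoint A) = (A :: complex mat)"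
  by (rule eq_matI) auto

lemma mat_adjoint_mult:
  fixes A :: "complex mat"
  assumes "A \<in> carrier_mat m n" "B \<in> carrier_mat n k"
  shows "mat_adjoint (A * B) = mat_adjoint B * mat_adjoint A"
  using assms by (intro eq_matI) (auto simp: scalar_prod_def mult.commute intro!: sum.cong)

lemma mat_adjoint_add:
  fixes A :: "complex mat"
  assumes "A \<in> carrier_mat m n" "B \<in> carrier_mat m n"
  shows "mat_adjoint (A + B) = mat_adjoint A + mat_adjoint B"
  using assms by (intro eq_matI) auto

lemma mat_adjoint_minus:
  fixes A :: "complex mat"
  assumes "A \<in> carrier_mat m n" "B \<in> carrier_mat m n"
  shows "mat_adjoint (A - B) = mat_adjoint A - mat_adjoint B"
  using assms by (intro eq_matI) auto

lemma mat_adjoint_zero [simp]: "mat_adjoint (0\<^sub>m m n :: complex mat) = 0\<^sub>m n m"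
  by (intro eq_matI) auto

lemma mat_adjoint_one [simp]: "mat_adjoint (1\<^sub>m n :: complex mat) = 1\<^sub>m n"
  by (intro eq_matI) auto

lemma cscalar_prod_mat_adjoint:
  fixes A :: "complex mat"
  assumes "A \<in> carrier_mat m n" "v \<in> carrier_vec m" "w \<in> carrier_vec n"
  shows "(mat_adjoint A *\<^sub>v v) \<bullet>c w = v \<bullet>c (A *\<^sub>v w)"
proof -
  have "(mat_adjoint A *\<^sub>v v) \<bullet>c w =
      (\<Sum>i = 0..<n. \<Sum>j = 0..<m. cnj (A $$ (j, i)) * vec_index v j * cnj (vec_index w i))"
    using assms by (auto simp: scalar_prod_def sum_distrib_right intro!: sum.cong)
  also have "\<dots> = (\<Sum>j = 0..<m. \<Sum>i = 0..<n. cnj (A $$ (j, i)) * vec_index v j * cnj (vec_index w i))"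
    by (rule sum.swap)
  also have "\<dots> = v \<bullet>c (A *\<^sub>v w)"
    using assms by (auto simp: scalar_prod_def sum_distrib_left algebra_simps intro!: sum.cong)
  finally show ?thesis .
qed

lemma vnorm_isometry:
  assumes J: "J \<in> carrier_mat m n" and "mat_adjoint J * J = 1\<^sub>m n" and v: "v \<in> carrier_vec n"
  shows "vnorm (J *\<^sub>v v) = vnorm v"
proof -
  have "(J *\<^sub>v v) \<bullet>c (J *\<^sub>v v) = (mat_adjoint J *\<^sub>v (J *\<^sub>v v)) \<bullet>c v"
    using assms by (subst cscalar_prod_mat_adjoint[OF J]) auto
  also have "mat_adjoint J *\<^sub>v (J *\<^sub>v v) = (mat_adjoint J * J) *\<^sub>v v"
    using assms by (subst assoc_mult_mat_vec[of _ n m _ n]) auto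
  also have "\<dots> = v" using assms by simp
  finally have "complex_of_real ((vnorm (J *\<^sub>v v))\<^sup>2) = complex_of_real ((vnorm v)\<^sup>2)"
    by (simp add: cscalar_prod_eq_vnorm)
  then show ?thesis by (simp only: of_real_eq_iff power2_eq_iff_nonneg vnorm_nonneg)
qed

text \<open>\<open>J * mat_adjoint J\<close> is the orthogonal projection onto the range of
  \<open>J\<close>. The first claim is Pythagoras; the second identifies the quadratic form of the
  complementary projection with the squared distance to that range.\<close>

lemma vnorm_adjoint_isometry:
  assumes J: "J \<in> carrier_mat m n" and JJ: "mat_adjoint J * J = 1\<^sub>m n" and v: "v \<in> carrier_vec m"
  shows "(vnorm (mat_adjoint J *\<^sub>v v))\<^sup>2 + (vnorm (v - J *\<^sub>v (mat_adjoint J *\<^sub>v v)))\<^sup>2 = (vnorm v)\<^sup>2"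
    and "((1\<^sub>m m - J * mat_adjoint J) *\<^sub>v v) \<bullet>c v
      = complex_of_real ((vnorm (v - J *\<^sub>v (mat_adjoint J *\<^sub>v v)))\<^sup>2)"
proof -
  let ?Jh = "mat_adjoint J"
  define u where "u = ?Jh *\<^sub>v v"
  have u: "u \<in> carrier_vec n" using J v by (auto simp: u_def intro!: mult_mat_vec_carrier[of _ n m])
  have Ju: "J *\<^sub>v u \<in> carrier_vec m" using J u by (auto intro!: mult_mat_vec_carrier[of _ m n])
  have Jhc: "?Jh \<in> carrier_mat n m" using J by auto
  have 1: "(J *\<^sub>v u) \<bullet>c v = u \<bullet>c u"
    using cscalar_prod_mat_adjoint[OF Jhc u v] by (simp add: u_def)
  have 2: "v \<bullet>c (J *\<^sub>v u) = u \<bullet>c u"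
    using cscalar_prod_mat_adjoint[OF J v u] by (simp add: u_def)
  have 3: "(J *\<^sub>v u) \<bullet>c (J *\<^sub>v u) = u \<bullet>c u"
    using vnorm_isometry[OF J JJ u] by (simp add: cscalar_prod_eq_vnorm)
  have exp: "x \<bullet>c (y - z) = x \<bullet>c y - x \<bullet>c z"
    if "x \<in> carrier_vec m" "y \<in> carrier_vec m" "z \<in> carrier_vec m" for x y z :: "complex Matrix.vec"
    using that by (auto simp: scalar_prod_def sum_subtractf[symmetric] algebra_simps intro!: sum.cong)
  have exp2: "(y - z) \<bullet>c x = y \<bullet>c x - z \<bullet>c x"
    if "x \<in> carrier_vec m" "y \<in> carrier_vec m" "z \<in> carrier_vec m" for x y z :: "complex Matrix.vec"
    using that by (auto simp: scalar_prod_def sum_subtractf[symmetric] algebra_simps intro!: sum.cong)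
  have 4: "(v - J *\<^sub>v u) \<bullet>c (v - J *\<^sub>v u) = v \<bullet>c v - u \<bullet>c u"
    using v Ju by (simp add: exp exp2 1 2 3)
  then have "complex_of_real ((vnorm (v - J *\<^sub>v u))\<^sup>2) = complex_of_real ((vnorm v)\<^sup>2 - (vnorm u)\<^sup>2)"
    by (simp add: cscalar_prod_eq_vnorm)
  then show "(vnorm (mat_adjoint J *\<^sub>v v))\<^sup>2 + (vnorm (v - J *\<^sub>v (mat_adjoint J *\<^sub>v v)))\<^sup>2 = (vnorm v)\<^sup>2"
    by (simp only: of_real_eq_iff u_def)
  have "(1\<^sub>m m - J * ?Jh) *\<^sub>v v = v - J *\<^sub>v u"
    using J v Jhc by (simp add: minus_mult_distrib_mat_vec[of _ m m] assoc_mult_mat_vec[of _ m n _ m] u_def)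
  then show "((1\<^sub>m m - J * ?Jh) *\<^sub>v v) \<bullet>c v
      = complex_of_real ((vnorm (v - J *\<^sub>v (?Jh *\<^sub>v v)))\<^sup>2)"
    using 4 v Ju by (simp add: exp2 1 cscalar_prod_eq_vnorm u_def[symmetric])
qed

lemma vnorm_adjoint_isometry_le:
  assumes J: "J \<in> carrier_mat m n" and JJ: "mat_adjoint J * J = 1\<^sub>m n" and v: "v \<in> carrier_vec m"
  shows "vnorm (mat_adjoint J *\<^sub>v v) \<le> vnorm v"
  using vnorm_adjoint_isometry(1)[OF assms] vnorm_nonneg
  by (metis le_add_same_cancel1 power2_le_imp_le zero_le_power2)

section \<open>Symmetrizers with uniform bounds\<close>

definition symmetrizer :: "nat \<Rightarrow> real \<Rightarrow> complex mat \<Rightarrow> complex mat \<Rightarrow> bool" where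
  "symmetrizer n C P H \<longleftrightarrow> H \<in> carrier_mat n n \<and> mat_adjoint H = H \<and> H * P = mat_adjoint P * H \<and>
     (\<forall>v\<in>carrier_vec n. inverse C * (vnorm v)\<^sup>2 \<le> Re ((H *\<^sub>v v) \<bullet>c v) \<and>
        Re ((H *\<^sub>v v) \<bullet>c v) \<le> C * (vnorm v)\<^sup>2)"

lemma Re_smult_one_mat:
  assumes "v \<in> carrier_vec n"
  shows "Re (((complex_of_real c \<cdot>\<^sub>m 1\<^sub>m n) *\<^sub>v v) \<bullet>c v) = c * (vnorm v)\<^sup>2"
proof -
  have "(complex_of_real c \<cdot>\<^sub>m 1\<^sub>m n) *\<^sub>v v = complex_of_real c \<cdot>\<^sub>v v"
    using assms by (intro eq_vecI) (simp_all add: smult_scalar_prod_distrib[of _ n])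
  then show ?thesis
    using assms by (simp add: cscalar_prod_eq_vnorm smult_scalar_prod_distrib[of v n])
qed

text \<open>A family \<open>H\<close> can be assembled by choice from one matrix per direction,
  since no dependence on \<open>s\<close> is prescribed. Only the constant has to be found before
  \<open>s\<close>.\<close>

lemma strongly_hyperbolic_iff_symmetrizer:
  "strongly_hyperbolic N S \<longleftrightarrow>
     (\<exists>C>0. \<forall>s. norm s = 1 \<longrightarrow> (\<exists>H. symmetrizer (total_dim N S) C (principal_symbol N S s) H))"
    (is "?L \<longleftrightarrow> ?R")
proof -
  have eq: "symmetrizer n C P H \<longleftrightarrow> hermitian_mat n H \<and> H * P = mat_adjoint P * H \<and>
      mat_le n (complex_of_real (inverse C) \<cdot>\<^sub>m 1\<^sub>m n) H \<and> mat_le n H (complex_of_real C \<cdot>\<^sub>m 1\<^sub>m n)"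
    for n C P H
    unfolding symmetrizer_def hermitian_mat_def mat_le_def
    by (auto simp only: Re_smult_one_mat)
  have "?L \<longleftrightarrow> (\<exists>C H. C > 0 \<and> (\<forall>s. norm s = 1 \<longrightarrow>
      symmetrizer (total_dim N S) C (principal_symbol N S s) (H s)))"
    unfolding strongly_hyperbolic_def eq ..
  also have "\<dots> \<longleftrightarrow> ?R" by metis
  finally show ?thesis .
qed

text \<open>The adjoint of \<open>M * J = J * P\<close> lets \<open>mat_adjoint M\<close> pass
  through \<open>mat_adjoint J\<close> and become \<open>mat_adjoint P\<close>. The bounds keep the
  same constant because \<open>J\<close> preserves norms.\<close>

lemma symmetrizer_restrict:
  assumes c: "P \<in> carrier_mat n n" "M \<in> carrier_mat m m" "J \<in> carrier_mat m n"
    and JJ: "mat_adjoint J * J = 1\<^sub>m n" and MJ: "M * J = J * P" and H: "symmetrizer m C M H"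
  shows "symmetrizer n C P (mat_adjoint J * H * J)"
proof -
  let ?Jh = "mat_adjoint J"
  have Hc: "H \<in> carrier_mat m m" and Hh: "mat_adjoint H = H" and HM: "H * M = mat_adjoint M * H"
    and Hb: "\<And>v. v \<in> carrier_vec m \<Longrightarrow> inverse C * (vnorm v)\<^sup>2 \<le> Re ((H *\<^sub>v v) \<bullet>c v) \<and>
        Re ((H *\<^sub>v v) \<bullet>c v) \<le> C * (vnorm v)\<^sup>2"
    using H by (auto simp: symmetrizer_def)
  have Jhc: "?Jh \<in> carrier_mat n m" and Mhc: "mat_adjoint M \<in> carrier_mat m m"
    and Phc: "mat_adjoint P \<in> carrier_mat n n" using c by auto
  note cs = c Hc Jhc Mhc Phc
  have MJ': "?Jh * mat_adjoint M = mat_adjoint P * ?Jh"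
    using arg_cong[OF MJ, of mat_adjoint] mat_adjoint_mult[OF c(2) c(3)] mat_adjoint_mult[OF c(3) c(1)]
    by simp
  have "?Jh * H * J * P = ?Jh * H * (J * P)"
    using cs by (intro assoc_mult_mat[of _ n m _ n _ n]) auto
  also have "\<dots> = ?Jh * H * (M * J)" by (simp add: MJ)
  also have "\<dots> = ?Jh * (H * M) * J"
    using cs by (simp add: assoc_mult_mat[of _ n m _ m _ n] assoc_mult_mat[of _ n m _ m _ m]
        assoc_mult_mat[of _ m m _ m _ n])
  also have "\<dots> = (?Jh * mat_adjoint M) * H * J"
    using cs by (simp add: HM assoc_mult_mat[of _ n m _ m _ m, symmetric])
  also have "\<dots> = mat_adjoint P * (?Jh * H) * J"
    unfolding MJ' using cs by (subst assoc_mult_mat[of _ n n _ m _ m]) auto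
  also have "\<dots> = mat_adjoint P * (?Jh * H * J)"
    using cs by (intro assoc_mult_mat[of _ n n _ m _ n]) auto
  finally have 1: "?Jh * H * J * P = mat_adjoint P * (?Jh * H * J)" .
  have "mat_adjoint (?Jh * H * J) = ?Jh * mat_adjoint (?Jh * H)"
    using cs by (intro mat_adjoint_mult) auto
  also have "mat_adjoint (?Jh * H) = H * J"
    using mat_adjoint_mult[OF Jhc Hc] by (simp add: Hh)
  also have "?Jh * (H * J) = ?Jh * H * J"
    using cs by (intro assoc_mult_mat[symmetric]) auto
  finally have 2: "mat_adjoint (?Jh * H * J) = ?Jh * H * J" .
  have 3: "((?Jh * H * J) *\<^sub>v v) \<bullet>c v = (H *\<^sub>v (J *\<^sub>v v)) \<bullet>c (J *\<^sub>v v)" if v: "v \<in> carrier_vec n" for v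
  proof -
    have "(?Jh * H * J) *\<^sub>v v = (?Jh * H) *\<^sub>v (J *\<^sub>v v)"
      by (rule assoc_mult_mat_vec[OF mult_carrier_mat[OF Jhc Hc] c(3) v])
    also have "\<dots> = ?Jh *\<^sub>v (H *\<^sub>v (J *\<^sub>v v))"
      by (rule assoc_mult_mat_vec[OF Jhc Hc mult_mat_vec_carrier[OF c(3) v]])
    finally have eq: "(?Jh * H * J) *\<^sub>v v = ?Jh *\<^sub>v (H *\<^sub>v (J *\<^sub>v v))" .
    show ?thesis
      unfolding eq using cscalar_prod_mat_adjoint[OF c(3), of "H *\<^sub>v (J *\<^sub>v v)" v] cs v by simp
  qed
  show ?thesis
    unfolding symmetrizer_def
  proof (intro conjI ballI)
    fix v :: "complex Matrix.vec" assume v: "v \<in> carrier_vec n"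
    have Jv: "J *\<^sub>v v \<in> carrier_vec m" using c v by auto
    show "inverse C * (vnorm v)\<^sup>2 \<le> Re (((?Jh * H * J) *\<^sub>v v) \<bullet>c v)"
      "Re (((?Jh * H * J) *\<^sub>v v) \<bullet>c v) \<le> C * (vnorm v)\<^sup>2"
      using Hb[OF Jv] by (simp_all add: 3[OF v] vnorm_isometry[OF c(3) JJ v])
  next
    show "?Jh * H * J \<in> carrier_mat n n" using cs by auto
  qed (fact 2, fact 1)
qed


section \<open>Decoupling by a Sylvester equation\<close>

text \<open>With \<open>p\<close> a bound on \<open>P\<close>, the shift exceeds the bound
  \<open>p^2\<close> on \<open>P * P\<close> by exactly 1, so \<open>T\<close> does not shrink any
  vector: it is injective, hence invertible, and its inverse has norm at most 1. Shifting the square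
  treats both tangential eigenvalues of \<open>R\<close>, which differ in sign, with a single
  inverse.\<close>

lemma inverse_of_square_shift_exists:
  fixes P :: "complex mat"
  assumes P: "P \<in> carrier_mat n n"
    and p: "\<And>v. v \<in> carrier_vec n \<Longrightarrow> vnorm (P *\<^sub>v v) \<le> p * vnorm v" and p0: "0 \<le> p"
  defines "T \<equiv> complex_of_real (p\<^sup>2 + 1) \<cdot>\<^sub>m 1\<^sub>m n - P * P"
  obtains Ti where "Ti \<in> carrier_mat n n" "Ti * T = 1\<^sub>m n" "T * Ti = 1\<^sub>m n"
    "\<And>v. v \<in> carrier_vec n \<Longrightarrow> vnorm (Ti *\<^sub>v v) \<le> vnorm v"
proof -
  have T: "T \<in> carrier_mat n n" using P by (auto simp: T_def)
  have lb: "vnorm v \<le> vnorm (T *\<^sub>v v)" if v: "v \<in> carrier_vec n" for v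
  proof -
    have Pv: "P *\<^sub>v v \<in> carrier_vec n" and PPv: "P *\<^sub>v (P *\<^sub>v v) \<in> carrier_vec n"
      using P v by (auto intro!: mult_mat_vec_carrier[of _ n n])
    have one: "(complex_of_real (p\<^sup>2 + 1) \<cdot>\<^sub>m 1\<^sub>m n) *\<^sub>v v = complex_of_real (p\<^sup>2 + 1) \<cdot>\<^sub>v v"
      using v by (intro eq_vecI) (simp_all add: smult_scalar_prod_distrib[of _ n])
    have Tv: "T *\<^sub>v v = complex_of_real (p\<^sup>2 + 1) \<cdot>\<^sub>v v - P *\<^sub>v (P *\<^sub>v v)"
      unfolding T_def using P v
      by (subst minus_mult_distrib_mat_vec[of _ n n]) (auto simp: one assoc_mult_mat_vec[of _ n n _ n])
    have "complex_of_real (p\<^sup>2 + 1) \<cdot>\<^sub>v v = T *\<^sub>v v + P *\<^sub>v (P *\<^sub>v v)"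
      unfolding Tv using v PPv P by (intro eq_vecI) auto
    moreover have "vnorm (complex_of_real (p\<^sup>2 + 1) \<cdot>\<^sub>v v) = (p\<^sup>2 + 1) * vnorm v"
      unfolding vnorm_smult by (simp only: norm_of_real) (simp add: add_nonneg_nonneg)
    moreover have "vnorm (P *\<^sub>v (P *\<^sub>v v)) \<le> p * (p * vnorm v)"
      by (rule order_trans[OF p[OF Pv] mult_left_mono[OF p[OF v] p0]])
    ultimately have "(p\<^sup>2 + 1) * vnorm v \<le> vnorm (T *\<^sub>v v) + p * (p * vnorm v)"
      using vnorm_add[of "T *\<^sub>v v" n "P *\<^sub>v (P *\<^sub>v v)"] T v PPv
        mult_mat_vec_carrier[OF T v] by (auto simp del: of_real_add)
    then show ?thesis by (simp add: algebra_simps power2_eq_square)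
  qed
  have "Determinant.det T \<noteq> 0"
  proof
    assume "Determinant.det T = 0"
    then obtain v where v: "v \<in> carrier_vec n" "v \<noteq> 0\<^sub>v n" "T *\<^sub>v v = 0\<^sub>v n"
      using det_0_iff_vec_prod_zero_field[OF T] by blast
    then have "vnorm (T *\<^sub>v v) = 0" using vnorm_zero_iff[of "0\<^sub>v n" n] by simp
    then show False using lb[OF v(1)] vnorm_nonneg[of v] vnorm_zero_iff[OF v(1)] v(2) by simp
  qed
  from det_non_zero_imp_unit[OF T this, of "()"] obtain Ti
    where Ti: "Ti \<in> carrier_mat n n" "Ti * T = 1\<^sub>m n" "T * Ti = 1\<^sub>m n"
    unfolding Units_def ring_mat_def by auto
  moreover have "vnorm (Ti *\<^sub>v v) \<le> vnorm v" if v: "v \<in> carrier_vec n" for v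
  proof -
    have "T *\<^sub>v (Ti *\<^sub>v v) = v"
      using assoc_mult_mat_vec[OF T Ti(1) v] Ti(3) v by simp
    then show ?thesis using lb[OF mult_mat_vec_carrier[OF Ti(1) v]] by simp
  qed
  ultimately show ?thesis by (rule that)
qed

text \<open>A solution \<open>X\<close> of the Sylvester equation \<open>P X - X R = Q\<close> is
  \<open>X = (P\<^sup>2 - \<lambda>\<^sup>2)\<^sup>-\<^sup>1 (P Q + Q R)\<close>, because \<open>Q R\<^sup>2 = \<lambda>\<^sup>2 Q\<close>; it makes \<open>J\<^sup>\<dagger> + X\<close>
  intertwine \<open>M\<close> and \<open>P\<close>.\<close>

lemma intertwiner_exists:
  fixes P M J W R Z :: "complex mat"
  assumes P: "P \<in> carrier_mat n n" and M: "M \<in> carrier_mat m m" and J: "J \<in> carrier_mat m n"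
    and W: "W \<in> carrier_mat n m" and R: "R \<in> carrier_mat m m" and Z: "Z \<in> carrier_mat m m"
    and JJ: "mat_adjoint J * J = 1\<^sub>m n" and MJ: "M * J = J * P"
    and MW: "M = J * W + R" and JR: "mat_adjoint J * R = 0\<^sub>m n m" and Rh: "mat_adjoint R = R"
    and JZ: "mat_adjoint J * Z = 0\<^sub>m n m" and WZ: "W * Z = 0\<^sub>m n m"
    and RR: "R * R = complex_of_real (p\<^sup>2 + 1) \<cdot>\<^sub>m (1\<^sub>m m - (J * mat_adjoint J + Z))"
    and p: "\<And>v. v \<in> carrier_vec n \<Longrightarrow> vnorm (P *\<^sub>v v) \<le> p * vnorm v" and p0: "0 \<le> p"
    and k: "\<And>v. v \<in> carrier_vec m \<Longrightarrow> vnorm (M *\<^sub>v v) \<le> k * vnorm v" and k0: "0 \<le> k"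
  obtains X where "X \<in> carrier_mat n m" "X * J = 0\<^sub>m n n"
    "(mat_adjoint J + X) * M = P * (mat_adjoint J + X)"
    "\<And>v. v \<in> carrier_vec m \<Longrightarrow> vnorm (X *\<^sub>v v) \<le> (p * (k + p) + (k + p) * (2 * k)) * vnorm v"
proof -
  define Jh where "Jh = mat_adjoint J"
  \<comment> \<open>Here \<open>l\<close> is the square of the tangential eigenvalues of
    \<open>R\<close>; in the curl reduction the letter denotes the eigenvalue itself.\<close>
  define l where "l = complex_of_real (p\<^sup>2 + 1)"
  define T where "T = l \<cdot>\<^sub>m 1\<^sub>m n - P * P"
  \<comment> \<open>If \<open>X * J = 0\<close>, then \<open>Jh * M = W\<close> and
    \<open>X * M = X * R\<close>, so the intertwining relation for \<open>Jh + X\<close> reads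
    \<open>W + X * R = P * Jh + P * X\<close>. Thus \<open>Q\<close> is the right-hand side of the
    Sylvester equation.\<close>
  define Q where "Q = W - P * Jh"
  define G where "G = P * Q + Q * R"
  have Jh: "Jh \<in> carrier_mat n m" using J by (auto simp: Jh_def)
  have Q: "Q \<in> carrier_mat n m" using W P Jh by (auto simp: Q_def)
  have G: "G \<in> carrier_mat n m" using Q P R by (auto simp: G_def)
  have T: "T \<in> carrier_mat n n" using P by (auto simp: T_def)
  obtain Ti where Ti: "Ti \<in> carrier_mat n n" "Ti * T = 1\<^sub>m n" "T * Ti = 1\<^sub>m n"
    and Tib: "\<And>v. v \<in> carrier_vec n \<Longrightarrow> vnorm (Ti *\<^sub>v v) \<le> vnorm v"
    using inverse_of_square_shift_exists[OF P p p0] unfolding T_def l_def by blast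
  define X where "X = - (Ti * G)"
  have X: "X \<in> carrier_mat n m" using Ti G by (auto simp: X_def)
  have RJ: "R * J = 0\<^sub>m m n"
    using arg_cong[OF JR, of mat_adjoint] mat_adjoint_mult[of "mat_adjoint J" n m R m] J R Rh by simp
  have JhM: "Jh * M = W"
  proof -
    have "Jh * M = Jh * (J * W) + Jh * R"
      unfolding MW using Jh J W R by (intro mult_add_distrib_mat[of _ n m _ m]) auto
    also have "Jh * (J * W) = W" using Jh J W JJ by (simp add: assoc_mult_mat[of _ n m _ n _ m, symmetric] Jh_def)
    finally show ?thesis using JR W by (simp add: Jh_def)
  qed
  have WJ: "W * J = P"
    using MJ Jh M J P JJ by (simp add: JhM[symmetric] assoc_mult_mat[of Jh n m M m J n] )
      (simp add: assoc_mult_mat[of _ n m _ n _ n, symmetric] Jh_def)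
  have QJ: "Q * J = 0\<^sub>m n n"
    unfolding Q_def using W P Jh J WJ JJ
    by (simp add: minus_mult_distrib_mat[of _ n m _ _ n] assoc_mult_mat[of _ n n _ m _ n] Jh_def)
  have QZ: "Q * Z = 0\<^sub>m n m"
    unfolding Q_def using W P Jh Z WZ JZ
    by (simp add: minus_mult_distrib_mat[of _ n m _ _ m] assoc_mult_mat[of _ n n _ m _ m] Jh_def)
  \<comment> \<open>\<open>R * R\<close> is \<open>l\<close> times the projection that removes the
    range of \<open>J\<close> and the part \<open>Z\<close>; \<open>Q\<close> vanishes on both, so
    it does not notice the removal.\<close>
  have QRR: "Q * (R * R) = l \<cdot>\<^sub>m Q"
  proof -
    have "Q * (J * Jh + Z) = (Q * J) * Jh + Q * Z"
      using Q J Jh Z by (simp add: mult_add_distrib_mat[of _ n m _ m] assoc_mult_mat[of _ n m _ n _ m])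
    also have "\<dots> = 0\<^sub>m n m" using Jh by (simp add: QJ QZ)
    finally have 0: "Q * (J * Jh + Z) = 0\<^sub>m n m" .
    have "Q * (1\<^sub>m m - (J * Jh + Z)) = Q"
      using Q J Jh Z by (subst mult_minus_distrib_mat[of _ n m _ m]) (auto simp: 0)
    moreover have "1\<^sub>m m - (J * Jh + Z) \<in> carrier_mat m m" using J Jh Z by auto
    ultimately show ?thesis
      using Q by (simp add: RR l_def Jh_def mult_smult_distrib[of _ n m _ m] del: of_real_add)
  qed
  have XJ: "X * J = 0\<^sub>m n n"
  proof -
    have "G * J = 0\<^sub>m n n"
      unfolding G_def using P Q R J
      by (simp add: add_mult_distrib_mat[of _ n m _ _ n] assoc_mult_mat[of _ n n _ m _ n]
          assoc_mult_mat[of _ n m _ m _ n] QJ RJ)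
    then have "X * J = - 0\<^sub>m n n"
      unfolding X_def using Ti G J by (simp add: assoc_mult_mat[of _ n n _ m _ n])
    also have "\<dots> = 0\<^sub>m n n" by (intro eq_matI) auto
    finally show ?thesis .
  qed
  have TX: "T * X = - G"
    unfolding X_def using T Ti G
    by (simp add: assoc_mult_mat[of _ n n _ n _ m, symmetric])
  have TP: "T * P = P * T"
    unfolding T_def using P
    by (simp add: minus_mult_distrib_mat[of _ n n _ _ n] mult_minus_distrib_mat[of _ n n _ n]
        mult_smult_distrib[of _ n n _ n] mult_smult_assoc_mat[of _ n n _ n] assoc_mult_mat[of _ n n _ n _ n])
  have TQ: "T * Q = l \<cdot>\<^sub>m Q - P * (P * Q)"
    unfolding T_def using P Q
    by (simp add: minus_mult_distrib_mat[of _ n n _ _ m] mult_smult_assoc_mat[of _ n n _ m]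
        assoc_mult_mat[of _ n n _ n _ m])
  have PG: "P * G = P * (P * Q) + P * (Q * R)"
    unfolding G_def using P Q R by (simp add: mult_add_distrib_mat[of _ n n _ m])
  have GR: "G * R = P * (Q * R) + l \<cdot>\<^sub>m Q"
    unfolding G_def using P Q R
    by (simp add: add_mult_distrib_mat[of _ n m _ _ m] assoc_mult_mat[of _ n n _ m _ m]
        assoc_mult_mat[of _ n m _ m _ m] QRR)
  \<comment> \<open>\<open>T\<close> commutes with \<open>P\<close>, and \<open>T * X = - G\<close>.
    In the difference of the two products the mixed term \<open>P * (Q * R)\<close> cancels, which
    leaves \<open>l Q - P * (P * Q) = T * Q\<close>; then \<open>T\<close> is cancelled by
    \<open>Ti\<close>.\<close>
  have "T * (P * X) = - (P * G)"
    using T P X G TX by (simp add: assoc_mult_mat[of T n n P n X m, symmetric] TP assoc_mult_mat[of P n n T n X m])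
  moreover have "T * (X * R) = - (G * R)"
    using T X R TX G by (simp add: assoc_mult_mat[of T n n X m R m, symmetric])
  ultimately have "T * (P * X - X * R) = - (P * G) - (- (G * R))"
    using T P X R by (simp add: mult_minus_distrib_mat[of _ n n _ m])
  also have "\<dots> = T * Q"
    unfolding PG GR TQ using P Q R by (intro eq_matI) auto
  finally have "Ti * (T * (P * X - X * R)) = Ti * (T * Q)" by simp
  moreover have "Ti * (T * D) = D" if "D \<in> carrier_mat n m" for D
    using assoc_mult_mat[OF Ti(1) T that] Ti(2) that by simp
  ultimately have syl: "P * X - X * R = Q"
    using P X R Q by (metis minus_carrier_mat mult_carrier_mat)
  have "(Jh + X) * M = Jh * M + X * M"
    using Jh X M by (rule add_mult_distrib_mat)
  also have "X * M = X * R"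
  proof -
    have "X * M = (X * J) * W + X * R"
      unfolding MW using X J W R
      by (simp add: mult_add_distrib_mat[of _ n m _ m] assoc_mult_mat[of _ n m _ n _ m])
    then show ?thesis using W X R by (simp add: XJ)
  qed
  also have "Jh * M + X * R = P * Jh + P * X"
  proof (rule eq_matI)
    fix i j assume ij: "i < dim_row (P * Jh + P * X)" "j < dim_col (P * Jh + P * X)"
    then have ij': "i < n" "j < m" using P X by auto
    have "(P * X - X * R) $$ (i, j) = (W - P * Jh) $$ (i, j)" by (simp only: syl Q_def)
    then have "(P * X) $$ (i, j) - (X * R) $$ (i, j) = W $$ (i, j) - (P * Jh) $$ (i, j)"
      using ij' P X R W Jh by (simp del: index_mult_mat(1))
    moreover have "(W + X * R) $$ (i, j) = W $$ (i, j) + (X * R) $$ (i, j)"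
      using ij' X R W by (simp del: index_mult_mat(1))
    moreover have "(P * Jh + P * X) $$ (i, j) = (P * Jh) $$ (i, j) + (P * X) $$ (i, j)"
      using ij' P X by (simp del: index_mult_mat(1))
    ultimately show "(Jh * M + X * R) $$ (i, j) = (P * Jh + P * X) $$ (i, j)"
      unfolding JhM by (simp add: algebra_simps)
  qed (use P X Jh M R in auto)
  also have "\<dots> = P * (Jh + X)"
    using P Jh X by (intro mult_add_distrib_mat[symmetric]) auto
  finally have YM: "(Jh + X) * M = P * (Jh + X)" .
  have Xb: "vnorm (X *\<^sub>v v) \<le> (p * (k + p) + (k + p) * (2 * k)) * vnorm v" if v: "v \<in> carrier_vec m" for v
  proof -
    note mv = mult_mat_vec_carrier
    have Jhb: "vnorm (Jh *\<^sub>v u) \<le> vnorm u" if "u \<in> carrier_vec m" for u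
      unfolding Jh_def by (rule vnorm_adjoint_isometry_le[OF J JJ that])
    \<comment> \<open>All bounds come from that on \<open>M\<close>: \<open>W = Jh * M\<close> gives
      \<open>k\<close>, \<open>R = M - J * W\<close> gives \<open>2 * k\<close>, and
      \<open>Q = W - P * Jh\<close> gives \<open>k + p\<close>. With \<open>Ti\<close> of norm at
      most 1 they add up to the constant for \<open>X\<close>.\<close>
    have Wb: "vnorm (W *\<^sub>v u) \<le> k * vnorm u" if u: "u \<in> carrier_vec m" for u
      using order_trans[OF Jhb[OF mv[OF M u]] k[OF u]] assoc_mult_mat_vec[OF Jh M u] by (simp add: JhM)
    have Rb: "vnorm (R *\<^sub>v u) \<le> 2 * k * vnorm u" if u: "u \<in> carrier_vec m" for u
    proof -
      have c: "J *\<^sub>v (W *\<^sub>v u) \<in> carrier_vec m" "R *\<^sub>v u \<in> carrier_vec m" "W *\<^sub>v u \<in> carrier_vec n"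
        using J W R u by (auto intro!: mv[of _ m n] mv[of _ n m] mv[of _ m m])
      have "M *\<^sub>v u = J *\<^sub>v (W *\<^sub>v u) + R *\<^sub>v u"
        unfolding MW using J W R u
        by (simp add: add_mult_distrib_mat_vec[of _ m m] assoc_mult_mat_vec[of _ m n _ m])
      moreover have "x + y - x = y" if "x \<in> carrier_vec m" "y \<in> carrier_vec m"
        for x y :: "complex Matrix.vec"
        using that by (intro eq_vecI) auto
      ultimately have "R *\<^sub>v u = M *\<^sub>v u - J *\<^sub>v (W *\<^sub>v u)"
        using c by metis
      then have "vnorm (R *\<^sub>v u) \<le> vnorm (M *\<^sub>v u) + vnorm (J *\<^sub>v (W *\<^sub>v u))"
        using vnorm_minus[OF mv[OF M u] c(1)] by simp
      then show ?thesis
        using k[OF u] Wb[OF u] vnorm_isometry[OF J JJ c(3)] by simp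
    qed
    have Qb: "vnorm (Q *\<^sub>v u) \<le> (k + p) * vnorm u" if u: "u \<in> carrier_vec m" for u
    proof -
      have c: "Jh *\<^sub>v u \<in> carrier_vec n" "P *\<^sub>v (Jh *\<^sub>v u) \<in> carrier_vec n" "W *\<^sub>v u \<in> carrier_vec n"
        using Jh P W u by (auto intro!: mv[of _ n n] mv[of _ n m])
      have "Q *\<^sub>v u = W *\<^sub>v u - P *\<^sub>v (Jh *\<^sub>v u)"
        unfolding Q_def using W P Jh u
        by (simp add: minus_mult_distrib_mat_vec[of _ n m] assoc_mult_mat_vec[of _ n n _ m])
      then have "vnorm (Q *\<^sub>v u) \<le> vnorm (W *\<^sub>v u) + vnorm (P *\<^sub>v (Jh *\<^sub>v u))"
        using vnorm_minus[OF c(3,2)] by simp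
      also have "\<dots> \<le> k * vnorm u + p * vnorm u"
        by (intro add_mono Wb[OF u] order_trans[OF p[OF c(1)]] mult_left_mono[OF Jhb[OF u] p0])
      finally show ?thesis by (simp add: algebra_simps)
    qed
    have Rv: "R *\<^sub>v v \<in> carrier_vec m" and Qv: "Q *\<^sub>v v \<in> carrier_vec n"
      and PQv: "P *\<^sub>v (Q *\<^sub>v v) \<in> carrier_vec n" and QRv: "Q *\<^sub>v (R *\<^sub>v v) \<in> carrier_vec n"
      and Gv: "G *\<^sub>v v \<in> carrier_vec n"
      using R Q P G v by (auto intro!: mv[of _ n n] mv[of _ n m] mv[of _ m m])
    have "G *\<^sub>v v = P *\<^sub>v (Q *\<^sub>v v) + Q *\<^sub>v (R *\<^sub>v v)"
      unfolding G_def using P Q R v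
      by (simp add: add_mult_distrib_mat_vec[of _ n m] assoc_mult_mat_vec[of _ n n _ m]
          assoc_mult_mat_vec[of _ n m _ m])
    then have "vnorm (G *\<^sub>v v) \<le> vnorm (P *\<^sub>v (Q *\<^sub>v v)) + vnorm (Q *\<^sub>v (R *\<^sub>v v))"
      using vnorm_add[OF PQv QRv] by simp
    also have "\<dots> \<le> p * ((k + p) * vnorm v) + (k + p) * (2 * k * vnorm v)"
      using p0 k0
      by (intro add_mono order_trans[OF p[OF Qv]] order_trans[OF Qb[OF Rv]] mult_left_mono
          Qb[OF v] Rb[OF v]) auto
    finally have Gb: "vnorm (G *\<^sub>v v) \<le> (p * (k + p) + (k + p) * (2 * k)) * vnorm v"
      by (simp add: algebra_simps)
    have "X *\<^sub>v v = - (Ti *\<^sub>v (G *\<^sub>v v))"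
      unfolding X_def using Ti G v
      by (simp add: uminus_mult_mat_vec assoc_mult_mat_vec[of _ n n _ m])
    then have "vnorm (X *\<^sub>v v) \<le> vnorm (G *\<^sub>v v)"
      using Tib[OF Gv] by (simp add: vnorm_uminus)
    with Gb show ?thesis by simp
  qed
  show ?thesis
    using that[OF X XJ _ Xb] YM by (simp add: Jh_def)
qed


text \<open>With \<open>Y = Jh + X\<close>, the matrix \<open>H'\<close> is the pullback of
  \<open>H\<close> along \<open>Y\<close> plus the projection onto the complement of the range of
  \<open>J\<close>. Since \<open>Y * M = P * Y\<close>, the product \<open>H' * M\<close> equals
  \<open>Yh * ((H * P) * Y) + R\<close>, which is Hermitian because \<open>H * P\<close> and
  \<open>R\<close> are; for Hermitian \<open>H'\<close> this is the symmetrizer equation. Positivity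
  holds because \<open>Y v\<close> and the complementary part of \<open>v\<close> together determine
  \<open>v\<close>.\<close>

lemma symmetrizer_extend:
  fixes P M J W R Z :: "complex mat"
  assumes P: "P \<in> carrier_mat n n" and M: "M \<in> carrier_mat m m" and J: "J \<in> carrier_mat m n"
    and W: "W \<in> carrier_mat n m" and R: "R \<in> carrier_mat m m" and Z: "Z \<in> carrier_mat m m"
    and JJ: "mat_adjoint J * J = 1\<^sub>m n" and MJ: "M * J = J * P"
    and MW: "M = J * W + R" and JR: "mat_adjoint J * R = 0\<^sub>m n m" and Rh: "mat_adjoint R = R"
    and JZ: "mat_adjoint J * Z = 0\<^sub>m n m" and WZ: "W * Z = 0\<^sub>m n m"
    and RR: "R * R = complex_of_real (p\<^sup>2 + 1) \<cdot>\<^sub>m (1\<^sub>m m - (J * mat_adjoint J + Z))"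
    and p: "\<And>v. v \<in> carrier_vec n \<Longrightarrow> vnorm (P *\<^sub>v v) \<le> p * vnorm v" and p0: "0 \<le> p"
    and k: "\<And>v. v \<in> carrier_vec m \<Longrightarrow> vnorm (M *\<^sub>v v) \<le> k * vnorm v" and k0: "0 \<le> k"
    and H: "symmetrizer n C P H" and C: "0 < C"
    and c_def: "c = p * (k + p) + (k + p) * (2 * k)"
    and K_def: "K = C * (1 + c)\<^sup>2 + 2 * C + 2 * c\<^sup>2 + 1"
  shows "\<exists>H'. symmetrizer m K M H'"
proof -
  obtain X where X: "X \<in> carrier_mat n m" and XJ: "X * J = 0\<^sub>m n n"
    and YM: "(mat_adjoint J + X) * M = P * (mat_adjoint J + X)"
    and Xb: "\<And>v. v \<in> carrier_vec m \<Longrightarrow> vnorm (X *\<^sub>v v) \<le> c * vnorm v"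
    using intertwiner_exists[OF P M J W R Z JJ MJ MW JR Rh JZ WZ RR p p0 k k0] unfolding c_def by blast
  define Jh where "Jh = mat_adjoint J"
  define Y where "Y = Jh + X"
  define Yh where "Yh = mat_adjoint Y"
  define H' where "H' = Yh * (H * Y) + (1\<^sub>m m - J * Jh)"
  have Hc: "H \<in> carrier_mat n n" and Hh: "mat_adjoint H = H" and HP: "H * P = mat_adjoint P * H"
    and Hb: "\<And>v. v \<in> carrier_vec n \<Longrightarrow> inverse C * (vnorm v)\<^sup>2 \<le> Re ((H *\<^sub>v v) \<bullet>c v) \<and>
        Re ((H *\<^sub>v v) \<bullet>c v) \<le> C * (vnorm v)\<^sup>2"
    using H by (auto simp: symmetrizer_def)
  have Jh: "Jh \<in> carrier_mat n m" using J by (auto simp: Jh_def)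
  have Y: "Y \<in> carrier_mat n m" and Yh: "Yh \<in> carrier_mat m n" using Jh X by (auto simp: Y_def Yh_def)
  have H': "H' \<in> carrier_mat m m" using J Jh Y Yh Hc by (auto simp: H'_def)
  have c0: "0 \<le> c" using p0 k0 by (simp add: c_def)
  have HY: "H * Y \<in> carrier_mat n m" and YHY: "Yh * (H * Y) \<in> carrier_mat m m"
    using Hc Y Yh by auto
  have JhM: "Jh * M = W"
  proof -
    have "Jh * M = Jh * (J * W) + Jh * R"
      unfolding MW using Jh J W R by (intro mult_add_distrib_mat[of _ n m _ m]) auto
    also have "Jh * (J * W) = W" using Jh J W JJ by (simp add: assoc_mult_mat[of _ n m _ n _ m, symmetric] Jh_def)
    finally show ?thesis using JR W by (simp add: Jh_def)
  qed
  have hermH': "mat_adjoint H' = H'"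
  proof -
    have "mat_adjoint (Yh * (H * Y)) = Yh * (H * Y)"
      using Yh HY Hc Y
      by (simp add: mat_adjoint_mult[of _ m n _ m] mat_adjoint_mult[of _ n n _ m] Hh Yh_def
          assoc_mult_mat[of _ m n _ n _ m])
    moreover have "mat_adjoint (1\<^sub>m m - J * Jh) = 1\<^sub>m m - J * Jh"
      using J Jh by (simp add: mat_adjoint_minus[of _ m m] mat_adjoint_mult[of _ m n _ m] Jh_def)
    ultimately show ?thesis
      unfolding H'_def using YHY J Jh by (subst mat_adjoint_add[of _ m m]) auto
  qed
  \<comment> \<open>On the complement the identity is a sufficient symmetrizer: the projection cuts
    off \<open>J * W\<close> and leaves the Hermitian \<open>R\<close>.\<close>
  have EM: "(1\<^sub>m m - J * Jh) * M = R"
  proof -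
    have "(1\<^sub>m m - J * Jh) * M = M - J * W"
      using J Jh M JhM by (simp add: minus_mult_distrib_mat[of _ m m _ _ m] assoc_mult_mat[of J m n Jh m M m])
    also have "\<dots> = R"
      unfolding MW using J W R by (intro eq_matI) auto
    finally show ?thesis .
  qed
  have HPh: "mat_adjoint (H * P) = H * P"
    using mat_adjoint_mult[OF Hc P] by (simp add: Hh HP)
  define F where "F = Yh * ((H * P) * Y)"
  have Fc: "F \<in> carrier_mat m m" using Yh Hc P Y by (auto simp: F_def)
  have Fh: "mat_adjoint F = F"
  proof -
    have "mat_adjoint F = (Yh * (H * P)) * Y"
      unfolding F_def using Yh Hc P Y
      by (subst mat_adjoint_mult[of _ m n _ m], simp, simp, subst mat_adjoint_mult[of _ n n _ m])
        (auto simp: HPh Yh_def)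
    also have "\<dots> = F"
      unfolding F_def using Yh Hc P Y by (intro assoc_mult_mat[of _ m n _ n _ m]) auto
    finally show ?thesis .
  qed
  have H'M: "H' * M = F + R"
  proof -
    have YM': "Y * M = P * Y" using YM by (simp add: Y_def Jh_def)
    have "Yh * (H * Y) * M = Yh * (H * Y * M)"
      using Yh HY M by (intro assoc_mult_mat[of _ m n _ m _ m]) auto
    also have "H * Y * M = H * (Y * M)"
      using Hc Y M by (intro assoc_mult_mat[of _ n n _ m _ m]) auto
    also have "\<dots> = H * P * Y"
      unfolding YM' using Hc P Y by (intro assoc_mult_mat[symmetric, of _ n n _ n _ m]) auto
    finally show ?thesis
      unfolding H'_def F_def using YHY J Jh M EM by (subst add_mult_distrib_mat[of _ m m _ _ m]) auto
  qed
  have "H' * M = mat_adjoint (H' * M)"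
    unfolding H'M using Fc R by (simp add: mat_adjoint_add[of _ m m] Fh Rh)
  then have sym: "H' * M = mat_adjoint M * H'"
    using mat_adjoint_mult[OF H' M] by (simp add: hermH')
  have bounds: "inverse K * (vnorm v)\<^sup>2 \<le> Re ((H' *\<^sub>v v) \<bullet>c v) \<and> Re ((H' *\<^sub>v v) \<bullet>c v) \<le> K * (vnorm v)\<^sup>2"
    if v: "v \<in> carrier_vec m" for v
  proof -
    note mv = mult_mat_vec_carrier
    define e where "e = v - J *\<^sub>v (Jh *\<^sub>v v)"
    have cs: "Jh *\<^sub>v v \<in> carrier_vec n" "X *\<^sub>v v \<in> carrier_vec n" "Y *\<^sub>v v \<in> carrier_vec n"
      using mv[OF Jh v] mv[OF X v] mv[OF Y v] by auto
    have JJv: "J *\<^sub>v (Jh *\<^sub>v v) \<in> carrier_vec m" using mv[OF J cs(1)] .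
    have e: "e \<in> carrier_vec m" using v JJv by (auto simp: e_def)
    have pyth: "(vnorm (Jh *\<^sub>v v))\<^sup>2 + (vnorm e)\<^sup>2 = (vnorm v)\<^sup>2"
      using vnorm_adjoint_isometry(1)[OF J JJ v] by (simp add: e_def Jh_def)
    \<comment> \<open>Since \<open>X\<close> vanishes on the range of \<open>J\<close>, only the
      complementary part \<open>e\<close> of \<open>v\<close> contributes; this is what makes the
      lower bound possible.\<close>
    have Xv: "X *\<^sub>v v = X *\<^sub>v e"
    proof -
      have "X *\<^sub>v (J *\<^sub>v (Jh *\<^sub>v v)) = 0\<^sub>m n n *\<^sub>v (Jh *\<^sub>v v)"
        using assoc_mult_mat_vec[OF X J cs(1)] XJ by simp
      also have "\<dots> = 0\<^sub>v n" using cs(1) by (intro eq_vecI) auto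
      finally have "X *\<^sub>v (J *\<^sub>v (Jh *\<^sub>v v)) = 0\<^sub>v n" .
      then show ?thesis
        unfolding e_def using X v JJv cs(2) by (simp add: mult_minus_distrib_mat_vec[of _ n m])
    qed
    have Yv: "Y *\<^sub>v v = Jh *\<^sub>v v + X *\<^sub>v v"
      unfolding Y_def using Jh X v by (intro add_mult_distrib_mat_vec) auto
    have "((Yh * (H * Y)) *\<^sub>v v) \<bullet>c v = (H *\<^sub>v (Y *\<^sub>v v)) \<bullet>c (Y *\<^sub>v v)"
    proof -
      have "(Yh * (H * Y)) *\<^sub>v v = Yh *\<^sub>v (H *\<^sub>v (Y *\<^sub>v v))"
        using Yh Hc HY Y v by (simp add: assoc_mult_mat_vec[of _ m n _ m] assoc_mult_mat_vec[of _ n n _ m])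
      then show ?thesis
        using cscalar_prod_mat_adjoint[OF Y mv[OF Hc cs(3)] v] by (simp add: Yh_def)
    qed
    moreover have "(H' *\<^sub>v v) \<bullet>c v = ((Yh * (H * Y)) *\<^sub>v v) \<bullet>c v + ((1\<^sub>m m - J * Jh) *\<^sub>v v) \<bullet>c v"
    proof -
      have "H' *\<^sub>v v = (Yh * (H * Y)) *\<^sub>v v + (1\<^sub>m m - J * Jh) *\<^sub>v v"
        unfolding H'_def using YHY J Jh v by (intro add_mult_distrib_mat_vec[of _ m m]) auto
      moreover have "1\<^sub>m m - J * Jh \<in> carrier_mat m m" using J Jh by auto
      ultimately show ?thesis
        using mv[OF YHY v] mv[of "1\<^sub>m m - J * Jh" m m v] v
          add_scalar_prod_distrib[of "(Yh * (H * Y)) *\<^sub>v v" m "(1\<^sub>m m - J * Jh) *\<^sub>v v" "conjugate v"]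
        by simp
    qed
    ultimately have form: "Re ((H' *\<^sub>v v) \<bullet>c v) = Re ((H *\<^sub>v (Y *\<^sub>v v)) \<bullet>c (Y *\<^sub>v v)) + (vnorm e)\<^sup>2"
      using vnorm_adjoint_isometry(2)[OF J JJ v] by (simp add: e_def Jh_def)
    have Jhb: "vnorm (Jh *\<^sub>v v) \<le> vnorm v"
      unfolding Jh_def by (rule vnorm_adjoint_isometry_le[OF J JJ v])
    have Yb: "vnorm (Y *\<^sub>v v) \<le> (1 + c) * vnorm v"
      using vnorm_add[OF cs(1,2)] Jhb Xb[OF v] by (simp add: Yv algebra_simps)
    have y2: "(vnorm (Y *\<^sub>v v))\<^sup>2 \<le> (1 + c)\<^sup>2 * (vnorm v)\<^sup>2"
      using power_mono[OF Yb vnorm_nonneg, of 2] by (simp add: power_mult_distrib)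
    have e2: "(vnorm e)\<^sup>2 \<le> (vnorm v)\<^sup>2" using pyth by (metis le_add_same_cancel2 zero_le_power2)
    \<comment> \<open>The first inequality serves the upper bound. The next two serve the lower one,
      where they weight the form of \<open>H\<close> at \<open>Y v\<close> and the square of
      \<open>vnorm e\<close>.\<close>
    have K1: "C * (1 + c)\<^sup>2 + 1 \<le> K" "2 * C \<le> K" "2 * c\<^sup>2 + 1 \<le> K" "0 < K"
      using C c0 by (auto simp: K_def add_nonneg_nonneg add_pos_nonneg)
    have "Re ((H' *\<^sub>v v) \<bullet>c v) \<le> C * ((1 + c)\<^sup>2 * (vnorm v)\<^sup>2) + (vnorm v)\<^sup>2"
      unfolding form using conjunct2[OF Hb[OF cs(3)]] mult_left_mono[OF y2, of C] C e2 by linarith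
    also have "\<dots> \<le> K * (vnorm v)\<^sup>2"
      using mult_right_mono[OF K1(1), of "(vnorm v)\<^sup>2"] by (simp add: algebra_simps)
    finally have upper: "Re ((H' *\<^sub>v v) \<bullet>c v) \<le> K * (vnorm v)\<^sup>2" .
    have "Jh *\<^sub>v v = Y *\<^sub>v v - X *\<^sub>v v"
      unfolding Yv using cs Jh X by (intro eq_vecI) auto
    then have "vnorm (Jh *\<^sub>v v) \<le> vnorm (Y *\<^sub>v v) + c * vnorm e"
      using vnorm_minus[OF cs(3,2)] Xb[OF e] by (simp add: Xv)
    then have "(vnorm (Jh *\<^sub>v v))\<^sup>2 \<le> (vnorm (Y *\<^sub>v v) + c * vnorm e)\<^sup>2"
      by (intro power_mono vnorm_nonneg)
    also have "\<dots> \<le> 2 * (vnorm (Y *\<^sub>v v))\<^sup>2 + 2 * (c * vnorm e)\<^sup>2"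
      using sum_squares_ge_zero[of "vnorm (Y *\<^sub>v v) - c * vnorm e" 0]
      by (simp add: power2_eq_square algebra_simps)
    finally have "(vnorm v)\<^sup>2 \<le> 2 * (vnorm (Y *\<^sub>v v))\<^sup>2 + (2 * c\<^sup>2 + 1) * (vnorm e)\<^sup>2"
      using pyth by (simp add: power_mult_distrib algebra_simps)
    also have "2 * (vnorm (Y *\<^sub>v v))\<^sup>2 \<le> 2 * C * Re ((H *\<^sub>v (Y *\<^sub>v v)) \<bullet>c (Y *\<^sub>v v))"
      using mult_left_mono[OF conjunct1[OF Hb[OF cs(3)]], of "2 * C"] C by (simp add: field_simps)
    also have "\<dots> \<le> K * Re ((H *\<^sub>v (Y *\<^sub>v v)) \<bullet>c (Y *\<^sub>v v))"
    proof (rule mult_right_mono[OF K1(2)])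
      have "0 \<le> inverse C * (vnorm (Y *\<^sub>v v))\<^sup>2" using C by simp
      then show "0 \<le> Re ((H *\<^sub>v (Y *\<^sub>v v)) \<bullet>c (Y *\<^sub>v v))"
        using Hb[OF cs(3)] by linarith
    qed
    also have "(2 * c\<^sup>2 + 1) * (vnorm e)\<^sup>2 \<le> K * (vnorm e)\<^sup>2"
      by (intro mult_right_mono K1) auto
    finally have "(vnorm v)\<^sup>2 \<le> K * Re ((H' *\<^sub>v v) \<bullet>c v)"
      unfolding form by (simp add: algebra_simps)
    then have "inverse K * (vnorm v)\<^sup>2 \<le> Re ((H' *\<^sub>v v) \<bullet>c v)"
      using K1(4) by (simp add: field_simps)
    with upper show ?thesis by blast
  qed
  show ?thesis
    unfolding symmetrizer_def using H' hermH' sym bounds by blast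
qed

section \<open>Regrouped fields and plane waves\<close>

text \<open>The layout of block 0 in \<open>regroup\<close>, with entries of any type: fields,
  numbers or whole coefficient rows. As a cascade of conditionals it lets every function pass
  through, so equations can be compared slot by slot.\<close>

definition slot :: "nat \<Rightarrow> (nat \<Rightarrow> 'a) \<Rightarrow> (3 \<Rightarrow> nat \<Rightarrow> 'a) \<Rightarrow> (nat \<Rightarrow> 'a) \<Rightarrow> nat \<Rightarrow> 'a" where
  "slot n x y z a =
     (if a < n then x a else if a < 2 * n then y 1 (a - n) else if a < 3 * n then y 2 (a - 2 * n)
      else if a < 4 * n then y 3 (a - 3 * n) else z (a - 4 * n))"

lemma regroup_0_eq_slot:
  "a < 4 * n 0 + n 1 \<Longrightarrow> regroup n v d 0 a = slot (n 0) (v 0) d (v 1) a"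
proof -
  have eqs: "n 0 + n 0 = 2 * n 0" "2 * n 0 + n 0 = 3 * n 0" "3 * n 0 + n 0 = 4 * n 0" by simp_all
  assume "a < 4 * n 0 + n 1"
  then show ?thesis
    by (auto simp: regroup_def slot_def nth_append eqs simp del: mult_2 mult_2_right)
qed

lemma slot_comp: "f (slot n x y z a) = slot n (\<lambda>b. f (x b)) (\<lambda>i b. f (y i b)) (\<lambda>b. f (z b)) a"
  by (simp add: slot_def)

lemma slot_comp2:
  "f (slot n x y z a) (slot n x' y' z' a) =
     slot n (\<lambda>b. f (x b) (x' b)) (\<lambda>i b. f (y i b) (y' i b)) (\<lambda>b. f (z b) (z' b)) a"
  by (simp add: slot_def)

lemma slot_cong:
  assumes "a < 4 * n + m"
    and "\<And>b. b < n \<Longrightarrow> x b = x' b" and "\<And>i b. b < n \<Longrightarrow> y i b = y' i b" and "\<And>b. b < m \<Longrightarrow> z b = z' b"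
  shows "slot n x y z a = slot n x' y' z' a"
  using assms by (auto simp: slot_def)

lemma sum_slot:
  fixes x :: "nat \<Rightarrow> 'a :: comm_monoid_add"
  shows "(\<Sum>a<4 * n + m. slot n x y z a) = (\<Sum>b<n. x b) + (\<Sum>i\<in>UNIV. \<Sum>b<n. y i b) + (\<Sum>b<m. z b)"
proof -
  have shift: "(\<Sum>a<p + q. f a) = (\<Sum>a<p. f a) + (\<Sum>b<q. f (p + b))" for p q and f :: "nat \<Rightarrow> 'a"
    by (induction q) (simp_all add: add.assoc)
  let ?f = "slot n x y z"
  have "(\<Sum>a<4 * n + m. ?f a) = (\<Sum>a<n + n + n + n + m. ?f a)"
    by (rule sum.cong) auto
  also have "\<dots> = (\<Sum>b<n. ?f b) + (\<Sum>b<n. ?f (n + b)) + (\<Sum>b<n. ?f (n + n + b))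
      + (\<Sum>b<n. ?f (n + n + n + b)) + (\<Sum>b<m. ?f (n + n + n + n + b))"
    by (simp only: shift)
  also have "\<dots> = (\<Sum>b<n. x b) + (\<Sum>b<n. y 1 b) + (\<Sum>b<n. y 2 b) + (\<Sum>b<n. y 3 b) + (\<Sum>b<m. z b)"
    by (intro arg_cong2[where f = "(+)"] sum.cong) (auto simp: slot_def numeral_eq_Suc)
  also have "\<dots> = (\<Sum>b<n. x b) + (\<Sum>i\<in>UNIV. \<Sum>b<n. y i b) + (\<Sum>b<m. z b)"
    by (simp add: sum_3 add.assoc)
  finally show ?thesis .
qed


section \<open>Plane waves and the principal symbol as a limit\<close>

text \<open>The exponent is real, so each derivative produces \<open>\<tau> * s_k\<close> without a
  power of \<open>\<i>\<close> and the symbol appears in the normalization of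
  \<open>symbol_block\<close>. The growth in \<open>x\<close> is harmless, since the limits are
  evaluated at the origin.\<close>

definition plane_wave :: "real \<Rightarrow> real^3 \<Rightarrow> complex \<Rightarrow> scalar_field" where
  "plane_wave \<tau> s c = (\<lambda>x. c * exp (complex_of_real (\<tau> * inner s x)))"

lemma plane_wave_has_derivative:
  "(plane_wave \<tau> s c has_derivative
     (\<lambda>h. c * exp (complex_of_real (\<tau> * inner s x)) * complex_of_real (\<tau> * inner s h))) (at x)"
proof -
  have d: "((\<lambda>x. complex_of_real (\<tau> * inner s x)) has_derivative (\<lambda>h. complex_of_real (\<tau> * inner s h))) (at x)"
    by (auto intro!: derivative_eq_intros)
  let ?z = "complex_of_real (\<tau> * inner s x)"
  have "(exp has_derivative (\<lambda>h. h * exp ?z)) (at ?z)"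
    using DERIV_exp[of ?z] unfolding has_field_derivative_def
    by (rule has_derivative_eq_rhs) (auto simp: fun_eq_iff)
  from has_derivative_compose[OF d this]
  have "((\<lambda>x. exp (complex_of_real (\<tau> * inner s x))) has_derivative
      (\<lambda>h. complex_of_real (\<tau> * inner s h) * exp ?z)) (at x)" .
  from has_derivative_mult_right[OF this, of c] show ?thesis
    unfolding plane_wave_def by (simp add: mult_ac)
qed

lemma pderiv_dir_plane_wave:
  "pderiv_dir i (plane_wave \<tau> s c) = plane_wave \<tau> s (c * complex_of_real (\<tau> * vec_nth s i))"
proof
  fix x
  show "pderiv_dir i (plane_wave \<tau> s c) x = plane_wave \<tau> s (c * complex_of_real (\<tau> * vec_nth s i)) x"
    unfolding pderiv_dir_def frechet_derivative_at[OF plane_wave_has_derivative, symmetric]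
    by (simp add: plane_wave_def inner_axis mult_ac)
qed

lemma pderivs_plane_wave:
  "pderivs ks (plane_wave \<tau> s c) =
     plane_wave \<tau> s (c * complex_of_real (\<tau> ^ length ks * (\<Prod>k\<leftarrow>ks. vec_nth s k)))"
  by (induction ks) (simp_all add: pderiv_dir_plane_wave mult_ac)

lemma smooth_plane_wave: "smooth_field (plane_wave \<tau> s c)"
  unfolding smooth_field_def pderivs_plane_wave
  using plane_wave_has_derivative differentiable_def by blast

lemma plane_wave_0 [simp]: "plane_wave \<tau> s c 0 = c"
  by (simp add: plane_wave_def)

lemma pderivs_append_single: "pderivs (ks @ [k]) f = pderivs ks (pderiv_dir k f)"
  by (induction ks) simp_all

lemma pderivs_zero [simp]: "pderivs ks (\<lambda>x. 0) = (\<lambda>x. 0)"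
proof -
  \<comment> \<open>The zero field is a plane wave of amplitude 0, so its derivatives are already
    known.\<close>
  have "plane_wave 0 0 0 = (\<lambda>x. 0)" by (simp add: plane_wave_def)
  then show ?thesis using pderivs_plane_wave[of ks 0 0 0] by simp
qed

lemma pderiv_dir_diff:
  assumes "\<And>x. f differentiable (at x)" "\<And>x. g differentiable (at x)"
  shows "pderiv_dir k (\<lambda>x. f x - g x) = (\<lambda>x. pderiv_dir k f x - pderiv_dir k g x)"
proof
  fix x
  have "((\<lambda>x. f x - g x) has_derivative
      (\<lambda>h. frechet_derivative f (at x) h - frechet_derivative g (at x) h)) (at x)"
    using assms by (intro has_derivative_diff) (auto simp: frechet_derivative_works)
  from frechet_derivative_at[OF this]
  show "pderiv_dir k (\<lambda>x. f x - g x) x = pderiv_dir k f x - pderiv_dir k g x"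
    unfolding pderiv_dir_def by metis
qed

lemma pderivs_diff:
  assumes "smooth_field f" "smooth_field g"
  shows "pderivs ks (\<lambda>x. f x - g x) = (\<lambda>x. pderivs ks f x - pderivs ks g x)"
  using assms by (induction ks) (simp_all add: pderiv_dir_diff smooth_field_def)

lemma smooth_pderiv_dir: "smooth_field f \<Longrightarrow> smooth_field (pderiv_dir k f)"
  unfolding smooth_field_def pderivs_append_single[symmetric] by blast

lemma finite_multi_indices [simp]: "finite (multi_indices m)"
  using finite_lists_length_eq[of "UNIV :: 3 set" m] by (simp add: multi_indices_def)

lemma multi_indices_0 [simp]: "multi_indices 0 = {[]}"
  by (auto simp: multi_indices_def)

text \<open>The last index is split off because the corresponding derivative acts first on the
  field: it is the one that \<open>d\<close> replaces.\<close>

lemma sum_multi_indices_snoc: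
  "(\<Sum>ks\<in>multi_indices (Suc m). f ks) = (\<Sum>ks\<in>multi_indices m. \<Sum>k\<in>UNIV. f (ks @ [k]))"
proof -
  have "(\<Sum>ks\<in>multi_indices m. \<Sum>k\<in>UNIV. f (ks @ [k])) =
      (\<Sum>p\<in>multi_indices m \<times> UNIV. f (fst p @ [snd p]))"
    by (simp add: sum.cartesian_product case_prod_beta)
  also have "\<dots> = (\<Sum>ks\<in>multi_indices (Suc m). f ks)"
  proof (rule sum.reindex_bij_witness[of _ "\<lambda>ks. (butlast ks, last ks)" "\<lambda>p. fst p @ [snd p]"])
    fix ks :: "3 list" assume ks: "ks \<in> multi_indices (Suc m)"
    then have "ks \<noteq> []" by (auto simp: multi_indices_def)
    then show "fst (butlast ks, last ks) @ [snd (butlast ks, last ks)] = ks" by simp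
  qed (auto simp: multi_indices_def)
  finally show ?thesis by simp
qed

definition symbol_of :: "nat \<Rightarrow> (3 list \<Rightarrow> complex mat) \<Rightarrow> real^3 \<Rightarrow> nat \<Rightarrow> nat \<Rightarrow> complex" where
  "symbol_of m C s a b =
     (\<Sum>ks\<in>multi_indices m. C ks $$ (a, b) * complex_of_real (\<Prod>k\<leftarrow>ks. vec_nth s k))"

lemma symbol_block_eq_symbol_of:
  "\<nu> \<le> \<mu> + 1 \<Longrightarrow> symbol_block S s \<mu> \<nu> a b = symbol_of (\<mu> + 1 - \<nu>) (coefA S \<mu> \<nu>) s a b"
  by (simp add: symbol_block_def symbol_of_def)

lemma diff_op_plane_wave:
  assumes u: "\<And>b. b < n \<Longrightarrow> u b = plane_wave \<tau> s (c b)"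
    and C: "\<And>ks. ks \<in> multi_indices m \<Longrightarrow> dim_col (C ks) = n"
  shows "diff_op m C u a x = plane_wave \<tau> s (complex_of_real (\<tau> ^ m) * (\<Sum>b<n. symbol_of m C s a b * c b)) x"
proof -
  let ?E = "exp (complex_of_real (\<tau> * inner s x))"
  have p: "pderivs ks (u b) x = c b * complex_of_real (\<tau> ^ m * (\<Prod>k\<leftarrow>ks. vec_nth s k)) * ?E"
    if "b < n" "ks \<in> multi_indices m" for b ks
    using that(2) unfolding u[OF that(1)] pderivs_plane_wave by (simp add: plane_wave_def multi_indices_def)
  have "diff_op m C u a x = (\<Sum>ks\<in>multi_indices m. \<Sum>b<n. C ks $$ (a, b) *
      (c b * complex_of_real (\<tau> ^ m * (\<Prod>k\<leftarrow>ks. vec_nth s k)) * ?E))"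
    unfolding diff_op_def mat_app_def
    by (intro sum.cong) (auto simp: C p)
  also have "\<dots> = (\<Sum>b<n. \<Sum>ks\<in>multi_indices m. C ks $$ (a, b) *
      (c b * complex_of_real (\<tau> ^ m * (\<Prod>k\<leftarrow>ks. vec_nth s k)) * ?E))"
    by (rule sum.swap)
  also have "\<dots> = complex_of_real (\<tau> ^ m) * (\<Sum>b<n. symbol_of m C s a b * c b) * ?E"
    unfolding symbol_of_def by (simp add: sum_distrib_left sum_distrib_right mult_ac)
  finally show ?thesis by (simp add: plane_wave_def)
qed

definition symbol_apply :: "nat \<Rightarrow> ft_system \<Rightarrow> real^3 \<Rightarrow> (nat \<Rightarrow> nat \<Rightarrow> complex) \<Rightarrow> nat \<Rightarrow> nat \<Rightarrow> complex" where
  "symbol_apply N S s u \<mu> a = (\<Sum>\<nu><N. \<Sum>b<ncomp S \<nu>. symbol_block S s \<mu> \<nu> a b * u \<nu> b)"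

lemma tendsto_const_div_power:
  "k > 0 \<Longrightarrow> ((\<lambda>\<tau>::real. c / complex_of_real (\<tau> ^ k)) \<longlongrightarrow> 0) at_top"
proof -
  assume k: "k > 0"
  have "((\<lambda>\<tau>::real. 1 / \<tau> ^ k) \<longlongrightarrow> 0) at_top"
    using k by (intro tendsto_divide_0[OF tendsto_const] filterlim_at_top_imp_at_infinity
        filterlim_pow_at_top filterlim_ident)
  then have "((\<lambda>\<tau>::real. c * complex_of_real (1 / \<tau> ^ k)) \<longlongrightarrow> c * complex_of_real 0) at_top"
    by (intro tendsto_intros)
  then show ?thesis by simp
qed

text \<open>With amplitudes of order \<open>\<tau> ^ (\<nu> + k)\<close>, every term with a
  coefficient \<open>A\<close> is of order \<open>\<tau> ^ (\<mu> + 1 + k)\<close>, a term with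
  \<open>B\<close> of index \<open>\<rho>\<close> loses a factor \<open>\<tau> ^ \<rho>\<close>, and
  the source is constant in \<open>\<tau>\<close>. Only the symbol survives the division. The offset
  \<open>k\<close> is 0 for the original system and 1 for the reduction; letting \<open>y\<close>
  depend on \<open>\<tau>\<close> admits components of lower order within a block.\<close>

lemma ft_rhs_plane_wave_limit:
  assumes S: "is_ft_system N S" and \<mu>: "\<mu> < N"
    and y: "\<And>\<nu> b. \<nu> < N \<Longrightarrow> b < ncomp S \<nu> \<Longrightarrow> ((\<lambda>\<tau>. y \<tau> \<nu> b) \<longlongrightarrow> y0 \<nu> b) at_top"
    and v: "\<And>\<tau> \<nu> b. \<tau> > 0 \<Longrightarrow> \<nu> < N \<Longrightarrow> b < ncomp S \<nu> \<Longrightarrow>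
        v \<tau> \<nu> b = plane_wave \<tau> s (complex_of_real (\<tau> ^ (\<nu> + k)) * y \<tau> \<nu> b)"
  shows "((\<lambda>\<tau>. ft_rhs N S t (v \<tau>) \<mu> a 0 / complex_of_real (\<tau> ^ (\<mu> + 1 + k)))
      \<longlongrightarrow> symbol_apply N S s y0 \<mu> a) at_top"
proof -
  have colA: "dim_col (coefA S \<mu> \<nu> ks) = ncomp S \<nu>"
    if "\<nu> \<le> min (\<mu> + 1) (N - 1)" "ks \<in> multi_indices (\<mu> + 1 - \<nu>)" for \<nu> ks
    using S \<mu> that unfolding is_ft_system_def by (metis carrier_matD(2))
  have colB: "dim_col (coefB S \<mu> \<rho> \<nu> ks) = ncomp S \<nu>"
    if "\<nu> \<le> \<mu>" "\<rho> \<in> {1..\<mu> - \<nu> + 1}" "ks \<in> multi_indices (\<mu> + 1 - \<nu> - \<rho>)" for \<nu> \<rho> ks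
    using S \<mu> that unfolding is_ft_system_def by (metis carrier_matD(2))
  define op where "op m C \<nu> \<tau> = (\<Sum>b<ncomp S \<nu>. symbol_of m C s a b * y \<tau> \<nu> b)" for m C \<nu> \<tau>
  define op0 where "op0 m C \<nu> = (\<Sum>b<ncomp S \<nu>. symbol_of m C s a b * y0 \<nu> b)" for m C \<nu>
  have op_lim: "((\<lambda>\<tau>. op m C \<nu> \<tau>) \<longlongrightarrow> op0 m C \<nu>) at_top" if "\<nu> < N" for m C \<nu>
    unfolding op_def op0_def using y that by (intro tendsto_sum tendsto_mult tendsto_const) auto
  have dop: "diff_op m C (v \<tau> \<nu>) a 0 = complex_of_real (\<tau> ^ (m + \<nu> + k)) * op m C \<nu> \<tau>"
    if "\<nu> < N" "\<tau> > 0" "\<And>ks. ks \<in> multi_indices m \<Longrightarrow> dim_col (C ks) = ncomp S \<nu>" for m C \<nu> \<tau>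
    using diff_op_plane_wave[OF v[OF that(2,1)] that(3), where a = a and x = 0] that
    by (simp add: op_def power_add sum_distrib_left mult_ac)
  have limA: "((\<lambda>\<tau>. \<Sum>\<nu>=0..min (\<mu> + 1) (N - 1). op (\<mu> + 1 - \<nu>) (coefA S \<mu> \<nu>) \<nu> \<tau>)
      \<longlongrightarrow> symbol_apply N S s y0 \<mu> a) at_top"
  proof -
    have "symbol_apply N S s y0 \<mu> a = (\<Sum>\<nu>=0..min (\<mu> + 1) (N - 1). op0 (\<mu> + 1 - \<nu>) (coefA S \<mu> \<nu>) \<nu>)"
      unfolding symbol_apply_def
    proof (rule sum.mono_neutral_cong_right)
      show "\<forall>\<nu>\<in>{..<N} - {0..min (\<mu> + 1) (N - 1)}. (\<Sum>b<ncomp S \<nu>. symbol_block S s \<mu> \<nu> a b * y0 \<nu> b) = 0"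
        by (auto simp: symbol_block_def)
    qed (use \<mu> in \<open>auto simp: op0_def symbol_block_eq_symbol_of\<close>)
    then show ?thesis using \<mu> op_lim by (auto intro!: tendsto_sum)
  qed
  have limB: "((\<lambda>\<tau>. \<Sum>\<nu>=0..\<mu>. \<Sum>\<rho>=1..\<mu> - \<nu> + 1.
      op (\<mu> + 1 - \<nu> - \<rho>) (coefB S \<mu> \<rho> \<nu>) \<nu> \<tau> * (1 / complex_of_real (\<tau> ^ \<rho>))) \<longlongrightarrow>
      (\<Sum>\<nu>=0..\<mu>. \<Sum>\<rho>=1..\<mu> - \<nu> + 1. op0 (\<mu> + 1 - \<nu> - \<rho>) (coefB S \<mu> \<rho> \<nu>) \<nu> * 0)) at_top"
    using \<mu> by (intro tendsto_sum tendsto_mult op_lim tendsto_const_div_power) auto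
  have limS: "((\<lambda>\<tau>. source S \<mu> t a 0 / complex_of_real (\<tau> ^ (\<mu> + 1 + k))) \<longlongrightarrow> 0) at_top"
    by (rule tendsto_const_div_power) simp
  have lim: "((\<lambda>\<tau>. (\<Sum>\<nu>=0..min (\<mu> + 1) (N - 1). op (\<mu> + 1 - \<nu>) (coefA S \<mu> \<nu>) \<nu> \<tau>) +
      (\<Sum>\<nu>=0..\<mu>. \<Sum>\<rho>=1..\<mu> - \<nu> + 1. op (\<mu> + 1 - \<nu> - \<rho>) (coefB S \<mu> \<rho> \<nu>) \<nu> \<tau> * (1 / complex_of_real (\<tau> ^ \<rho>))) +
      source S \<mu> t a 0 / complex_of_real (\<tau> ^ (\<mu> + 1 + k))) \<longlongrightarrow> symbol_apply N S s y0 \<mu> a) at_top"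
    using tendsto_add[OF tendsto_add[OF limA limB] limS] by simp
  show ?thesis
  proof (rule Lim_transform_eventually[OF lim], rule eventually_mono[OF eventually_gt_at_top[of "0::real"]])
    fix \<tau> :: real assume \<tau>: "\<tau> > 0"
    let ?T = "complex_of_real (\<tau> ^ (\<mu> + 1 + k))"
    have A: "diff_op (\<mu> + 1 - \<nu>) (coefA S \<mu> \<nu>) (v \<tau> \<nu>) a 0 = ?T * op (\<mu> + 1 - \<nu>) (coefA S \<mu> \<nu>) \<nu> \<tau>"
      if \<nu>: "\<nu> \<in> {0..min (\<mu> + 1) (N - 1)}" for \<nu>
    proof -
      have "\<nu> < N" and "\<nu> \<le> min (\<mu> + 1) (N - 1)" and "\<mu> + 1 - \<nu> + \<nu> + k = \<mu> + 1 + k"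
        using \<nu> \<mu> by auto
      then show ?thesis
        using dop[where m = "\<mu> + 1 - \<nu>" and C = "coefA S \<mu> \<nu>" and \<nu> = \<nu>, OF _ \<tau> colA] by metis
    qed
    have B: "diff_op (\<mu> + 1 - \<nu> - \<rho>) (coefB S \<mu> \<rho> \<nu>) (v \<tau> \<nu>) a 0 =
        ?T * (op (\<mu> + 1 - \<nu> - \<rho>) (coefB S \<mu> \<rho> \<nu>) \<nu> \<tau> * (1 / complex_of_real (\<tau> ^ \<rho>)))"
      if \<nu>: "\<nu> \<in> {0..\<mu>}" and \<rho>: "\<rho> \<in> {1..\<mu> - \<nu> + 1}" for \<nu> \<rho>
    proof -
      have "\<tau> ^ (\<mu> + 1 + k) = \<tau> ^ (\<mu> + 1 - \<nu> - \<rho> + \<nu> + k) * \<tau> ^ \<rho>"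
        unfolding power_add[symmetric] using \<nu> \<rho> by (intro arg_cong[where f = "(^) \<tau>"]) auto
      then have T: "?T = complex_of_real (\<tau> ^ (\<mu> + 1 - \<nu> - \<rho> + \<nu> + k)) * complex_of_real (\<tau> ^ \<rho>)"
        by (simp only: of_real_mult)
      have "\<nu> < N" "\<nu> \<le> \<mu>" using \<nu> \<mu> by auto
      then have "diff_op (\<mu> + 1 - \<nu> - \<rho>) (coefB S \<mu> \<rho> \<nu>) (v \<tau> \<nu>) a 0 =
          complex_of_real (\<tau> ^ (\<mu> + 1 - \<nu> - \<rho> + \<nu> + k)) * op (\<mu> + 1 - \<nu> - \<rho>) (coefB S \<mu> \<rho> \<nu>) \<nu> \<tau>"
        using \<rho> \<tau> colB by (intro dop) auto
      then show ?thesis unfolding T using \<tau> by simp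
    qed
    have "ft_rhs N S t (v \<tau>) \<mu> a 0 = ?T * ((\<Sum>\<nu>=0..min (\<mu> + 1) (N - 1). op (\<mu> + 1 - \<nu>) (coefA S \<mu> \<nu>) \<nu> \<tau>) +
      (\<Sum>\<nu>=0..\<mu>. \<Sum>\<rho>=1..\<mu> - \<nu> + 1. op (\<mu> + 1 - \<nu> - \<rho>) (coefB S \<mu> \<rho> \<nu>) \<nu> \<tau> * (1 / complex_of_real (\<tau> ^ \<rho>))))
      + source S \<mu> t a 0"
      unfolding ft_rhs_def by (simp only: A B sum_distrib_left distrib_left cong: sum.cong)
    then show "(\<Sum>\<nu>=0..min (\<mu> + 1) (N - 1). op (\<mu> + 1 - \<nu>) (coefA S \<mu> \<nu>) \<nu> \<tau>) +
      (\<Sum>\<nu>=0..\<mu>. \<Sum>\<rho>=1..\<mu> - \<nu> + 1. op (\<mu> + 1 - \<nu> - \<rho>) (coefB S \<mu> \<rho> \<nu>) \<nu> \<tau> * (1 / complex_of_real (\<tau> ^ \<rho>))) +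
      source S \<mu> t a 0 / ?T = ft_rhs N S t (v \<tau>) \<mu> a 0 / ?T"
      using \<tau> by (simp add: add_divide_distrib)
  qed
qed

section \<open>Reductions on gradient fields\<close>

text \<open>The isometry \<open>J\<close> on block components. The slot of \<open>v^0\<close> is
  zero because on a plane wave \<open>v^0\<close> is one order in \<open>\<tau>\<close> below its
  gradient.\<close>

definition grad_embed :: "nat \<Rightarrow> real^3 \<Rightarrow> (nat \<Rightarrow> nat \<Rightarrow> complex) \<Rightarrow> nat \<Rightarrow> nat \<Rightarrow> complex" where
  "grad_embed n s u \<kappa> a =
     (if \<kappa> = 0 then slot n (\<lambda>_. 0) (\<lambda>i b. complex_of_real (vec_nth s i) * u 0 b) (u 1) a
      else u (\<kappa> + 1) a)"

lemma ft_rhs_0_eq: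
  assumes "N \<ge> 2"
  shows "ft_rhs N S t v 0 a x =
     (\<Sum>k\<in>UNIV. mat_app (coefA S 0 0 [k]) (\<lambda>b. pderiv_dir k (v 0 b)) a x)
   + mat_app (coefA S 0 1 []) (v 1) a x + mat_app (coefB S 0 1 0 []) (v 0) a x + source S 0 t a x"
proof -
  have "{0..min (0 + 1) (N - 1)} = {0, 1}" using assms by auto
  moreover have "diff_op (Suc 0) C u a x = (\<Sum>k\<in>UNIV. mat_app (C [k]) (\<lambda>b. pderiv_dir k (u b)) a x)"
    for C and u :: "nat \<Rightarrow> scalar_field"
    unfolding diff_op_def sum_multi_indices_snoc by simp
  ultimately show ?thesis
    by (simp add: ft_rhs_def) (simp add: diff_op_def)
qed

lemma mat_app_zero_field [simp]: "mat_app C (\<lambda>b y. 0) a x = 0"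
  by (simp add: mat_app_def)

text \<open>A gradient \<open>d\<close> satisfies the auxiliary constraints, so the reduction parameters drop out.\<close>

lemma red_rhs_v_gradient:
  assumes N: "N \<ge> 2"
    and d: "\<And>i b. d i b = pderiv_dir i (v 0 b)"
    and comm: "\<And>i j b x. pderiv_dir i (d j b) x = pderiv_dir j (d i b) x"
  shows "red_rhs_v N S D t v d \<mu> a x = ft_rhs N S t v \<mu> a x"
proof -
  have c1: "constr1 (v 0) d k = (\<lambda>b y. 0)" for k
    by (simp add: constr1_def d fun_eq_iff)
  have c2: "constr2 d k j = (\<lambda>b y. 0)" for k j
    unfolding constr2_def using comm by (simp add: fun_eq_iff)
  show ?thesis
  proof (cases "\<mu> = 0")
    case True
    then show ?thesis
      by (simp add: red_rhs_v_def red_rhs_v0_def c1 c2 ft_rhs_0_eq[OF N])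
  next
    case False
    have "{0..min (\<mu> + 1) (N - 1)} = insert 0 {1..min (\<mu> + 1) (N - 1)}" by auto
    moreover have "diff_op (\<mu> + 1) (coefA S \<mu> 0) (v 0) a x =
        (\<Sum>ks\<in>multi_indices \<mu>. \<Sum>k\<in>UNIV.
          mat_app (coefA S \<mu> 0 (ks @ [k])) (\<lambda>b. pderivs ks (d k b)) a x)"
      unfolding diff_op_def by (simp add: sum_multi_indices_snoc pderivs_append_single d)
    ultimately show ?thesis
      using False by (simp add: red_rhs_v_def red_rhs_vmu_def ft_rhs_def c1 c2)
  qed
qed

text \<open>Apart from the vanishing constraints, the equation of \<open>d i\<close> is the
  derivative of the equation of \<open>v^0\<close>, and differentiating a plane wave multiplies it
  by \<open>\<tau> * s_i\<close>. The source is not a plane wave and is therefore treated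
  apart.\<close>

lemma red_rhs_d_gradient_plane_wave:
  assumes N: "N \<ge> 2"
    and v: "\<And>\<nu> b. v \<nu> b = plane_wave \<tau> s (c \<nu> b)" and d: "\<And>i b. d i b = pderiv_dir i (v 0 b)"
  shows "red_rhs_d S D t v d i a x =
    complex_of_real (\<tau> * vec_nth s i) * (ft_rhs N S t v 0 a x - source S 0 t a x) + pderiv_dir i (source S 0 t a) x"
proof -
  have c1: "constr1 (v 0) d k = (\<lambda>b y. 0)" for k
    by (simp add: constr1_def d fun_eq_iff)
  have c2: "constr2 d k j = (\<lambda>b y. 0)" for k j
    unfolding constr2_def by (simp add: fun_eq_iff v d pderiv_dir_plane_wave mult_ac)
  let ?z = "complex_of_real (\<tau> * vec_nth s i)"
  have "pderiv_dir i (plane_wave \<tau> s c) = (\<lambda>y. ?z * plane_wave \<tau> s c y)" for c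
    unfolding pderiv_dir_plane_wave by (simp add: plane_wave_def fun_eq_iff)
  then have ma: "mat_app C (\<lambda>b. pderiv_dir i (plane_wave \<tau> s (f b))) a x =
      ?z * mat_app C (\<lambda>b. plane_wave \<tau> s (f b)) a x" for C f
    by (simp add: mat_app_def sum_distrib_left mult_ac del: of_real_mult)
  have m1: "mat_app C (\<lambda>b. pderiv_dir i (v \<nu> b)) a x = ?z * mat_app C (v \<nu>) a x" for C \<nu>
    using ma[of C "c \<nu>"] v by (simp add: v[abs_def] del: of_real_mult)
  have m2: "mat_app C (\<lambda>b. pderiv_dir i (d j b)) a x = ?z * mat_app C (\<lambda>b. pderiv_dir j (v 0 b)) a x" for C j
    unfolding d v pderiv_dir_plane_wave[of j] by (rule ma)
  show ?thesis
    unfolding red_rhs_d_def ft_rhs_0_eq[OF N] c1 c2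
    by (simp add: m1 m2 sum_distrib_left distrib_left del: of_real_mult)
qed

text \<open>The component form of \<open>M * J = J * P\<close>. The two sides are the rescaled
  limits at the origin of the two sides of the operator identity defining a reduction, so they agree
  by uniqueness of limits.\<close>

lemma reduction_symbol_intertwines:
  assumes N: "N \<ge> 2" and S: "is_ft_system N S" and red: "is_ft_reduction N S S'"
    and \<kappa>: "\<kappa> < N - 1" and a: "a < ncomp S' \<kappa>"
  shows "symbol_apply (N - 1) S' s (grad_embed (ncomp S 0) s u) \<kappa> a = grad_embed (ncomp S 0) s (symbol_apply N S s u) \<kappa> a"
proof -
  define n where "n = ncomp S 0"
  have S': "is_ft_system (N - 1) S'" and n0: "ncomp S' 0 = 4 * ncomp S 0 + ncomp S 1"
    and nk: "\<And>\<kappa>. \<kappa> \<in> {1..<N - 1} \<Longrightarrow> ncomp S' \<kappa> = ncomp S (\<kappa> + 1)"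
    using red by (auto simp: is_ft_reduction_def)
  obtain D where eq: "\<And>t v d \<kappa> a x. (\<And>\<mu> a. smooth_field (v \<mu> a)) \<Longrightarrow> (\<And>i a. smooth_field (d i a)) \<Longrightarrow>
      \<kappa> < N - 1 \<Longrightarrow> a < ncomp S' \<kappa> \<Longrightarrow> ft_rhs (N - 1) S' t (regroup (ncomp S) v d) \<kappa> a x =
        regroup (ncomp S) (red_rhs_v N S D t v d) (red_rhs_d S D t v d) \<kappa> a x"
    using red unfolding is_ft_reduction_def by metis
  define v where "v \<tau> \<nu> b = plane_wave \<tau> s (complex_of_real (\<tau> ^ \<nu>) * u \<nu> b)" for \<tau> \<nu> b
  define d where "d \<tau> i b = pderiv_dir i (v \<tau> 0 b)" for \<tau> i b
  have d_pw: "d \<tau> i b = plane_wave \<tau> s (u 0 b * complex_of_real (\<tau> * vec_nth s i))" for \<tau> i b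
    by (simp add: d_def v_def pderiv_dir_plane_wave)
  \<comment> \<open>Block 0 of the reduction is scaled by \<open>\<tau>\<close>, the order of
    \<open>d\<close> and \<open>v^1\<close>. Relative to this \<open>v^0\<close> has size
    \<open>1 / \<tau>\<close> and disappears in the limit, as \<open>grad_embed\<close>
    requires.\<close>
  define y where "y \<tau> \<kappa> b = (if \<kappa> = 0 then slot n (\<lambda>b. u 0 b / complex_of_real (\<tau> ^ 1))
      (\<lambda>i b. complex_of_real (vec_nth s i) * u 0 b) (u 1) b else u (\<kappa> + 1) b)" for \<tau> \<kappa> b
  have y_lim: "((\<lambda>\<tau>. y \<tau> \<nu> b) \<longlongrightarrow> grad_embed n s u \<nu> b) at_top" for \<nu> b
    unfolding y_def grad_embed_def slot_def using tendsto_const_div_power[of 1] by simp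
  have w: "regroup (ncomp S) (v \<tau>) (d \<tau>) \<nu> b = plane_wave \<tau> s (complex_of_real (\<tau> ^ (\<nu> + 1)) * y \<tau> \<nu> b)"
    if \<tau>: "\<tau> > 0" and "\<nu> < N - 1" "b < ncomp S' \<nu>" for \<tau> \<nu> b
  proof (cases "\<nu> = 0")
    case True
    then have "regroup (ncomp S) (v \<tau>) (d \<tau>) \<nu> b = slot n (v \<tau> 0) (d \<tau>) (v \<tau> 1) b"
      using that n0 by (simp add: regroup_0_eq_slot n_def)
    also have "\<dots> = plane_wave \<tau> s (complex_of_real (\<tau> ^ (\<nu> + 1)) * y \<tau> \<nu> b)"
      using True \<tau> unfolding y_def slot_def by (auto simp: v_def d_pw mult_ac)
    finally show ?thesis .
  next
    case False
    then show ?thesis by (simp add: regroup_def v_def y_def)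
  qed
  have lhs: "((\<lambda>\<tau>. ft_rhs (N - 1) S' 0 (regroup (ncomp S) (v \<tau>) (d \<tau>)) \<kappa> a 0 / complex_of_real (\<tau> ^ (\<kappa> + 1 + 1)))
      \<longlongrightarrow> symbol_apply (N - 1) S' s (grad_embed n s u) \<kappa> a) at_top"
    by (rule ft_rhs_plane_wave_limit[OF S' \<kappa> y_lim w])
  have orig: "((\<lambda>\<tau>. ft_rhs N S 0 (v \<tau>) \<mu> b 0 / complex_of_real (\<tau> ^ (\<mu> + 1)))
      \<longlongrightarrow> symbol_apply N S s u \<mu> b) at_top" if "\<mu> < N" for \<mu> b
    using ft_rhs_plane_wave_limit[OF S that, of "\<lambda>_. u" u v s 0 0 b] by (simp add: v_def)
  have comm: "pderiv_dir i (d \<tau> j b) x = pderiv_dir j (d \<tau> i b) x" for i j b x \<tau>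
    by (simp add: d_pw pderiv_dir_plane_wave mult_ac)
  have rv: "red_rhs_v N S D 0 (v \<tau>) (d \<tau>) \<mu> b 0 = ft_rhs N S 0 (v \<tau>) \<mu> b 0" for \<tau> \<mu> b
    by (rule red_rhs_v_gradient[OF N]) (rule d_def, rule comm)
  have rd: "red_rhs_d S D 0 (v \<tau>) (d \<tau>) i b 0 = complex_of_real (\<tau> * vec_nth s i) *
      (ft_rhs N S 0 (v \<tau>) 0 b 0 - source S 0 0 b 0) + pderiv_dir i (source S 0 0 b) 0" for \<tau> i b
    by (rule red_rhs_d_gradient_plane_wave[OF N]) (rule v_def, rule d_def)
  have rhs: "((\<lambda>\<tau>. regroup (ncomp S) (red_rhs_v N S D 0 (v \<tau>) (d \<tau>)) (red_rhs_d S D 0 (v \<tau>) (d \<tau>)) \<kappa> a 0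
      / complex_of_real (\<tau> ^ (\<kappa> + 1 + 1))) \<longlongrightarrow> grad_embed n s (symbol_apply N S s u) \<kappa> a) at_top"
  proof (cases "\<kappa> = 0")
    case False
    then show ?thesis using orig[of "\<kappa> + 1" a] \<kappa> by (simp add: regroup_def rv grad_embed_def)
  next
    case True
    \<comment> \<open>The right-hand side of \<open>v^0\<close> is of order \<open>\<tau>\<close>
      only, whereas block 0 is divided by \<open>\<tau> ^ 2\<close>: this is the zero slot on the
      other side of the identity.\<close>
    have v0: "((\<lambda>\<tau>. ft_rhs N S 0 (v \<tau>) 0 b 0 / complex_of_real (\<tau> ^ 2)) \<longlongrightarrow> 0) at_top" for b
      using tendsto_mult[OF orig[of 0 b] tendsto_const_div_power[of 1 1]] N
      by (simp add: power2_eq_square)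
    \<comment> \<open>The factor \<open>\<tau> * s_i\<close> compensates the missing order. The
      source enters through two fixed numbers, which the powers of \<open>\<tau>\<close>
      suppress.\<close>
    have di: "((\<lambda>\<tau>. (complex_of_real (\<tau> * vec_nth s i) * (ft_rhs N S 0 (v \<tau>) 0 b 0 - source S 0 0 b 0)
        + pderiv_dir i (source S 0 0 b) 0) / complex_of_real (\<tau> ^ 2)) \<longlongrightarrow>
        complex_of_real (vec_nth s i) * symbol_apply N S s u 0 b) at_top" for i b
    proof -
      have "((\<lambda>\<tau>. complex_of_real (vec_nth s i) * (ft_rhs N S 0 (v \<tau>) 0 b 0 / complex_of_real (\<tau> ^ (0 + 1)) -
          source S 0 0 b 0 / complex_of_real (\<tau> ^ 1)) + pderiv_dir i (source S 0 0 b) 0 / complex_of_real (\<tau> ^ 2))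
          \<longlongrightarrow> complex_of_real (vec_nth s i) * (symbol_apply N S s u 0 b - 0) + 0) at_top"
        using N by (intro tendsto_intros orig tendsto_const_div_power) auto
      then have "((\<lambda>\<tau>. complex_of_real (vec_nth s i) * (ft_rhs N S 0 (v \<tau>) 0 b 0 / complex_of_real (\<tau> ^ (0 + 1)) -
          source S 0 0 b 0 / complex_of_real (\<tau> ^ 1)) + pderiv_dir i (source S 0 0 b) 0 / complex_of_real (\<tau> ^ 2))
          \<longlongrightarrow> complex_of_real (vec_nth s i) * symbol_apply N S s u 0 b) at_top"
        by simp
      then show ?thesis
        by (rule Lim_transform_eventually, intro eventually_mono[OF eventually_gt_at_top[of "0::real"]])
          (simp add: field_simps power2_eq_square)
    qed
    have v1: "((\<lambda>\<tau>. ft_rhs N S 0 (v \<tau>) 1 b 0 / complex_of_real (\<tau> ^ 2)) \<longlongrightarrow> symbol_apply N S s u 1 b) at_top" for b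
      using orig[of 1 b] N by (simp add: numeral_2_eq_2)
    have "a < 4 * ncomp S 0 + ncomp S 1" using a True n0 by simp
    then have "regroup (ncomp S) (red_rhs_v N S D 0 (v \<tau>) (d \<tau>)) (red_rhs_d S D 0 (v \<tau>) (d \<tau>)) \<kappa> a 0
        / complex_of_real (\<tau> ^ (\<kappa> + 1 + 1)) =
        slot n (\<lambda>b. ft_rhs N S 0 (v \<tau>) 0 b 0 / complex_of_real (\<tau> ^ 2))
          (\<lambda>i b. (complex_of_real (\<tau> * vec_nth s i) * (ft_rhs N S 0 (v \<tau>) 0 b 0 - source S 0 0 b 0)
            + pderiv_dir i (source S 0 0 b) 0) / complex_of_real (\<tau> ^ 2))
          (\<lambda>b. ft_rhs N S 0 (v \<tau>) 1 b 0 / complex_of_real (\<tau> ^ 2)) a" for \<tau>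
      using True
      by (simp add: regroup_0_eq_slot slot_comp[where f = "\<lambda>f. f 0 / c" for c] rv rd n_def numeral_2_eq_2)
    then show ?thesis
      using True v0 di v1 by (simp add: grad_embed_def slot_def)
  qed
  have "regroup (ncomp S) (red_rhs_v N S D 0 (v \<tau>) (d \<tau>)) (red_rhs_d S D 0 (v \<tau>) (d \<tau>)) \<kappa> a 0 =
      ft_rhs (N - 1) S' 0 (regroup (ncomp S) (v \<tau>) (d \<tau>)) \<kappa> a 0" for \<tau>
    by (rule eq[symmetric]) (use \<kappa> a in \<open>auto simp: v_def d_pw smooth_plane_wave\<close>)
  with rhs lhs show ?thesis
    using tendsto_unique[OF trivial_limit_at_top_linorder] unfolding n_def by auto
qed

section \<open>The curl reduction\<close>

text \<open>The coefficient of \<open>\<partial>\<^bsub>ks\<^esub> v\<^sup>\<nu>\<close>: the derivative order \<open>length ks\<close> determines whether it belongs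
  to \<open>A\<close> or to which \<open>B\<^sub>\<rho>\<close>.\<close>

definition coefC :: "ft_system \<Rightarrow> nat \<Rightarrow> nat \<Rightarrow> 3 list \<Rightarrow> complex mat" where
  "coefC S \<mu> \<nu> ks =
     (if length ks = \<mu> + 1 - \<nu> then coefA S \<mu> \<nu> ks else coefB S \<mu> (\<mu> + 1 - \<nu> - length ks) \<nu> ks)"

lemma diff_op_cong:
  "(\<And>ks. ks \<in> multi_indices m \<Longrightarrow> C ks = C' ks) \<Longrightarrow> diff_op m C u a x = diff_op m C' u a x"
  by (simp add: diff_op_def)

lemma diff_op_coefC_top: "diff_op (\<mu> + 1 - \<nu>) (coefC S \<mu> \<nu>) u a x = diff_op (\<mu> + 1 - \<nu>) (coefA S \<mu> \<nu>) u a x"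
  by (intro diff_op_cong) (simp add: coefC_def multi_indices_def)

lemma sum_coefB_eq:
  assumes "\<nu> \<le> \<mu>"
  shows "(\<Sum>\<rho>=1..\<mu> - \<nu> + 1. diff_op (\<mu> + 1 - \<nu> - \<rho>) (coefB S \<mu> \<rho> \<nu>) u a x) =
    (\<Sum>m<\<mu> + 1 - \<nu>. diff_op m (coefC S \<mu> \<nu>) u a x)"
proof (rule sum.reindex_bij_witness[of _ "\<lambda>m. \<mu> + 1 - \<nu> - m" "\<lambda>\<rho>. \<mu> + 1 - \<nu> - \<rho>"])
  fix \<rho> assume \<rho>: "\<rho> \<in> {1..\<mu> - \<nu> + 1}"
  then show "diff_op (\<mu> + 1 - \<nu> - \<rho>) (coefC S \<mu> \<nu>) u a x = diff_op (\<mu> + 1 - \<nu> - \<rho>) (coefB S \<mu> \<rho> \<nu>) u a x"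
    using assms by (intro diff_op_cong) (auto simp: coefC_def multi_indices_def Suc_diff_le)
qed (use assms in auto)

text \<open>The term of order \<open>\<mu> + 1\<close> in \<open>v^0\<close> is left out on both
  sides, because a reduction writes it with \<open>d\<close>. The same identity thus serves the
  original system, which adds the term back, and the reduction.\<close>

lemma lower_order_sum_eq:
  "(\<Sum>\<nu>=1..min (\<mu> + 1) (N - 1). diff_op (\<mu> + 1 - \<nu>) (coefA S \<mu> \<nu>) (v \<nu>) a x)
   + (\<Sum>\<nu>=0..\<mu>. \<Sum>\<rho>=1..\<mu> - \<nu> + 1. diff_op (\<mu> + 1 - \<nu> - \<rho>) (coefB S \<mu> \<rho> \<nu>) (v \<nu>) a x)
   = (\<Sum>m<\<mu> + 1. diff_op m (coefC S \<mu> 0) (v 0) a x)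
   + (\<Sum>\<nu>=1..min (\<mu> + 1) (N - 1). \<Sum>m\<le>\<mu> + 1 - \<nu>. diff_op m (coefC S \<mu> \<nu>) (v \<nu>) a x)"
  if \<mu>: "\<mu> < N"
proof -
  let ?B = "\<lambda>\<nu>. \<Sum>m<\<mu> + 1 - \<nu>. diff_op m (coefC S \<mu> \<nu>) (v \<nu>) a x"
  have "(\<Sum>\<nu>=0..\<mu>. \<Sum>\<rho>=1..\<mu> - \<nu> + 1. diff_op (\<mu> + 1 - \<nu> - \<rho>) (coefB S \<mu> \<rho> \<nu>) (v \<nu>) a x) = (\<Sum>\<nu>=0..\<mu>. ?B \<nu>)"
    by (intro sum.cong refl sum_coefB_eq) auto
  also have "\<dots> = ?B 0 + (\<Sum>\<nu>=1..\<mu>. ?B \<nu>)"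
    by (simp add: sum.atLeast_Suc_atMost)
  also have "(\<Sum>\<nu>=1..\<mu>. ?B \<nu>) = (\<Sum>\<nu>=1..min (\<mu> + 1) (N - 1). ?B \<nu>)"
  proof (rule sum.mono_neutral_left)
    show "\<forall>\<nu>\<in>{1..min (\<mu> + 1) (N - 1)} - {1..\<mu>}. ?B \<nu> = 0"
    proof
      fix \<nu> assume "\<nu> \<in> {1..min (\<mu> + 1) (N - 1)} - {1..\<mu>}"
      then have "\<nu> = \<mu> + 1" by auto
      then show "?B \<nu> = 0" by simp
    qed
  qed (use \<mu> in auto)
  finally have B: "(\<Sum>\<nu>=0..\<mu>. \<Sum>\<rho>=1..\<mu> - \<nu> + 1. diff_op (\<mu> + 1 - \<nu> - \<rho>) (coefB S \<mu> \<rho> \<nu>) (v \<nu>) a x) =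
    ?B 0 + (\<Sum>\<nu>=1..min (\<mu> + 1) (N - 1). ?B \<nu>)" .
  have "(\<Sum>m\<le>k. f m) = f k + (\<Sum>m<k. f m)" for k and f :: "nat \<Rightarrow> complex"
    by (simp add: lessThan_Suc_atMost[symmetric])
  then show ?thesis
    unfolding B by (simp only: sum.distrib diff_op_coefC_top) (simp add: add_ac)
qed

lemma ft_rhs_eq_coefC:
  assumes \<mu>: "\<mu> < N"
  shows "ft_rhs N S t v \<mu> a x =
    (\<Sum>\<nu>=0..min (\<mu> + 1) (N - 1). \<Sum>m\<le>\<mu> + 1 - \<nu>. diff_op m (coefC S \<mu> \<nu>) (v \<nu>) a x) + source S \<mu> t a x"
proof -
  have s: "sum f {0..min (\<mu> + 1) (N - 1)} = f 0 + sum f {1..min (\<mu> + 1) (N - 1)}" for f :: "nat \<Rightarrow> complex"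
    by (simp add: sum.atLeast_Suc_atMost)
  have "(\<Sum>m\<le>\<mu> + 1. f m) = f (\<mu> + 1) + (\<Sum>m<\<mu> + 1. f m)" for f :: "nat \<Rightarrow> complex"
    by (simp add: lessThan_Suc_atMost[symmetric])
  then show ?thesis
    unfolding ft_rhs_def s using lower_order_sum_eq[OF \<mu>, of S v a x] diff_op_coefC_top[of \<mu> 0 S "v 0" a x]
    by (simp add: add.assoc)
qed

text \<open>One coefficient function serves both \<open>A\<close> and \<open>B\<close>: the length
  of \<open>ks\<close> already determines \<open>\<rho>\<close>, so a system can be specified by
  listing its coefficients derivative by derivative.\<close>

definition mk_system ::
    "(nat \<Rightarrow> nat) \<Rightarrow> (nat \<Rightarrow> nat \<Rightarrow> nat \<Rightarrow> 3 list \<Rightarrow> nat \<Rightarrow> complex) \<Rightarrow>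
     (nat \<Rightarrow> real \<Rightarrow> nat \<Rightarrow> scalar_field) \<Rightarrow> ft_system" where
  "mk_system n c src =
     \<lparr>ncomp = n,
      coefA = \<lambda>\<kappa> \<nu> ks. Matrix.mat (n \<kappa>) (n \<nu>) (\<lambda>(a, b). c \<kappa> a \<nu> ks b),
      coefB = \<lambda>\<kappa> \<rho> \<nu> ks. Matrix.mat (n \<kappa>) (n \<nu>) (\<lambda>(a, b). c \<kappa> a \<nu> ks b),
      source = src\<rparr>"

lemma is_ft_system_mk_system: "M \<ge> 1 \<Longrightarrow> is_ft_system M (mk_system n c src)"
  by (simp add: is_ft_system_def mk_system_def)

lemma ncomp_mk_system [simp]: "ncomp (mk_system n c src) = n"
  by (simp add: mk_system_def)

lemma ft_rhs_mk_system:
  assumes "\<kappa> < M" "a < n \<kappa>"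
  shows "ft_rhs M (mk_system n c src) t w \<kappa> a x =
    (\<Sum>\<nu>=0..min (\<kappa> + 1) (M - 1). \<Sum>m\<le>\<kappa> + 1 - \<nu>. \<Sum>ks\<in>multi_indices m. \<Sum>b<n \<nu>.
       c \<kappa> a \<nu> ks b * pderivs ks (w \<nu> b) x) + src \<kappa> t a x"
proof -
  have C: "coefC (mk_system n c src) \<kappa> \<nu> ks = Matrix.mat (n \<kappa>) (n \<nu>) (\<lambda>(a, b). c \<kappa> a \<nu> ks b)" for \<nu> ks
    by (simp add: coefC_def mk_system_def)
  have ma: "mat_app (Matrix.mat (n \<kappa>) (n \<nu>) (\<lambda>(a, b). c \<kappa> a \<nu> ks b)) u a x = (\<Sum>b<n \<nu>. c \<kappa> a \<nu> ks b * u b x)"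
    for \<nu> ks u
    unfolding mat_app_def using assms(2) by (intro sum.cong) auto
  show ?thesis
    unfolding ft_rhs_eq_coefC[OF assms(1)] diff_op_def C ma by (simp only: mk_system_def ft_system.simps)
qed

lemma symbol_block_mk_system:
  assumes "a < n \<kappa>" "b < n \<nu>"
  shows "symbol_block (mk_system n c src) s \<kappa> \<nu> a b =
    (if \<nu> \<le> \<kappa> + 1 then \<Sum>ks\<in>multi_indices (\<kappa> + 1 - \<nu>). c \<kappa> a \<nu> ks b * complex_of_real (\<Prod>k\<leftarrow>ks. vec_nth s k)
     else 0)"
  using assms by (simp add: symbol_block_def mk_system_def)


definition levi_civita :: "3 \<Rightarrow> 3 \<Rightarrow> 3 \<Rightarrow> complex" where
  "levi_civita i j k =
     (if (i, j, k) \<in> {(1, 2, 3), (2, 3, 1), (3, 1, 2)} then 1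
      else if (i, j, k) \<in> {(1, 3, 2), (3, 2, 1), (2, 1, 3)} then - 1 else 0)"

lemma three_distinct: "(1::3) \<noteq> 2" "(1::3) \<noteq> 3" "(2::3) \<noteq> 3" "(2::3) \<noteq> 1" "(3::3) \<noteq> 1" "(3::3) \<noteq> 2"
  by simp_all

lemma levi_civita_swap: "levi_civita i k j = - levi_civita i j k" "levi_civita k j i = - levi_civita i j k"
proof -
  have "\<forall>i j k. levi_civita i k j = - levi_civita i j k \<and> levi_civita k j i = - levi_civita i j k"
    unfolding forall_3 levi_civita_def
    by (simp only: insert_iff empty_iff prod.inject simp_thms if_True if_False three_distinct
        minus_minus minus_zero refl)
  then show "levi_civita i k j = - levi_civita i j k" "levi_civita k j i = - levi_civita i j k" by blast+
qed

text \<open>In the three row definitions the value at \<open>\<nu>\<close>, \<open>ks\<close>,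
  \<open>b\<close> is the coefficient of the derivative \<open>ks\<close> of component
  \<open>b\<close> of \<open>w^\<nu>\<close>. This row has no derivatives, since the constraint term
  has traded the gradient of \<open>v^0\<close> for \<open>d\<close>.\<close>

definition row_v0 :: "ft_system \<Rightarrow> nat \<Rightarrow> nat \<Rightarrow> 3 list \<Rightarrow> nat \<Rightarrow> complex" where
  "row_v0 S a \<nu> ks b =
     (if \<nu> = 0 \<and> ks = []
      then slot (ncomp S 0) (\<lambda>b. coefB S 0 1 0 [] $$ (a, b)) (\<lambda>j b. coefA S 0 0 [j] $$ (a, b))
        (\<lambda>b. coefA S 0 1 [] $$ (a, b)) b
      else 0)"

text \<open>The test \<open>hd ks = i\<close> is the Kronecker delta of the outer derivative along
  \<open>i\<close>; the Levi-Civita term is the added curl. In the evaluated system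
  \<open>ks\<close> has at most one entry, so \<open>hd ks\<close> is the whole derivative.\<close>

definition row_d :: "ft_system \<Rightarrow> real \<Rightarrow> 3 \<Rightarrow> nat \<Rightarrow> nat \<Rightarrow> 3 list \<Rightarrow> nat \<Rightarrow> complex" where
  "row_d S l i a \<nu> ks b =
     (if \<nu> \<noteq> 0 then 0
      else if ks = []
      then slot (ncomp S 0) (\<lambda>b. 0) (\<lambda>j b. if j = i then coefB S 0 1 0 [] $$ (a, b) else 0) (\<lambda>b. 0) b
      else slot (ncomp S 0) (\<lambda>b. 0)
        (\<lambda>j b. (if hd ks = i then coefA S 0 0 [j] $$ (a, b) else 0) +
          (if a = b then \<i> * l * levi_civita i (hd ks) j else 0))
        (\<lambda>b. if hd ks = i then coefA S 0 1 [] $$ (a, b) else 0) b)"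

text \<open>Derivatives of \<open>v^0\<close> of order below \<open>\<mu>\<close> are kept; those of
  order \<open>\<mu>\<close> and \<open>\<mu> + 1\<close> are rewritten with \<open>d j\<close>,
  where \<open>j\<close> is the innermost index. Hence \<open>v^0\<close> does not reach the
  principal order \<open>\<mu>\<close> of this row. For \<open>\<nu> > 0\<close> the shift by one is
  \<open>w^\<nu> = v^(\<nu>+1)\<close>.\<close>

definition row_v :: "ft_system \<Rightarrow> nat \<Rightarrow> nat \<Rightarrow> nat \<Rightarrow> 3 list \<Rightarrow> nat \<Rightarrow> complex" where
  "row_v S \<mu> a \<nu> ks b =
     (if \<nu> = 0
      then slot (ncomp S 0) (\<lambda>b. if length ks < \<mu> then coefC S \<mu> 0 ks $$ (a, b) else 0)
        (\<lambda>j b. if \<mu> \<le> length ks + 1 then coefC S \<mu> 0 (ks @ [j]) $$ (a, b) else 0)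
        (\<lambda>b. coefC S \<mu> 1 ks $$ (a, b)) b
      else coefC S \<mu> (\<nu> + 1) ks $$ (a, b))"

definition reduced_comp :: "ft_system \<Rightarrow> nat \<Rightarrow> nat" where
  "reduced_comp S \<kappa> = (if \<kappa> = 0 then 4 * ncomp S 0 + ncomp S 1 else ncomp S (\<kappa> + 1))"

definition reduced_coef :: "ft_system \<Rightarrow> real \<Rightarrow> nat \<Rightarrow> nat \<Rightarrow> nat \<Rightarrow> 3 list \<Rightarrow> nat \<Rightarrow> complex" where
  "reduced_coef S l \<kappa> a =
     (if \<kappa> = 0 then slot (ncomp S 0) (row_v0 S) (row_d S l) (row_v S 1) a else row_v S (\<kappa> + 1) a)"

definition reduced_source :: "ft_system \<Rightarrow> nat \<Rightarrow> real \<Rightarrow> nat \<Rightarrow> scalar_field" where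
  "reduced_source S \<kappa> t a =
     (if \<kappa> = 0
      then slot (ncomp S 0) (source S 0 t) (\<lambda>i b. pderiv_dir i (source S 0 t b)) (source S 1 t) a
      else source S (\<kappa> + 1) t a)"

text \<open>The parameters \<open>D\<close> remove \<open>\<partial> v\<^sup>0\<close> from the principal part and \<open>Dbar\<close> adds
  \<open>i l curl d\<close> to the equation of \<open>d\<close>.\<close>

definition curl_params :: "ft_system \<Rightarrow> real \<Rightarrow> reduction_params" where
  "curl_params S l =
     \<lparr>parD0 = \<lambda>k. - coefA S 0 0 [k],
      parDbar0 = \<lambda>k j. 0\<^sub>m (ncomp S 0) (ncomp S 0),
      parD = \<lambda>i k. if i = k then - coefB S 0 1 0 [] else 0\<^sub>m (ncomp S 0) (ncomp S 0),
      parDbar = \<lambda>i k j. (\<i> * l * levi_civita i k j) \<cdot>\<^sub>m 1\<^sub>m (ncomp S 0),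
      parDmu = \<lambda>\<mu> ks. - coefB S \<mu> 1 0 ks,
      parDbarmu = \<lambda>\<mu> ks. 0\<^sub>m (ncomp S \<mu>) (ncomp S 0)\<rparr>"

definition curl_reduction :: "ft_system \<Rightarrow> real \<Rightarrow> ft_system" where
  "curl_reduction S l = mk_system (reduced_comp S) (reduced_coef S l) (reduced_source S)"

lemma is_reduction_params_curl:
  assumes N: "N \<ge> 2" and S: "is_ft_system N S"
  shows "is_reduction_params N S (curl_params S l)"
proof -
  have A: "coefA S 0 0 [k] \<in> carrier_mat (ncomp S 0) (ncomp S 0)" for k
    using S N unfolding is_ft_system_def by (auto simp: multi_indices_def)
  have B0: "coefB S 0 1 0 [] \<in> carrier_mat (ncomp S 0) (ncomp S 0)"
    using S N unfolding is_ft_system_def by (auto simp: multi_indices_def)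
  have B: "coefB S \<mu> 1 0 ks \<in> carrier_mat (ncomp S \<mu>) (ncomp S 0)" if "\<mu> \<in> {1..<N}" "ks \<in> multi_indices \<mu>" for \<mu> ks
  proof -
    have "\<mu> < N" "0 \<le> \<mu>" "1 \<in> {1..\<mu> - 0 + 1}" "ks \<in> multi_indices (\<mu> + 1 - 0 - 1)" using that by auto
    then show ?thesis using S unfolding is_ft_system_def by blast
  qed
  have z: "- (0\<^sub>m p q :: complex mat) = 0\<^sub>m p q" for p q by (intro eq_matI) auto
  have lc: "(\<i> * l * levi_civita i j k) \<cdot>\<^sub>m 1\<^sub>m n = - ((\<i> * l * levi_civita i k j) \<cdot>\<^sub>m 1\<^sub>m n)" for i j k n
    unfolding levi_civita_swap(1)[of i k j] by (intro eq_matI) auto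
  show ?thesis
    unfolding is_reduction_params_def
  proof (intro conjI allI ballI)
    show "parDmu (curl_params S l) \<mu> ks \<in> carrier_mat (ncomp S \<mu>) (ncomp S 0)"
      if "\<mu> \<in> {1..<N}" "ks \<in> multi_indices \<mu>" for \<mu> ks
      using B[OF that] by (simp add: curl_params_def)
    show "parDbar (curl_params S l) i j k = - parDbar (curl_params S l) i k j" for i j k
      by (simp only: curl_params_def reduction_params.simps) (rule lc)
  qed (use A B0 in \<open>auto simp: curl_params_def z\<close>)
qed

lemma sum_slot_pderivs:
  "(\<Sum>b<4 * n + m. slot n x y z b * pderivs ks (slot n v\<^sub>0 d v\<^sub>1 b) p) =
   (\<Sum>b<n. x b * pderivs ks (v\<^sub>0 b) p) + (\<Sum>j\<in>UNIV. \<Sum>b<n. y j b * pderivs ks (d j b) p) +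
   (\<Sum>b<m. z b * pderivs ks (v\<^sub>1 b) p)"
  unfolding slot_comp[where f = "\<lambda>f. pderivs ks f p"] slot_comp2[where f = "(*)"] by (rule sum_slot)

lemma regroup_reduced:
  assumes "b < reduced_comp S \<nu>"
  shows "regroup (ncomp S) v d \<nu> b = (if \<nu> = 0 then slot (ncomp S 0) (v 0) d (v 1) b else v (\<nu> + 1) b)"
proof (cases "\<nu> = 0")
  case True
  then show ?thesis using assms regroup_0_eq_slot[of b "ncomp S" v d] by (simp add: reduced_comp_def)
qed (simp add: regroup_def)

lemma mat_app_uminus: "C \<in> carrier_mat p q \<Longrightarrow> a < p \<Longrightarrow> mat_app (- C) u a x = - mat_app C u a x"
  by (simp add: mat_app_def sum_negf)

lemma mat_app_diff: "mat_app C (\<lambda>b y. f b y - g b y) a x = mat_app C f a x - mat_app C g a x"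
  by (simp add: mat_app_def sum_subtractf algebra_simps)

lemma mat_app_zero_mat [simp]: "a < p \<Longrightarrow> mat_app (0\<^sub>m p q) u a x = 0"
  by (simp add: mat_app_def)

lemma mat_app_eq_sum: "C \<in> carrier_mat p q \<Longrightarrow> mat_app C u a x = (\<Sum>b<q. C $$ (a, b) * u b x)"
  by (auto simp: mat_app_def)


lemma sum_to_first: "(\<Sum>m\<le>k. f m) = f 0" if "\<And>m. 0 < m \<Longrightarrow> m \<le> k \<Longrightarrow> f m = (0 :: complex)" for k :: nat
  using that by (subst sum.remove[of _ 0]) auto

section \<open>The equations of the curl reduction, row by row\<close>

lemma reduced_rhs_row_v0:
  assumes N: "N \<ge> 2" and S: "is_ft_system N S" and a: "a < ncomp S 0"
  shows "(\<Sum>\<nu>=0..min (0 + 1) (N - 1 - 1). \<Sum>m\<le>0 + 1 - \<nu>. \<Sum>ks\<in>multi_indices m. \<Sum>b<reduced_comp S \<nu>.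
       row_v0 S a \<nu> ks b * pderivs ks (regroup (ncomp S) v d \<nu> b) x) + source S 0 t a x =
    red_rhs_v0 S (curl_params S l) t v d a x"
proof -
  have A: "coefA S 0 0 [k] \<in> carrier_mat (ncomp S 0) (ncomp S 0)" for k
    using S N unfolding is_ft_system_def by (auto simp: multi_indices_def)
  have A1: "coefA S 0 1 [] \<in> carrier_mat (ncomp S 0) (ncomp S 1)"
    using S N unfolding is_ft_system_def by (auto simp: multi_indices_def)
  have B: "coefB S 0 1 0 [] \<in> carrier_mat (ncomp S 0) (ncomp S 0)"
    using S N unfolding is_ft_system_def by (auto simp: multi_indices_def)
  let ?T = "\<lambda>\<nu> ks. \<Sum>b<reduced_comp S \<nu>. row_v0 S a \<nu> ks b * pderivs ks (regroup (ncomp S) v d \<nu> b) x"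
  have z: "?T \<nu> ks = 0" if "\<nu> \<noteq> 0 \<or> ks \<noteq> []" for \<nu> ks
    using that by (auto simp: row_v0_def)
  have "(\<Sum>\<nu>=0..min (0 + 1) (N - 1 - 1). \<Sum>m\<le>0 + 1 - \<nu>. \<Sum>ks\<in>multi_indices m. ?T \<nu> ks) =
      (\<Sum>m\<le>0 + 1 - 0. \<Sum>ks\<in>multi_indices m. ?T 0 ks)"
    unfolding atLeast0AtMost by (intro sum_to_first sum.neutral ballI z) auto
  also have "\<dots> = (\<Sum>ks\<in>multi_indices 0. ?T 0 ks)"
    by (intro sum_to_first sum.neutral ballI z) (auto simp: multi_indices_def)
  also have "\<dots> = ?T 0 []" by simp
  also have "\<dots> = (\<Sum>b<4 * ncomp S 0 + ncomp S 1. slot (ncomp S 0) (\<lambda>b. coefB S 0 1 0 [] $$ (a, b))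
      (\<lambda>j b. coefA S 0 0 [j] $$ (a, b)) (\<lambda>b. coefA S 0 1 [] $$ (a, b)) b *
      pderivs [] (slot (ncomp S 0) (v 0) d (v 1) b) x)"
    by (intro sum.cong) (auto simp: regroup_reduced reduced_comp_def row_v0_def regroup_0_eq_slot)
  also have "\<dots> = mat_app (coefB S 0 1 0 []) (v 0) a x + (\<Sum>j\<in>UNIV. mat_app (coefA S 0 0 [j]) (d j) a x) +
      mat_app (coefA S 0 1 []) (v 1) a x"
    unfolding sum_slot_pderivs mat_app_eq_sum[OF A] mat_app_eq_sum[OF A1] mat_app_eq_sum[OF B] by simp
  finally have lhs: "(\<Sum>\<nu>=0..min (0 + 1) (N - 1 - 1). \<Sum>m\<le>0 + 1 - \<nu>. \<Sum>ks\<in>multi_indices m. ?T \<nu> ks) =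
      mat_app (coefB S 0 1 0 []) (v 0) a x + (\<Sum>j\<in>UNIV. mat_app (coefA S 0 0 [j]) (d j) a x) +
      mat_app (coefA S 0 1 []) (v 1) a x" .
  have c: "mat_app (- coefA S 0 0 [k]) (constr1 (v 0) d k) a x =
      mat_app (coefA S 0 0 [k]) (d k) a x - mat_app (coefA S 0 0 [k]) (\<lambda>b. pderiv_dir k (v 0 b)) a x" for k
  proof -
    have "constr1 (v 0) d k = (\<lambda>b y. pderiv_dir k (v 0 b) y - d k b y)"
      by (simp add: constr1_def fun_eq_iff)
    then show ?thesis unfolding mat_app_uminus[OF A a] by (simp only: mat_app_diff) simp
  qed
  show ?thesis
    unfolding lhs red_rhs_v0_def curl_params_def reduction_params.simps c
    using a by (simp add: sum_subtractf)
qed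

lemma reduced_rhs_row_d:
  assumes N: "N \<ge> 2" and S: "is_ft_system N S" and a: "a < ncomp S 0"
  shows "(\<Sum>\<nu>=0..min (0 + 1) (N - 1 - 1). \<Sum>m\<le>0 + 1 - \<nu>. \<Sum>ks\<in>multi_indices m. \<Sum>b<reduced_comp S \<nu>.
       row_d S l i a \<nu> ks b * pderivs ks (regroup (ncomp S) v d \<nu> b) x) + pderiv_dir i (source S 0 t a) x =
    red_rhs_d S (curl_params S l) t v d i a x"
proof -
  let ?n = "ncomp S 0"
  have A: "coefA S 0 0 [k] \<in> carrier_mat (ncomp S 0) (ncomp S 0)" for k
    using S N unfolding is_ft_system_def by (auto simp: multi_indices_def)
  have A1: "coefA S 0 1 [] \<in> carrier_mat (ncomp S 0) (ncomp S 1)"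
    using S N unfolding is_ft_system_def by (auto simp: multi_indices_def)
  have B: "coefB S 0 1 0 [] \<in> carrier_mat (ncomp S 0) (ncomp S 0)"
    using S N unfolding is_ft_system_def by (auto simp: multi_indices_def)
  let ?T = "\<lambda>\<nu> ks. \<Sum>b<reduced_comp S \<nu>. row_d S l i a \<nu> ks b * pderivs ks (regroup (ncomp S) v d \<nu> b) x"
  have z: "?T \<nu> ks = 0" if "\<nu> \<noteq> 0" for \<nu> ks
    using that by (auto simp: row_d_def)
  have r: "?T 0 ks = (\<Sum>b<4 * ?n + ncomp S 1. row_d S l i a 0 ks b * pderivs ks (slot ?n (v 0) d (v 1) b) x)" for ks
    by (intro sum.cong) (auto simp: regroup_reduced reduced_comp_def regroup_0_eq_slot)
  have "(\<Sum>\<nu>=0..min (0 + 1) (N - 1 - 1). \<Sum>m\<le>0 + 1 - \<nu>. \<Sum>ks\<in>multi_indices m. ?T \<nu> ks) =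
      (\<Sum>m\<le>0 + 1 - 0. \<Sum>ks\<in>multi_indices m. ?T 0 ks)"
    unfolding atLeast0AtMost by (intro sum_to_first sum.neutral ballI z) auto
  also have "\<dots> = ?T 0 [] + (\<Sum>ks\<in>multi_indices (Suc 0). ?T 0 ks)" by simp
  also have "(\<Sum>ks\<in>multi_indices (Suc 0). ?T 0 ks) = (\<Sum>k\<in>UNIV. ?T 0 [k])"
    unfolding sum_multi_indices_snoc by simp
  also have "?T 0 [] = mat_app (coefB S 0 1 0 []) (d i) a x"
  proof -
    have "?T 0 [] = (\<Sum>j\<in>UNIV. \<Sum>b<?n. (if j = i then coefB S 0 1 0 [] $$ (a, b) else 0) * d j b x)"
      unfolding r unfolding row_d_def using sum_slot_pderivs[where m = "ncomp S 1" and n = ?n and x = "\<lambda>b. 0"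
          and y = "\<lambda>j b. if j = i then coefB S 0 1 0 [] $$ (a, b) else 0" and z = "\<lambda>b. 0"
          and ks = "[]" and v\<^sub>0 = "v 0" and d = d and v\<^sub>1 = "v 1" and p = x] by simp
    also have "\<dots> = (\<Sum>j\<in>UNIV. if j = i then mat_app (coefB S 0 1 0 []) (d i) a x else 0)"
      unfolding mat_app_eq_sum[OF B] by (intro sum.cong) auto
    finally show ?thesis by simp
  qed
  also have "(\<Sum>k\<in>UNIV. ?T 0 [k]) = (\<Sum>j\<in>UNIV. mat_app (coefA S 0 0 [j]) (\<lambda>b. pderiv_dir i (d j b)) a x) +
      mat_app (coefA S 0 1 []) (\<lambda>b. pderiv_dir i (v 1 b)) a x +
      (\<Sum>k\<in>UNIV. \<Sum>j\<in>UNIV. \<i> * l * levi_civita i k j * pderiv_dir k (d j a) x)"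
  proof -
    have "?T 0 [k] = (\<Sum>j\<in>UNIV. \<Sum>b<?n. ((if k = i then coefA S 0 0 [j] $$ (a, b) else 0) +
          (if a = b then \<i> * l * levi_civita i k j else 0)) * pderiv_dir k (d j b) x) +
        (\<Sum>b<ncomp S 1. (if k = i then coefA S 0 1 [] $$ (a, b) else 0) * pderiv_dir k (v 1 b) x)" for k
      unfolding r unfolding row_d_def using sum_slot_pderivs[where m = "ncomp S 1" and n = ?n and x = "\<lambda>b. 0"
          and y = "\<lambda>j b. (if k = i then coefA S 0 0 [j] $$ (a, b) else 0) +
            (if a = b then \<i> * l * levi_civita i k j else 0)"
          and z = "\<lambda>b. if k = i then coefA S 0 1 [] $$ (a, b) else 0"
          and ks = "[k]" and v\<^sub>0 = "v 0" and d = d and v\<^sub>1 = "v 1" and p = x]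
      by (simp cong: if_cong)
    also have "\<dots> k = (if k = i then (\<Sum>j\<in>UNIV. mat_app (coefA S 0 0 [j]) (\<lambda>b. pderiv_dir i (d j b)) a x) +
        mat_app (coefA S 0 1 []) (\<lambda>b. pderiv_dir i (v 1 b)) a x else 0) +
        (\<Sum>j\<in>UNIV. \<i> * l * levi_civita i k j * pderiv_dir k (d j a) x)" for k
    proof -
      have "(\<Sum>b<?n. ((if k = i then coefA S 0 0 [j] $$ (a, b) else 0) +
          (if a = b then \<i> * l * levi_civita i k j else 0)) * pderiv_dir k (d j b) x) =
          (if k = i then mat_app (coefA S 0 0 [j]) (\<lambda>b. pderiv_dir i (d j b)) a x else 0) +
          \<i> * l * levi_civita i k j * pderiv_dir k (d j a) x" for j
      proof -
        have "(\<Sum>b<?n. (if a = b then \<i> * l * levi_civita i k j else 0) * pderiv_dir k (d j b) x) =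
            (\<Sum>b<?n. if a = b then \<i> * l * levi_civita i k j * pderiv_dir k (d j b) x else 0)"
          by (intro sum.cong) auto
        then show ?thesis
          using a by (simp add: distrib_right sum.distrib mat_app_eq_sum[OF A])
      qed
      then show ?thesis by (simp add: sum.distrib mat_app_eq_sum[OF A1] del: One_nat_def)
    qed
    finally have T: "?T 0 [k] = (if k = i then (\<Sum>j\<in>UNIV. mat_app (coefA S 0 0 [j]) (\<lambda>b. pderiv_dir i (d j b)) a x) +
        mat_app (coefA S 0 1 []) (\<lambda>b. pderiv_dir i (v 1 b)) a x else 0) +
        (\<Sum>j\<in>UNIV. \<i> * l * levi_civita i k j * pderiv_dir k (d j a) x)" for k .
    show ?thesis unfolding T by (simp add: sum.distrib)
  qed
  finally have lhs: "(\<Sum>\<nu>=0..min (0 + 1) (N - 1 - 1). \<Sum>m\<le>0 + 1 - \<nu>. \<Sum>ks\<in>multi_indices m. ?T \<nu> ks) =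
      mat_app (coefB S 0 1 0 []) (d i) a x + ((\<Sum>j\<in>UNIV. mat_app (coefA S 0 0 [j]) (\<lambda>b. pderiv_dir i (d j b)) a x) +
      mat_app (coefA S 0 1 []) (\<lambda>b. pderiv_dir i (v 1 b)) a x +
      (\<Sum>k\<in>UNIV. \<Sum>j\<in>UNIV. \<i> * l * levi_civita i k j * pderiv_dir k (d j a) x))" .
  \<comment> \<open>This constraint term exchanges the gradient of \<open>v^0\<close> in the lower
    order part for \<open>d i\<close>, so that no derivative of \<open>v^0\<close> remains.\<close>
  have c1: "(\<Sum>k\<in>UNIV. mat_app (if i = k then - coefB S 0 1 0 [] else 0\<^sub>m ?n ?n) (constr1 (v 0) d k) a x) =
      mat_app (coefB S 0 1 0 []) (d i) a x - mat_app (coefB S 0 1 0 []) (\<lambda>b. pderiv_dir i (v 0 b)) a x"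
  proof -
    have "constr1 (v 0) d i = (\<lambda>b y. pderiv_dir i (v 0 b) y - d i b y)"
      by (simp add: constr1_def fun_eq_iff)
    then have "mat_app (- coefB S 0 1 0 []) (constr1 (v 0) d i) a x =
        mat_app (coefB S 0 1 0 []) (d i) a x - mat_app (coefB S 0 1 0 []) (\<lambda>b. pderiv_dir i (v 0 b)) a x"
      unfolding mat_app_uminus[OF B a] by (simp only: mat_app_diff) simp
    moreover have "(\<Sum>k\<in>UNIV. mat_app (if i = k then - coefB S 0 1 0 [] else 0\<^sub>m ?n ?n) (constr1 (v 0) d k) a x) =
        (\<Sum>k\<in>UNIV. if i = k then mat_app (- coefB S 0 1 0 []) (constr1 (v 0) d i) a x else 0)"
      using a by (intro sum.cong) auto
    ultimately show ?thesis by simp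
  qed
  \<comment> \<open>By antisymmetry of the Levi-Civita symbol the two terms of
    \<open>constr2\<close> contribute equally, which absorbs its factor 1/2.\<close>
  have c2: "(\<Sum>k\<in>UNIV. \<Sum>j\<in>UNIV. mat_app ((\<i> * l * levi_civita i k j) \<cdot>\<^sub>m 1\<^sub>m ?n) (constr2 d k j) a x) =
      (\<Sum>k\<in>UNIV. \<Sum>j\<in>UNIV. \<i> * l * levi_civita i k j * pderiv_dir k (d j a) x)"
  proof -
    have "mat_app (c \<cdot>\<^sub>m 1\<^sub>m ?n) u a x = c * u a x" for c and u :: "nat \<Rightarrow> scalar_field"
    proof -
      have "mat_app (c \<cdot>\<^sub>m 1\<^sub>m ?n) u a x = (\<Sum>b<?n. if a = b then c * u b x else 0)"
        unfolding mat_app_def using a by (intro sum.cong) auto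
      then show ?thesis using a by simp
    qed
    then have "(\<Sum>k\<in>UNIV. \<Sum>j\<in>UNIV. mat_app ((\<i> * l * levi_civita i k j) \<cdot>\<^sub>m 1\<^sub>m ?n) (constr2 d k j) a x) =
        (1 / 2) * (\<Sum>k\<in>UNIV. \<Sum>j\<in>UNIV. \<i> * l * levi_civita i k j * pderiv_dir k (d j a) x) -
        (1 / 2) * (\<Sum>k\<in>UNIV. \<Sum>j\<in>UNIV. \<i> * l * levi_civita i k j * pderiv_dir j (d k a) x)"
      by (simp add: constr2_def sum_distrib_left sum_subtractf[symmetric] algebra_simps)
    also have "(\<Sum>k\<in>UNIV. \<Sum>j\<in>UNIV. \<i> * l * levi_civita i k j * pderiv_dir j (d k a) x) =
        (\<Sum>j\<in>UNIV. \<Sum>k\<in>UNIV. \<i> * l * levi_civita i k j * pderiv_dir j (d k a) x)"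
      by (rule sum.swap)
    also have "\<dots> = - (\<Sum>j\<in>UNIV. \<Sum>k\<in>UNIV. \<i> * l * levi_civita i j k * pderiv_dir j (d k a) x)"
      by (subst levi_civita_swap(1)) (simp add: sum_negf)
    finally show ?thesis by simp
  qed
  show ?thesis
    unfolding lhs red_rhs_d_def curl_params_def reduction_params.simps c1 c2 by simp
qed

text \<open>The derivatives of \<open>v^0\<close> split by order: below \<open>\<mu>\<close> they
  stay, order \<open>\<mu>\<close> is exchanged for \<open>d\<close> by the parameter
  \<open>parDmu\<close>, and order \<open>\<mu> + 1\<close> is written with \<open>d\<close> in
  every reduction.\<close>

lemma reduced_rhs_row_v:
  assumes N: "N \<ge> 2" and S: "is_ft_system N S" and \<mu>: "1 \<le> \<mu>" "\<mu> < N" and a: "a < ncomp S \<mu>"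
    and sv: "\<And>\<mu> a. smooth_field (v \<mu> a)" and sd: "\<And>i a. smooth_field (d i a)"
  shows "(\<Sum>\<nu>=0..min \<mu> (N - 1 - 1). \<Sum>m\<le>\<mu> - \<nu>. \<Sum>ks\<in>multi_indices m. \<Sum>b<reduced_comp S \<nu>.
       row_v S \<mu> a \<nu> ks b * pderivs ks (regroup (ncomp S) v d \<nu> b) x) + source S \<mu> t a x =
    red_rhs_vmu N S (curl_params S l) t v d \<mu> a x"
proof -
  let ?n = "ncomp S 0"
  have A: "coefA S \<mu> \<nu> ks \<in> carrier_mat (ncomp S \<mu>) (ncomp S \<nu>)"
    if "\<nu> \<le> min (\<mu> + 1) (N - 1)" "ks \<in> multi_indices (\<mu> + 1 - \<nu>)" for \<nu> ks
    using S \<mu> that unfolding is_ft_system_def by blast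
  have B: "coefB S \<mu> \<rho> \<nu> ks \<in> carrier_mat (ncomp S \<mu>) (ncomp S \<nu>)"
    if "\<nu> \<le> \<mu>" "\<rho> \<in> {1..\<mu> - \<nu> + 1}" "ks \<in> multi_indices (\<mu> + 1 - \<nu> - \<rho>)" for \<nu> \<rho> ks
    using S \<mu> that unfolding is_ft_system_def by blast
  have C: "coefC S \<mu> \<nu> ks \<in> carrier_mat (ncomp S \<mu>) (ncomp S \<nu>)"
    if "\<nu> \<le> min (\<mu> + 1) (N - 1)" "length ks \<le> \<mu> + 1 - \<nu>" for \<nu> ks
  proof (cases "length ks = \<mu> + 1 - \<nu>")
    case True
    then show ?thesis using A that by (simp add: coefC_def multi_indices_def)
  next
    case False
      then have "\<nu> \<le> \<mu>" "\<mu> + 1 - \<nu> - length ks \<in> {1..\<mu> - \<nu> + 1}"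
      "ks \<in> multi_indices (\<mu> + 1 - \<nu> - (\<mu> + 1 - \<nu> - length ks))"
      using that by (auto simp: multi_indices_def)
    from B[OF this] show ?thesis using False by (simp add: coefC_def)
  qed
  let ?T = "\<lambda>\<nu> ks. \<Sum>b<reduced_comp S \<nu>. row_v S \<mu> a \<nu> ks b * pderivs ks (regroup (ncomp S) v d \<nu> b) x"
  have dop: "diff_op m (coefC S \<mu> \<nu>) u a x = (\<Sum>ks\<in>multi_indices m. \<Sum>b<ncomp S \<nu>. coefC S \<mu> \<nu> ks $$ (a, b) * pderivs ks (u b) x)"
    if "\<nu> \<le> min (\<mu> + 1) (N - 1)" "m \<le> \<mu> + 1 - \<nu>" for m \<nu> and u :: "nat \<Rightarrow> scalar_field"
    unfolding diff_op_def using that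
    by (intro sum.cong refl mat_app_eq_sum[OF C]) (auto simp: multi_indices_def)
  have high: "(\<Sum>m\<le>\<mu> - \<nu>. \<Sum>ks\<in>multi_indices m. ?T \<nu> ks) =
      (\<Sum>m\<le>\<mu> - \<nu>. diff_op m (coefC S \<mu> (\<nu> + 1)) (v (\<nu> + 1)) a x)"
    if "1 \<le> \<nu>" "\<nu> \<le> min \<mu> (N - 1 - 1)" for \<nu>
    using that by (intro sum.cong refl) (auto simp: dop row_v_def reduced_comp_def regroup_def)
  \<comment> \<open>Collects the derivatives of \<open>d\<close> of order \<open>m\<close>, with the
    coefficients that \<open>v^0\<close> has at order \<open>m + 1\<close>. Only
    \<open>m = \<mu>\<close> (from \<open>A\<close>) and \<open>m = \<mu> - 1\<close> (from
    \<open>B\<close> with \<open>\<rho> = 1\<close>) occur.\<close>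
  define Dk where "Dk m = (\<Sum>ks\<in>multi_indices m. \<Sum>j\<in>UNIV.
      mat_app (coefC S \<mu> 0 (ks @ [j])) (\<lambda>b. pderivs ks (d j b)) a x)" for m
  have low: "(\<Sum>ks\<in>multi_indices m. ?T 0 ks) =
      (if m < \<mu> then diff_op m (coefC S \<mu> 0) (v 0) a x else 0) + (if \<mu> \<le> m + 1 then Dk m else 0) +
      diff_op m (coefC S \<mu> 1) (v 1) a x" if m: "m \<le> \<mu>" for m
  proof -
    have "?T 0 ks = (\<Sum>b<?n. (if m < \<mu> then coefC S \<mu> 0 ks $$ (a, b) else 0) * pderivs ks (v 0 b) x) +
        (\<Sum>j\<in>UNIV. \<Sum>b<?n. (if \<mu> \<le> m + 1 then coefC S \<mu> 0 (ks @ [j]) $$ (a, b) else 0) * pderivs ks (d j b) x) +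
        (\<Sum>b<ncomp S 1. coefC S \<mu> 1 ks $$ (a, b) * pderivs ks (v 1 b) x)" if ks: "ks \<in> multi_indices m" for ks
    proof -
      have len: "length ks = m" using ks by (simp add: multi_indices_def)
      have "?T 0 ks = (\<Sum>b<4 * ?n + ncomp S 1. row_v S \<mu> a 0 ks b * pderivs ks (slot ?n (v 0) d (v 1) b) x)"
        by (intro sum.cong) (auto simp: regroup_reduced reduced_comp_def regroup_0_eq_slot)
      then show ?thesis unfolding row_v_def sum_slot_pderivs[symmetric] by (simp add: len)
    qed
    moreover have "(\<Sum>ks\<in>multi_indices m. \<Sum>b<?n. (if m < \<mu> then coefC S \<mu> 0 ks $$ (a, b) else 0) * pderivs ks (v 0 b) x) =
        (if m < \<mu> then diff_op m (coefC S \<mu> 0) (v 0) a x else 0)"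
      by (simp add: dop)
    moreover have "(\<Sum>ks\<in>multi_indices m. \<Sum>j\<in>UNIV. \<Sum>b<?n.
        (if \<mu> \<le> m + 1 then coefC S \<mu> 0 (ks @ [j]) $$ (a, b) else 0) * pderivs ks (d j b) x) =
        (if \<mu> \<le> m + 1 then Dk m else 0)"
      unfolding Dk_def using m
      by (auto intro!: sum.cong mat_app_eq_sum[symmetric] C simp: multi_indices_def)
    ultimately show ?thesis
      using m \<mu> N by (simp add: sum.distrib dop)
  qed
  have v0sum: "(\<Sum>m\<le>\<mu>. if m < \<mu> then diff_op m (coefC S \<mu> 0) (v 0) a x else 0) =
      (\<Sum>m<\<mu>. diff_op m (coefC S \<mu> 0) (v 0) a x)"
    by (simp add: lessThan_Suc_atMost[symmetric])
  have dsum: "(\<Sum>m\<le>\<mu>. if \<mu> \<le> m + 1 then Dk m else 0) = Dk \<mu> + Dk (\<mu> - 1)"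
  proof -
    have "(\<Sum>m\<le>\<mu>. if \<mu> \<le> m + 1 then Dk m else 0) = (\<Sum>m\<in>{\<mu> - 1, \<mu>}. Dk m)"
      by (rule sum.mono_neutral_cong_right) auto
    then show ?thesis using \<mu> by (simp add: add.commute)
  qed
  have "(\<Sum>\<nu>=0..min \<mu> (N - 1 - 1). \<Sum>m\<le>\<mu> - \<nu>. \<Sum>ks\<in>multi_indices m. ?T \<nu> ks) =
      (\<Sum>m\<le>\<mu>. \<Sum>ks\<in>multi_indices m. ?T 0 ks) +
      (\<Sum>\<nu>=1..min \<mu> (N - 1 - 1). \<Sum>m\<le>\<mu> - \<nu>. \<Sum>ks\<in>multi_indices m. ?T \<nu> ks)"
    by (subst sum.atLeast_Suc_atMost) auto
  also have "(\<Sum>m\<le>\<mu>. \<Sum>ks\<in>multi_indices m. ?T 0 ks) =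
      (\<Sum>m<\<mu>. diff_op m (coefC S \<mu> 0) (v 0) a x) + (Dk \<mu> + Dk (\<mu> - 1)) +
      (\<Sum>m\<le>\<mu>. diff_op m (coefC S \<mu> 1) (v 1) a x)"
    unfolding v0sum[symmetric] dsum[symmetric] sum.distrib[symmetric] by (intro sum.cong low) auto
  also have "(\<Sum>\<nu>=1..min \<mu> (N - 1 - 1). \<Sum>m\<le>\<mu> - \<nu>. \<Sum>ks\<in>multi_indices m. ?T \<nu> ks) =
      (\<Sum>\<nu>=1..min \<mu> (N - 1 - 1). \<Sum>m\<le>\<mu> - \<nu>. diff_op m (coefC S \<mu> (\<nu> + 1)) (v (\<nu> + 1)) a x)"
    by (intro sum.cong[OF refl] high) auto
  \<comment> \<open>Passes from block numbers of the reduction to those of the original system. The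
    field \<open>v^1\<close> is missing here because it sits inside block 0; its terms are joined
    below.\<close>
  also have "\<dots> = (\<Sum>\<nu>=2..min (\<mu> + 1) (N - 1). \<Sum>m\<le>\<mu> + 1 - \<nu>. diff_op m (coefC S \<mu> \<nu>) (v \<nu>) a x)"
    by (rule sum.reindex_bij_witness[of _ "\<lambda>\<nu>. \<nu> - 1" "\<lambda>\<nu>. \<nu> + 1"]) (use N in auto)
  finally have "(\<Sum>\<nu>=0..min \<mu> (N - 1 - 1). \<Sum>m\<le>\<mu> - \<nu>. \<Sum>ks\<in>multi_indices m. ?T \<nu> ks) =
      (\<Sum>m<\<mu>. diff_op m (coefC S \<mu> 0) (v 0) a x) + (Dk \<mu> + Dk (\<mu> - 1)) +
      ((\<Sum>m\<le>\<mu>. diff_op m (coefC S \<mu> 1) (v 1) a x) +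
      (\<Sum>\<nu>=2..min (\<mu> + 1) (N - 1). \<Sum>m\<le>\<mu> + 1 - \<nu>. diff_op m (coefC S \<mu> \<nu>) (v \<nu>) a x))"
    by simp
  also have "(\<Sum>m\<le>\<mu>. diff_op m (coefC S \<mu> 1) (v 1) a x) +
      (\<Sum>\<nu>=2..min (\<mu> + 1) (N - 1). \<Sum>m\<le>\<mu> + 1 - \<nu>. diff_op m (coefC S \<mu> \<nu>) (v \<nu>) a x) =
      (\<Sum>\<nu>=1..min (\<mu> + 1) (N - 1). \<Sum>m\<le>\<mu> + 1 - \<nu>. diff_op m (coefC S \<mu> \<nu>) (v \<nu>) a x)"
    using N \<mu> by (subst sum.atLeast_Suc_atMost[of 1]) (auto simp: numeral_2_eq_2)
  finally have lhs: "(\<Sum>\<nu>=0..min \<mu> (N - 1 - 1). \<Sum>m\<le>\<mu> - \<nu>. \<Sum>ks\<in>multi_indices m. ?T \<nu> ks) =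
      (\<Sum>m<\<mu>. diff_op m (coefC S \<mu> 0) (v 0) a x) + (Dk \<mu> + Dk (\<mu> - 1)) +
      (\<Sum>\<nu>=1..min (\<mu> + 1) (N - 1). \<Sum>m\<le>\<mu> + 1 - \<nu>. diff_op m (coefC S \<mu> \<nu>) (v \<nu>) a x)" .
  have top: "Dk \<mu> = (\<Sum>ks\<in>multi_indices \<mu>. \<Sum>k\<in>UNIV. mat_app (coefA S \<mu> 0 (ks @ [k])) (\<lambda>b. pderivs ks (d k b)) a x)"
    unfolding Dk_def by (intro sum.cong refl) (auto simp: coefC_def multi_indices_def)
  \<comment> \<open>The exchange at order \<open>\<mu>\<close>: the terms in \<open>d\<close> equal
    those in \<open>v^0\<close> plus the constraint term with parameter \<open>- B\<close>.\<close>
  have sub: "Dk (\<mu> - 1) = diff_op \<mu> (coefC S \<mu> 0) (v 0) a x + (\<Sum>ks\<in>multi_indices (\<mu> - 1). \<Sum>k\<in>UNIV.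
      mat_app (- coefB S \<mu> 1 0 (ks @ [k])) (\<lambda>b. pderivs ks (constr1 (v 0) d k b)) a x)"
  proof -
    have "mat_app (- coefB S \<mu> 1 0 (ks @ [k])) (\<lambda>b. pderivs ks (constr1 (v 0) d k b)) a x =
        mat_app (coefC S \<mu> 0 (ks @ [k])) (\<lambda>b. pderivs ks (d k b)) a x -
        mat_app (coefC S \<mu> 0 (ks @ [k])) (\<lambda>b. pderivs (ks @ [k]) (v 0 b)) a x"
      if ks: "ks \<in> multi_indices (\<mu> - 1)" for ks k
    proof -
      have "constr1 (v 0) d k b = (\<lambda>y. pderiv_dir k (v 0 b) y - d k b y)" for b
        by (simp add: constr1_def fun_eq_iff)
      \<comment> \<open>Smoothness of the fields enters here: the higher derivatives have to be
        distributed over the difference in the constraint.\<close>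
      then have "pderivs ks (constr1 (v 0) d k b) = (\<lambda>y. pderivs (ks @ [k]) (v 0 b) y - pderivs ks (d k b) y)" for b
        unfolding pderivs_append_single by (simp only: pderivs_diff[OF smooth_pderiv_dir[OF sv] sd])
      then have "(\<lambda>b. pderivs ks (constr1 (v 0) d k b)) = (\<lambda>b y. pderivs (ks @ [k]) (v 0 b) y - pderivs ks (d k b) y)"
        by simp
      moreover have Bc: "coefB S \<mu> 1 0 (ks @ [k]) \<in> carrier_mat (ncomp S \<mu>) ?n"
        using ks \<mu> by (intro B) (auto simp: multi_indices_def)
      moreover have "coefC S \<mu> 0 (ks @ [k]) = coefB S \<mu> 1 0 (ks @ [k])"
        using ks \<mu> by (auto simp: coefC_def multi_indices_def)
      ultimately show ?thesis
        unfolding mat_app_uminus[OF Bc a] by (simp only: mat_app_diff) simp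
    qed
    then have "(\<Sum>ks\<in>multi_indices (\<mu> - 1). \<Sum>k\<in>UNIV.
        mat_app (- coefB S \<mu> 1 0 (ks @ [k])) (\<lambda>b. pderivs ks (constr1 (v 0) d k b)) a x) =
        Dk (\<mu> - 1) - (\<Sum>ks\<in>multi_indices (\<mu> - 1). \<Sum>k\<in>UNIV.
          mat_app (coefC S \<mu> 0 (ks @ [k])) (\<lambda>b. pderivs (ks @ [k]) (v 0 b)) a x)"
      unfolding Dk_def by (simp add: sum_subtractf)
    also have "(\<Sum>ks\<in>multi_indices (\<mu> - 1). \<Sum>k\<in>UNIV.
          mat_app (coefC S \<mu> 0 (ks @ [k])) (\<lambda>b. pderivs (ks @ [k]) (v 0 b)) a x) =
        diff_op (Suc (\<mu> - 1)) (coefC S \<mu> 0) (v 0) a x"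
      unfolding diff_op_def sum_multi_indices_snoc ..
    finally show ?thesis using \<mu> by simp
  qed
  have z: "(\<Sum>ks\<in>multi_indices (\<mu> - 1). \<Sum>k\<in>UNIV. \<Sum>j\<in>UNIV.
      mat_app (0\<^sub>m (ncomp S \<mu>) ?n) (\<lambda>b. pderivs ks (constr2 d k j b)) a x) = 0"
    using a by simp
  have "(\<Sum>m<\<mu> + 1. diff_op m (coefC S \<mu> 0) (v 0) a x) =
      (\<Sum>m<\<mu>. diff_op m (coefC S \<mu> 0) (v 0) a x) + diff_op \<mu> (coefC S \<mu> 0) (v 0) a x"
    by simp
  then show ?thesis
    unfolding lhs red_rhs_vmu_def curl_params_def reduction_params.simps z top[symmetric]
    using sub lower_order_sum_eq[OF \<mu>(2), of S v a x] by (simp add: add_ac)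
qed

lemma is_ft_reduction_curl:
  assumes N: "N \<ge> 2" and S: "is_ft_system N S"
  shows "is_ft_reduction N S (curl_reduction S l)"
proof -
  have "ft_rhs (N - 1) (curl_reduction S l) t (regroup (ncomp S) v d) \<kappa> a x =
      regroup (ncomp S) (red_rhs_v N S (curl_params S l) t v d) (red_rhs_d S (curl_params S l) t v d) \<kappa> a x"
    if sv: "\<And>\<mu> a. smooth_field (v \<mu> a)" and sd: "\<And>i a. smooth_field (d i a)"
      and \<kappa>: "\<kappa> < N - 1" and a: "a < reduced_comp S \<kappa>" for t v d \<kappa> a x
  proof -
    let ?sum = "\<lambda>c. \<Sum>\<nu>=0..min (\<kappa> + 1) (N - 1 - 1). \<Sum>m\<le>\<kappa> + 1 - \<nu>. \<Sum>ks\<in>multi_indices m.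
        \<Sum>b<reduced_comp S \<nu>. c \<nu> ks b * pderivs ks (regroup (ncomp S) v d \<nu> b) x"
    have rhs: "ft_rhs (N - 1) (curl_reduction S l) t (regroup (ncomp S) v d) \<kappa> a x =
        ?sum (reduced_coef S l \<kappa> a) + reduced_source S \<kappa> t a x"
      unfolding curl_reduction_def by (rule ft_rhs_mk_system) (fact \<kappa>, fact a)
    show ?thesis
    proof (cases "\<kappa> = 0")
      case True
      have a': "a < 4 * ncomp S 0 + ncomp S 1" using a True by (simp add: reduced_comp_def)
      have r: "regroup (ncomp S) (red_rhs_v N S (curl_params S l) t v d) (red_rhs_d S (curl_params S l) t v d) \<kappa> a x =
          slot (ncomp S 0) (\<lambda>b. red_rhs_v0 S (curl_params S l) t v d b x)
            (\<lambda>i b. red_rhs_d S (curl_params S l) t v d i b x)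
            (\<lambda>b. red_rhs_vmu N S (curl_params S l) t v d 1 b x) a"
        using True regroup_0_eq_slot[where n = "ncomp S" and a = a, OF a']
        by (simp add: slot_comp[where f = "\<lambda>f. f x"] red_rhs_v_def)
      have "?sum (reduced_coef S l \<kappa> a) + reduced_source S \<kappa> t a x =
          slot (ncomp S 0) (\<lambda>b. ?sum (row_v0 S b) + source S 0 t b x)
            (\<lambda>i b. ?sum (row_d S l i b) + pderiv_dir i (source S 0 t b) x)
            (\<lambda>b. ?sum (row_v S 1 b) + source S 1 t b x) a"
      proof -
        have rc: "reduced_coef S l \<kappa> a = slot (ncomp S 0) (row_v0 S) (row_d S l) (row_v S 1) a"
          and rs: "reduced_source S \<kappa> t a =
            slot (ncomp S 0) (source S 0 t) (\<lambda>i b. pderiv_dir i (source S 0 t b)) (source S 1 t) a"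
          using True by (simp_all add: reduced_coef_def reduced_source_def)
        show ?thesis unfolding rc rs by (rule slot_comp2[where f = "\<lambda>c f. ?sum c + f x"])
      qed
      also have "\<dots> = slot (ncomp S 0) (\<lambda>b. red_rhs_v0 S (curl_params S l) t v d b x)
            (\<lambda>i b. red_rhs_d S (curl_params S l) t v d i b x)
            (\<lambda>b. red_rhs_vmu N S (curl_params S l) t v d 1 b x) a"
      proof (rule slot_cong[OF a'])
        fix b assume b: "b < ncomp S 1"
        show "?sum (row_v S 1 b) + source S 1 t b x = red_rhs_vmu N S (curl_params S l) t v d 1 b x"
          using reduced_rhs_row_v[where x = x and t = t and l = l and v = v and d = d, OF N S _ _ b sv sd] N True by simp
      qed (use True reduced_rhs_row_v0[OF N S] reduced_rhs_row_d[OF N S] in simp_all)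
      finally show ?thesis unfolding rhs r .
    next
      case False
      have a': "a < ncomp S (\<kappa> + 1)" using a False by (simp add: reduced_comp_def)
      have "regroup (ncomp S) (red_rhs_v N S (curl_params S l) t v d) (red_rhs_d S (curl_params S l) t v d) \<kappa> a =
          red_rhs_vmu N S (curl_params S l) t v d (\<kappa> + 1) a"
        and "reduced_coef S l \<kappa> a = row_v S (\<kappa> + 1) a" "reduced_source S \<kappa> t a = source S (\<kappa> + 1) t a"
        using False by (simp_all add: regroup_def red_rhs_v_def reduced_coef_def reduced_source_def)
      moreover have "1 \<le> \<kappa> + 1" "\<kappa> + 1 < N" using \<kappa> by auto
      ultimately show ?thesis
        unfolding rhs by (simp only: reduced_rhs_row_v[where v = v and d = d, OF N S _ _ a' sv sd])
    qed
  qed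
  then have eq: "\<exists>D. is_reduction_params N S D \<and>
        (\<forall>t v d. (\<forall>\<mu> a. smooth_field (v \<mu> a)) \<longrightarrow> (\<forall>i a. smooth_field (d i a)) \<longrightarrow>
           (\<forall>\<kappa><N - 1. \<forall>a<ncomp (curl_reduction S l) \<kappa>. \<forall>x.
              ft_rhs (N - 1) (curl_reduction S l) t (regroup (ncomp S) v d) \<kappa> a x =
              regroup (ncomp S) (red_rhs_v N S D t v d) (red_rhs_d S D t v d) \<kappa> a x))"
    using is_reduction_params_curl[OF N S, of l] by (intro exI[of _ "curl_params S l"]) (simp add: curl_reduction_def)
  have "is_ft_system (N - 1) (curl_reduction S l)"
    unfolding curl_reduction_def using N by (intro is_ft_system_mk_system) simp
  with eq show ?thesis
    unfolding is_ft_reduction_def by (auto simp: curl_reduction_def reduced_comp_def)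
qed

section \<open>Block matrices\<close>

lemma block_indices_Suc: "block_indices (Suc N) n = block_indices N n @ map (Pair N) [0..<n N]"
  by (simp add: block_indices_def)

lemma length_block_indices: "length (block_indices N n) = (\<Sum>\<mu><N. n \<mu>)"
  by (induction N) (simp_all add: block_indices_Suc, simp add: block_indices_def)

lemma set_block_indices: "set (block_indices N n) = {(\<mu>, a). \<mu> < N \<and> a < n \<mu>}"
  by (auto simp: block_indices_def)

lemma distinct_block_indices: "distinct (block_indices N n)"
  by (induction N)
    (auto simp: block_indices_Suc set_block_indices distinct_map inj_on_def, simp add: block_indices_def)

lemma sum_block_indices:
  fixes h :: "nat \<Rightarrow> nat \<Rightarrow> 'a :: comm_monoid_add"
  shows "(\<Sum>i = 0..<(\<Sum>\<mu><N. n \<mu>). case block_indices N n ! i of (\<mu>, a) \<Rightarrow> h \<mu> a) = (\<Sum>\<mu><N. \<Sum>a<n \<mu>. h \<mu> a)"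
proof -
  have "(\<Sum>i = 0..<(\<Sum>\<mu><N. n \<mu>). case block_indices N n ! i of (\<mu>, a) \<Rightarrow> h \<mu> a) =
      sum_list (map (case_prod h) (block_indices N n))"
    by (simp add: sum_list_sum_nth length_block_indices)
  also have "\<dots> = sum (case_prod h) (set (block_indices N n))"
    by (rule sum_list_distinct_conv_sum_set[OF distinct_block_indices])
  also have "set (block_indices N n) = (SIGMA \<mu>:{..<N}. {..<n \<mu>})"
    by (auto simp: set_block_indices)
  also have "sum (case_prod h) \<dots> = (\<Sum>\<mu><N. \<Sum>a<n \<mu>. h \<mu> a)"
    by (subst sum.Sigma) auto
  finally show ?thesis .
qed

lemma nth_block_indices:
  assumes "i < (\<Sum>\<mu><N. n \<mu>)"
  obtains \<mu> a where "block_indices N n ! i = (\<mu>, a)" "\<mu> < N" "a < n \<mu>"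
  using assms nth_mem[of i "block_indices N n"] by (auto simp: length_block_indices set_block_indices)

definition block_vec :: "nat \<Rightarrow> (nat \<Rightarrow> nat) \<Rightarrow> (nat \<Rightarrow> nat \<Rightarrow> complex) \<Rightarrow> complex Matrix.vec" where
  "block_vec N n u = Matrix.vec (\<Sum>\<mu><N. n \<mu>) (\<lambda>i. case block_indices N n ! i of (\<mu>, a) \<Rightarrow> u \<mu> a)"

definition block_mat ::
    "nat \<Rightarrow> (nat \<Rightarrow> nat) \<Rightarrow> nat \<Rightarrow> (nat \<Rightarrow> nat) \<Rightarrow> (nat \<Rightarrow> nat \<Rightarrow> nat \<Rightarrow> nat \<Rightarrow> complex) \<Rightarrow> complex mat" where
  "block_mat N n M m f = Matrix.mat (\<Sum>\<mu><N. n \<mu>) (\<Sum>\<mu><M. m \<mu>)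
     (\<lambda>(i, j). case block_indices N n ! i of (\<mu>, a) \<Rightarrow> case block_indices M m ! j of (\<nu>, b) \<Rightarrow> f \<mu> a \<nu> b)"

definition block_apply ::
    "nat \<Rightarrow> (nat \<Rightarrow> nat) \<Rightarrow> (nat \<Rightarrow> nat \<Rightarrow> nat \<Rightarrow> nat \<Rightarrow> complex) \<Rightarrow> (nat \<Rightarrow> nat \<Rightarrow> complex) \<Rightarrow> nat \<Rightarrow> nat \<Rightarrow> complex" where
  "block_apply M m f u \<mu> a = (\<Sum>\<nu><M. \<Sum>b<m \<nu>. f \<mu> a \<nu> b * u \<nu> b)"

lemma block_vec_carrier [simp]: "block_vec N n u \<in> carrier_vec (\<Sum>\<mu><N. n \<mu>)"
  by (simp add: block_vec_def)

lemma block_mat_carrier [simp]: "block_mat N n M m f \<in> carrier_mat (\<Sum>\<mu><N. n \<mu>) (\<Sum>\<mu><M. m \<mu>)"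
  by (simp add: block_mat_def)

lemma block_vec_cong:
  "(\<And>\<mu> a. \<mu> < N \<Longrightarrow> a < n \<mu> \<Longrightarrow> u \<mu> a = u' \<mu> a) \<Longrightarrow> block_vec N n u = block_vec N n u'"
  by (intro eq_vecI) (auto simp: block_vec_def elim!: nth_block_indices split: prod.splits)

lemma block_mat_cong:
  "(\<And>\<mu> a \<nu> b. \<mu> < N \<Longrightarrow> a < n \<mu> \<Longrightarrow> \<nu> < M \<Longrightarrow> b < m \<nu> \<Longrightarrow> f \<mu> a \<nu> b = g \<mu> a \<nu> b) \<Longrightarrow>
   block_mat N n M m f = block_mat N n M m g"
  by (intro eq_matI) (auto simp: block_mat_def elim!: nth_block_indices)

lemma block_vec_surj:
  assumes "v \<in> carrier_vec (\<Sum>\<mu><N. n \<mu>)"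
  obtains u where "v = block_vec N n u"
proof -
  \<comment> \<open>The position of a pair in the list of block indices; distinctness of the list
    makes it unique, so it inverts the enumeration.\<close>
  define idx where "idx p = (SOME i. i < (\<Sum>\<mu><N. n \<mu>) \<and> block_indices N n ! i = p)" for p
  have idx: "idx (block_indices N n ! i) = i" if i: "i < (\<Sum>\<mu><N. n \<mu>)" for i
    unfolding idx_def
  proof (rule some_equality)
    fix j assume "j < (\<Sum>\<mu><N. n \<mu>) \<and> block_indices N n ! j = block_indices N n ! i"
    then show "j = i"
      using i nth_eq_iff_index_eq[OF distinct_block_indices[of N n], of j i] by (simp add: length_block_indices)
  qed (use i in simp)
  have "v = block_vec N n (\<lambda>\<mu> a. vec_index v (idx (\<mu>, a)))"
    using assms idx by (intro eq_vecI) (auto simp: block_vec_def split: prod.splits)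
  then show ?thesis by (rule that)
qed

lemma block_mat_mult_vec:
  "block_mat N n M m f *\<^sub>v block_vec M m u = block_vec N n (block_apply M m f u)"
proof (rule eq_vecI)
  fix i assume "i < dim_vec (block_vec N n (block_apply M m f u))"
  then have i: "i < (\<Sum>\<mu><N. n \<mu>)" by (simp add: block_vec_def)
  then obtain \<mu> a where p: "block_indices N n ! i = (\<mu>, a)" by (rule nth_block_indices)
  have "vec_index (block_mat N n M m f *\<^sub>v block_vec M m u) i =
      (\<Sum>j = 0..<(\<Sum>\<mu><M. m \<mu>). case block_indices M m ! j of (\<nu>, b) \<Rightarrow> f \<mu> a \<nu> b * u \<nu> b)"
    using i p by (auto simp: block_mat_def block_vec_def scalar_prod_def intro!: sum.cong split: prod.splits)
  then show "vec_index (block_mat N n M m f *\<^sub>v block_vec M m u) i =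
      vec_index (block_vec N n (block_apply M m f u)) i"
    using i p by (simp add: sum_block_indices block_vec_def block_apply_def)
qed (simp add: block_mat_def block_vec_def)

lemma block_mat_mult:
  "block_mat N n M m f * block_mat M m K k g =
   block_mat N n K k (\<lambda>\<mu> a \<nu> b. block_apply M m f (\<lambda>\<kappa> c. g \<kappa> c \<nu> b) \<mu> a)"
proof (rule eq_matI)
  let ?R = "block_mat N n K k (\<lambda>\<mu> a \<nu> b. block_apply M m f (\<lambda>\<kappa> c. g \<kappa> c \<nu> b) \<mu> a)"
  fix i j assume "i < dim_row ?R" "j < dim_col ?R"
  then have ij: "i < (\<Sum>\<mu><N. n \<mu>)" "j < (\<Sum>\<mu><K. k \<mu>)" by (auto simp: block_mat_def)
  obtain \<mu> a where p: "block_indices N n ! i = (\<mu>, a)" using ij(1) by (rule nth_block_indices)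
  obtain \<nu> b where q: "block_indices K k ! j = (\<nu>, b)" using ij(2) by (rule nth_block_indices)
  have "(block_mat N n M m f * block_mat M m K k g) $$ (i, j) =
      (\<Sum>l = 0..<(\<Sum>\<mu><M. m \<mu>). case block_indices M m ! l of (\<kappa>, c) \<Rightarrow> f \<mu> a \<kappa> c * g \<kappa> c \<nu> b)"
    using ij p q by (auto simp: block_mat_def scalar_prod_def intro!: sum.cong split: prod.splits)
  then show "(block_mat N n M m f * block_mat M m K k g) $$ (i, j) = ?R $$ (i, j)"
    using ij p q by (simp add: sum_block_indices block_mat_def block_apply_def)
qed (simp_all add: block_mat_def)

lemma mat_adjoint_block_mat:
  "mat_adjoint (block_mat N n M m f) = block_mat M m N n (\<lambda>\<mu> a \<nu> b. cnj (f \<nu> b \<mu> a))"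
proof (rule eq_matI)
  fix i j assume "i < dim_row (block_mat M m N n (\<lambda>\<mu> a \<nu> b. cnj (f \<nu> b \<mu> a)))"
    "j < dim_col (block_mat M m N n (\<lambda>\<mu> a \<nu> b. cnj (f \<nu> b \<mu> a)))"
  then have ij: "i < (\<Sum>\<mu><M. m \<mu>)" "j < (\<Sum>\<mu><N. n \<mu>)" by (auto simp: block_mat_def)
  then show "mat_adjoint (block_mat N n M m f) $$ (i, j) =
      block_mat M m N n (\<lambda>\<mu> a \<nu> b. cnj (f \<nu> b \<mu> a)) $$ (i, j)"
    by (subst index_mat_adjoint) (auto simp: block_mat_def split: prod.splits)
qed (simp_all add: block_mat_def)

lemma block_mat_add:
  "block_mat N n M m f + block_mat N n M m g = block_mat N n M m (\<lambda>\<mu> a \<nu> b. f \<mu> a \<nu> b + g \<mu> a \<nu> b)"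
  by (intro eq_matI) (auto simp: block_mat_def split: prod.splits)

lemma block_vec_add: "block_vec N n u + block_vec N n w = block_vec N n (\<lambda>\<mu> a. u \<mu> a + w \<mu> a)"
  by (intro eq_vecI) (auto simp: block_vec_def split: prod.splits)

lemma block_vec_minus: "block_vec N n u - block_vec N n w = block_vec N n (\<lambda>\<mu> a. u \<mu> a - w \<mu> a)"
  by (intro eq_vecI) (auto simp: block_vec_def split: prod.splits)

lemma block_vec_smult: "c \<cdot>\<^sub>v block_vec N n u = block_vec N n (\<lambda>\<mu> a. c * u \<mu> a)"
  by (intro eq_vecI) (auto simp: block_vec_def split: prod.splits)

lemma block_vec_zero: "block_vec N n (\<lambda>\<mu> a. 0) = 0\<^sub>v (\<Sum>\<mu><N. n \<mu>)"
  by (intro eq_vecI) (auto simp: block_vec_def split: prod.splits)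

text \<open>Unit vectors are block vectors, so a matrix is determined by its action on these. Matrix
  identities are thereby reduced to computations with blocks, without handling flattened
  positions.\<close>

lemma mat_eqI_mult_vec:
  fixes A :: "complex mat"
  assumes "A \<in> carrier_mat p (\<Sum>\<mu><N. n \<mu>)" "B \<in> carrier_mat p (\<Sum>\<mu><N. n \<mu>)"
    and eq: "\<And>u. A *\<^sub>v block_vec N n u = B *\<^sub>v block_vec N n u"
  shows "A = B"
proof (rule eq_matI)
  fix i j assume ij: "i < dim_row B" "j < dim_col B"
  have col: "vec_index (C *\<^sub>v unit_vec (\<Sum>\<mu><N. n \<mu>) j) i = C $$ (i, j)"
    if "C \<in> carrier_mat p (\<Sum>\<mu><N. n \<mu>)" for C :: "complex mat"
    using that ij assms(2) by (simp add: scalar_prod_right_unit)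
  obtain u where "unit_vec (\<Sum>\<mu><N. n \<mu>) j = block_vec N n u"
    using block_vec_surj[where N = N and n = n and v = "unit_vec (\<Sum>\<mu><N. n \<mu>) j"] by auto
  then show "A $$ (i, j) = B $$ (i, j)"
    using eq[of u] col[OF assms(1)] col[OF assms(2)] by metis
qed (use assms in auto)

lemma principal_symbol_eq_block_mat:
  "principal_symbol N S s = block_mat N (ncomp S) N (ncomp S) (\<lambda>\<mu> a \<nu> b. symbol_block S s \<mu> \<nu> a b)"
  unfolding principal_symbol_def block_mat_def total_dim_def by (intro eq_matI) (auto split: prod.splits)

lemma symbol_apply_eq_block_apply:
  "symbol_apply N S s = block_apply N (ncomp S) (\<lambda>\<mu> a \<nu> b. symbol_block S s \<mu> \<nu> a b)"
  by (simp add: symbol_apply_def block_apply_def fun_eq_iff)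

lemma abs_prod_list_component_le_1:
  assumes "norm (s :: real^3) = 1"
  shows "\<bar>\<Prod>k\<leftarrow>ks. vec_nth s k\<bar> \<le> 1"
proof (induction ks)
  case (Cons k ks)
  have "\<bar>vec_nth s k\<bar> \<le> 1" using component_le_norm_cart[of s k] assms by simp
  then show ?case using Cons mult_mono[of "\<bar>vec_nth s k\<bar>" 1 "\<bar>\<Prod>k\<leftarrow>ks. vec_nth s k\<bar>" 1] by (simp add: abs_mult)
qed simp

text \<open>The entries are polynomials in the components of \<open>s\<close>, each of modulus at
  most 1, so sums of moduli of coefficients bound them in all directions at once.\<close>

lemma principal_symbol_bounded:
  obtains p where "0 \<le> p" "\<And>s v. norm s = 1 \<Longrightarrow> v \<in> carrier_vec (total_dim N S) \<Longrightarrow>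
    vnorm (principal_symbol N S s *\<^sub>v v) \<le> p * vnorm v"
proof -
  define \<beta> where "\<beta> \<mu> a \<nu> b = (\<Sum>ks\<in>multi_indices (\<mu> + 1 - \<nu>). cmod (coefA S \<mu> \<nu> ks $$ (a, b)))" for \<mu> a \<nu> b
  define B where "B = (\<Sum>\<mu><N. \<Sum>a<ncomp S \<mu>. \<Sum>\<nu><N. \<Sum>b<ncomp S \<nu>. \<beta> \<mu> a \<nu> b)"
  have \<beta>0: "0 \<le> \<beta> \<mu> a \<nu> b" for \<mu> a \<nu> b unfolding \<beta>_def by (intro sum_nonneg) auto
  have B0: "0 \<le> B" unfolding B_def by (intro sum_nonneg \<beta>0)
  have \<beta>B: "\<beta> \<mu> a \<nu> b \<le> B" if "\<mu> < N" "a < ncomp S \<mu>" "\<nu> < N" "b < ncomp S \<nu>" for \<mu> a \<nu> b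
  proof -
    have "\<beta> \<mu> a \<nu> b \<le> (\<Sum>b<ncomp S \<nu>. \<beta> \<mu> a \<nu> b)"
      using that by (intro member_le_sum) (auto intro: \<beta>0)
    also have "\<dots> \<le> (\<Sum>\<nu><N. \<Sum>b<ncomp S \<nu>. \<beta> \<mu> a \<nu> b)"
      using that by (intro member_le_sum[of \<nu> _ "\<lambda>\<nu>. \<Sum>b<ncomp S \<nu>. \<beta> \<mu> a \<nu> b"]) (auto intro!: \<beta>0 sum_nonneg)
    also have "\<dots> \<le> (\<Sum>a<ncomp S \<mu>. \<Sum>\<nu><N. \<Sum>b<ncomp S \<nu>. \<beta> \<mu> a \<nu> b)"
      using that by (intro member_le_sum[of a _ "\<lambda>a. \<Sum>\<nu><N. \<Sum>b<ncomp S \<nu>. \<beta> \<mu> a \<nu> b"]) (auto intro!: \<beta>0 sum_nonneg)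
    also have "\<dots> \<le> B"
      unfolding B_def using that
      by (intro member_le_sum[of \<mu> _ "\<lambda>\<mu>. \<Sum>a<ncomp S \<mu>. \<Sum>\<nu><N. \<Sum>b<ncomp S \<nu>. \<beta> \<mu> a \<nu> b"])
        (auto intro!: \<beta>0 sum_nonneg)
    finally show ?thesis .
  qed
  have entry: "cmod (symbol_block S s \<mu> \<nu> a b) \<le> \<beta> \<mu> a \<nu> b" if "norm s = 1" for s \<mu> \<nu> a b
  proof (cases "\<nu> \<le> \<mu> + 1")
    case True
    have "cmod (symbol_block S s \<mu> \<nu> a b) \<le> (\<Sum>ks\<in>multi_indices (\<mu> + 1 - \<nu>).
        cmod (coefA S \<mu> \<nu> ks $$ (a, b) * complex_of_real (\<Prod>k\<leftarrow>ks. vec_nth s k)))"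
      using True by (simp only: symbol_block_def if_True norm_sum)
    also have "\<dots> \<le> \<beta> \<mu> a \<nu> b"
      unfolding \<beta>_def norm_mult norm_of_real
      by (intro sum_mono mult_left_le abs_prod_list_component_le_1[OF that] norm_ge_zero)
    finally show ?thesis .
  qed (simp add: symbol_block_def \<beta>0)
  let ?D = "total_dim N S"
  have "vnorm (principal_symbol N S s *\<^sub>v v) \<le> (real ?D * real ?D * B) * vnorm v"
    if s: "norm s = 1" and v: "v \<in> carrier_vec ?D" for s v
  proof (rule vnorm_mult_mat_vec_le[OF _ v _ B0])
    show "principal_symbol N S s \<in> carrier_mat ?D ?D" by (simp add: principal_symbol_def)
    fix i j assume ij: "i < ?D" "j < ?D"
    then have "i < (\<Sum>\<mu><N. ncomp S \<mu>)" "j < (\<Sum>\<mu><N. ncomp S \<mu>)" by (auto simp: total_dim_def)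
    from nth_block_indices[OF this(1)] nth_block_indices[OF this(2)] obtain \<mu> a \<nu> b where
      "block_indices N (ncomp S) ! i = (\<mu>, a)" "\<mu> < N" "a < ncomp S \<mu>"
      "block_indices N (ncomp S) ! j = (\<nu>, b)" "\<nu> < N" "b < ncomp S \<nu>" by metis
    then show "cmod (principal_symbol N S s $$ (i, j)) \<le> B"
      using ij entry[OF s, of \<mu> \<nu> a b] \<beta>B[of \<mu> a \<nu> b] by (simp add: principal_symbol_def)
  qed
  moreover have "0 \<le> real ?D * real ?D * B" using B0 by simp
  ultimately show ?thesis using that by blast
qed

lemma sum_block_delta:
  fixes N :: nat and n :: "nat \<Rightarrow> nat"
  assumes "\<mu>\<^sub>0 < N" "c\<^sub>0 < n \<mu>\<^sub>0"
  shows "(\<Sum>\<mu><N. \<Sum>c<n \<mu>. (if \<mu>\<^sub>0 = \<mu> \<and> c\<^sub>0 = c then 1 else 0) * u \<mu> c) = (u \<mu>\<^sub>0 c\<^sub>0 :: complex)"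
proof -
  have "(\<Sum>\<mu><N. \<Sum>c<n \<mu>. (if \<mu>\<^sub>0 = \<mu> \<and> c\<^sub>0 = c then 1 else 0) * u \<mu> c) =
      (\<Sum>\<mu><N. if \<mu>\<^sub>0 = \<mu> then (\<Sum>c<n \<mu>. if c\<^sub>0 = c then u \<mu> c else 0) else 0)"
  proof (intro sum.cong refl)
    fix \<mu>
    have "(if \<mu>\<^sub>0 = \<mu> \<and> c\<^sub>0 = c then 1 else 0) * u \<mu> c = (if \<mu>\<^sub>0 = \<mu> then if c\<^sub>0 = c then u \<mu> c else 0 else 0)"
      for c by auto
    then show "(\<Sum>c<n \<mu>. (if \<mu>\<^sub>0 = \<mu> \<and> c\<^sub>0 = c then 1 else 0) * u \<mu> c) =
        (if \<mu>\<^sub>0 = \<mu> then (\<Sum>c<n \<mu>. if c\<^sub>0 = c then u \<mu> c else 0) else 0)"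
      by (cases "\<mu>\<^sub>0 = \<mu>") simp_all
  qed
  also have "\<dots> = (\<Sum>c<n \<mu>\<^sub>0. if c\<^sub>0 = c then u \<mu>\<^sub>0 c else 0)"
    using assms(1) by (subst sum.delta'[OF finite_lessThan]) simp
  also have "\<dots> = u \<mu>\<^sub>0 c\<^sub>0"
    using assms(2) by (subst sum.delta'[OF finite_lessThan]) simp
  finally show ?thesis .
qed


section \<open>Regrouped block vectors and the matrix of the embedding\<close>

definition regrouped ::
    "nat \<Rightarrow> (nat \<Rightarrow> 'a) \<Rightarrow> (3 \<Rightarrow> nat \<Rightarrow> 'a) \<Rightarrow> (nat \<Rightarrow> 'a) \<Rightarrow> (nat \<Rightarrow> nat \<Rightarrow> 'a) \<Rightarrow> nat \<Rightarrow> nat \<Rightarrow> 'a" where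
  "regrouped n x y z w \<kappa> a = (if \<kappa> = 0 then slot n x y z a else w (\<kappa> + 1) a)"

lemma regrouped_comp:
  "f (regrouped n x y z w \<kappa> a) = regrouped n (\<lambda>b. f (x b)) (\<lambda>i b. f (y i b)) (\<lambda>b. f (z b)) (\<lambda>\<mu> b. f (w \<mu> b)) \<kappa> a"
  by (simp add: regrouped_def slot_def)

lemma regrouped_comp2:
  "f (regrouped n x y z w \<kappa> a) (regrouped n x' y' z' w' \<kappa> a) =
     regrouped n (\<lambda>b. f (x b) (x' b)) (\<lambda>i b. f (y i b) (y' i b)) (\<lambda>b. f (z b) (z' b)) (\<lambda>\<mu> b. f (w \<mu> b) (w' \<mu> b)) \<kappa> a"
  by (simp add: regrouped_def slot_def)

lemma regrouped_cong:
  assumes "\<kappa> < N - 1" "a < reduced_comp S \<kappa>"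
    and "\<And>b. b < ncomp S 0 \<Longrightarrow> x b = x' b" and "\<And>i b. b < ncomp S 0 \<Longrightarrow> y i b = y' i b"
    and "\<And>b. b < ncomp S 1 \<Longrightarrow> z b = z' b"
    and "\<And>\<mu> b. 2 \<le> \<mu> \<Longrightarrow> \<mu> < N \<Longrightarrow> b < ncomp S \<mu> \<Longrightarrow> w \<mu> b = w' \<mu> b"
  shows "regrouped (ncomp S 0) x y z w \<kappa> a = regrouped (ncomp S 0) x' y' z' w' \<kappa> a"
proof (cases "\<kappa> = 0")
  case True
  then show ?thesis using assms slot_cong[of a "ncomp S 0" "ncomp S 1" x x' y y' z z']
    by (simp add: regrouped_def reduced_comp_def)
qed (use assms in \<open>auto simp: regrouped_def reduced_comp_def\<close>)

text \<open>Cutting block 0 at the offsets of its five slots exhibits any block field in regrouped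
  form, so identities need to be checked on regrouped fields only. The index shift in the last
  witness undoes the \<open>\<kappa> + 1\<close> of \<open>regrouped\<close>.\<close>

lemma regrouped_surj:
  obtains x y z w where "\<And>\<kappa> a. \<kappa> < N - 1 \<Longrightarrow> a < reduced_comp S \<kappa> \<Longrightarrow> u \<kappa> a = regrouped (ncomp S 0) x y z w \<kappa> a"
proof (rule that)
  let ?n = "ncomp S 0"
  fix \<kappa> a
  show "u \<kappa> a = regrouped ?n (u 0) (\<lambda>i b. u 0 ((if i = 1 then ?n else if i = 2 then 2 * ?n else 3 * ?n) + b))
      (\<lambda>b. u 0 (4 * ?n + b)) (\<lambda>\<mu>. u (\<mu> - 1)) \<kappa> a"
    by (simp add: regrouped_def slot_def three_distinct)
qed

lemma sum_regrouped:
  fixes x :: "nat \<Rightarrow> complex"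
  assumes N: "N \<ge> 2"
  shows "(\<Sum>\<kappa><N - 1. \<Sum>a<reduced_comp S \<kappa>. regrouped (ncomp S 0) x y z w \<kappa> a) =
    (\<Sum>b<ncomp S 0. x b) + (\<Sum>i\<in>UNIV. \<Sum>b<ncomp S 0. y i b) + (\<Sum>b<ncomp S 1. z b) +
    (\<Sum>\<mu>=2..<N. \<Sum>b<ncomp S \<mu>. w \<mu> b)"
proof -
  have "{..<N - 1} = insert 0 {1..<N - 1}" using N by auto
  then have "(\<Sum>\<kappa><N - 1. \<Sum>a<reduced_comp S \<kappa>. regrouped (ncomp S 0) x y z w \<kappa> a) =
      (\<Sum>a<4 * ncomp S 0 + ncomp S 1. slot (ncomp S 0) x y z a) +
      (\<Sum>\<kappa>=1..<N - 1. \<Sum>a<ncomp S (\<kappa> + 1). w (\<kappa> + 1) a)"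
    by (simp add: regrouped_def reduced_comp_def)
  also have "(\<Sum>\<kappa>=1..<N - 1. \<Sum>a<ncomp S (\<kappa> + 1). w (\<kappa> + 1) a) = (\<Sum>\<mu>=2..<N. \<Sum>b<ncomp S \<mu>. w \<mu> b)"
    by (rule sum.reindex_bij_witness[of _ "\<lambda>\<mu>. \<mu> - 1" "\<lambda>\<kappa>. \<kappa> + 1"]) auto
  finally show ?thesis by (simp add: sum_slot)
qed

lemma grad_embed_eq_regrouped:
  "grad_embed n s u = regrouped n (\<lambda>_. 0) (\<lambda>i b. complex_of_real (vec_nth s i) * u 0 b) (u 1) u"
  by (simp add: grad_embed_def regrouped_def fun_eq_iff)

text \<open>The columns of \<open>J\<close> are the images of the unit block vectors.\<close>

definition grad_embed_entry :: "nat \<Rightarrow> real^3 \<Rightarrow> nat \<Rightarrow> nat \<Rightarrow> nat \<Rightarrow> nat \<Rightarrow> complex" where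
  "grad_embed_entry n s \<kappa> a \<mu> c = grad_embed n s (\<lambda>\<nu> b. if \<nu> = \<mu> \<and> b = c then 1 else 0) \<kappa> a"

lemma block_apply_grad_embed_entry:
  assumes N: "N \<ge> 2" and \<kappa>: "\<kappa> < N - 1" and a: "a < reduced_comp S \<kappa>"
  shows "block_apply N (ncomp S) (grad_embed_entry (ncomp S 0) s) u \<kappa> a = grad_embed (ncomp S 0) s u \<kappa> a"
proof -
  have 1: "(\<Sum>\<nu><N. \<Sum>b<ncomp S \<nu>. (x * (if \<mu> = \<nu> \<and> c = b then 1 else 0)) * u \<nu> b) = x * u \<mu> c"
    if "\<mu> < N" "c < ncomp S \<mu>" for \<mu> c x
    using sum_block_delta[where n = "ncomp S" and u = u, OF that(1), of c] that(2) by (simp add: sum_distrib_left[symmetric] mult.assoc)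
  show ?thesis
  proof (cases "\<kappa> = 0")
    case True
    have "block_apply N (ncomp S) (grad_embed_entry (ncomp S 0) s) u \<kappa> a =
        slot (ncomp S 0) (\<lambda>b. 0)
          (\<lambda>i c. \<Sum>\<nu><N. \<Sum>b<ncomp S \<nu>. (complex_of_real (vec_nth s i) * (if 0 = \<nu> \<and> c = b then 1 else 0)) * u \<nu> b)
          (\<lambda>c. \<Sum>\<nu><N. \<Sum>b<ncomp S \<nu>. (1 * (if 1 = \<nu> \<and> c = b then 1 else 0)) * u \<nu> b) a"
      using True by (simp add: block_apply_def grad_embed_entry_def grad_embed_def slot_def)
    also have "\<dots> = grad_embed (ncomp S 0) s u \<kappa> a"
    proof -
      have "a < 4 * ncomp S 0 + ncomp S 1" using True a by (simp add: reduced_comp_def)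
      moreover have "0 < N" "1 < N" using N by auto
      moreover have "grad_embed (ncomp S 0) s u \<kappa> a =
          slot (ncomp S 0) (\<lambda>_. 0) (\<lambda>i b. complex_of_real (vec_nth s i) * u 0 b) (u 1) a"
        using True by (simp add: grad_embed_def)
      ultimately show ?thesis
        by (simp only:) (intro slot_cong[of _ _ "ncomp S 1"] refl, simp_all only: 1, simp)
    qed
    finally show ?thesis .
  next
    case False
    then show ?thesis
      using 1[of "\<kappa> + 1" a 1] \<kappa> a by (simp add: block_apply_def grad_embed_entry_def grad_embed_def reduced_comp_def)
  qed
qed

text \<open>The adjoint of \<open>J\<close>: it forgets the slot of \<open>v^0\<close> and extracts
  from \<open>d\<close> its component along \<open>s\<close>.\<close>

definition grad_embed_adj :: "real^3 \<Rightarrow> (3 \<Rightarrow> nat \<Rightarrow> complex) \<Rightarrow> (nat \<Rightarrow> complex) \<Rightarrow> (nat \<Rightarrow> nat \<Rightarrow> complex) \<Rightarrow> nat \<Rightarrow> nat \<Rightarrow> complex" where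
  "grad_embed_adj s y z w \<mu> c =
     (if \<mu> = 0 then \<Sum>i\<in>UNIV. complex_of_real (vec_nth s i) * y i c else if \<mu> = 1 then z c else w \<mu> c)"

lemma block_apply_grad_embed_entry_adjoint:
  assumes N: "N \<ge> 2" and \<mu>: "\<mu> < N" and c: "c < ncomp S \<mu>"
  shows "block_apply (N - 1) (reduced_comp S) (\<lambda>\<mu> c \<kappa> a. cnj (grad_embed_entry (ncomp S 0) s \<kappa> a \<mu> c))
      (regrouped (ncomp S 0) x y z w) \<mu> c = grad_embed_adj s y z w \<mu> c"
proof -
  let ?\<delta> = "\<lambda>\<nu> b. if \<nu> = \<mu> \<and> b = c then 1 else (0 :: complex)"
  have "cnj (grad_embed_entry (ncomp S 0) s \<kappa> a \<mu> c) = regrouped (ncomp S 0) (\<lambda>_. 0)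
      (\<lambda>i b. complex_of_real (vec_nth s i) * ?\<delta> 0 b) (?\<delta> 1) ?\<delta> \<kappa> a" for \<kappa> a
    unfolding grad_embed_entry_def grad_embed_eq_regrouped regrouped_comp[where f = cnj] by (simp add: regrouped_def slot_def)
  then have "block_apply (N - 1) (reduced_comp S) (\<lambda>\<mu> c \<kappa> a. cnj (grad_embed_entry (ncomp S 0) s \<kappa> a \<mu> c))
      (regrouped (ncomp S 0) x y z w) \<mu> c =
      (\<Sum>i\<in>UNIV. \<Sum>b<ncomp S 0. complex_of_real (vec_nth s i) * ?\<delta> 0 b * y i b) +
      (\<Sum>b<ncomp S 1. ?\<delta> 1 b * z b) + (\<Sum>\<nu>=2..<N. \<Sum>b<ncomp S \<nu>. ?\<delta> \<nu> b * w \<nu> b)"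
    unfolding block_apply_def by (simp only: regrouped_comp2[where f = "(*)"] sum_regrouped[OF N]) simp
  also have "(\<Sum>i\<in>UNIV. \<Sum>b<ncomp S 0. complex_of_real (vec_nth s i) * ?\<delta> 0 b * y i b) =
      (if \<mu> = 0 then \<Sum>i\<in>UNIV. complex_of_real (vec_nth s i) * y i c else 0)"
  proof (cases "\<mu> = 0")
    case True
    have "(\<Sum>b<ncomp S 0. complex_of_real (vec_nth s i) * ?\<delta> 0 b * y i b) =
        (\<Sum>b<ncomp S 0. if b = c then complex_of_real (vec_nth s i) * y i b else 0)" for i
      using True by (intro sum.cong) auto
    then show ?thesis using True c by simp
  qed simp
  also have "(\<Sum>b<ncomp S 1. ?\<delta> 1 b * z b) = (if \<mu> = 1 then z c else 0)"
  proof (cases "\<mu> = 1")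
    case True
    then have "(\<Sum>b<ncomp S 1. ?\<delta> 1 b * z b) = (\<Sum>b<ncomp S 1. if b = c then z b else 0)"
      by (intro sum.cong) auto
    then show ?thesis using True c by simp
  qed simp
  also have "(\<Sum>\<nu>=2..<N. \<Sum>b<ncomp S \<nu>. ?\<delta> \<nu> b * w \<nu> b) = (if 2 \<le> \<mu> then w \<mu> c else 0)"
  proof -
    have "(\<Sum>\<nu>=2..<N. \<Sum>b<ncomp S \<nu>. ?\<delta> \<nu> b * w \<nu> b) =
        (\<Sum>\<nu>=2..<N. if \<nu> = \<mu> then (\<Sum>b<ncomp S \<nu>. if b = c then w \<nu> b else 0) else 0)"
    proof (intro sum.cong refl)
      fix \<nu>
      have "?\<delta> \<nu> b * w \<nu> b = (if \<nu> = \<mu> then if b = c then w \<nu> b else 0 else 0)" for b by auto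
      then show "(\<Sum>b<ncomp S \<nu>. ?\<delta> \<nu> b * w \<nu> b) = (if \<nu> = \<mu> then (\<Sum>b<ncomp S \<nu>. if b = c then w \<nu> b else 0) else 0)"
        by (cases "\<nu> = \<mu>") simp_all
    qed
    also have "\<dots> = (if 2 \<le> \<mu> then (\<Sum>b<ncomp S \<mu>. if b = c then w \<mu> b else 0) else 0)"
      using \<mu> by (subst sum.delta) auto
    also have "(\<Sum>b<ncomp S \<mu>. if b = c then w \<mu> b else 0) = w \<mu> c"
      using c by (subst sum.delta) auto
    finally show ?thesis .
  qed
  finally show ?thesis by (auto simp: grad_embed_adj_def)
qed

section \<open>The symbol of the curl reduction\<close>

text \<open>The matrix of the cross product \<open>y \<mapsto> s \<times> y\<close>, that is, the
  symbol of the curl.\<close>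

definition curl_symbol :: "real^3 \<Rightarrow> 3 \<Rightarrow> 3 \<Rightarrow> complex" where
  "curl_symbol s i j = (\<Sum>k\<in>UNIV. levi_civita i k j * complex_of_real (vec_nth s k))"

lemma curl_symbol_explicit:
  "curl_symbol s 1 1 = 0" "curl_symbol s 2 2 = 0" "curl_symbol s 3 3 = 0"
  "curl_symbol s 1 2 = - complex_of_real (vec_nth s 3)" "curl_symbol s 2 1 = complex_of_real (vec_nth s 3)"
  "curl_symbol s 1 3 = complex_of_real (vec_nth s 2)" "curl_symbol s 3 1 = - complex_of_real (vec_nth s 2)"
  "curl_symbol s 2 3 = - complex_of_real (vec_nth s 1)" "curl_symbol s 3 2 = complex_of_real (vec_nth s 1)"
  unfolding curl_symbol_def sum_3 levi_civita_def
  by (simp_all only: insert_iff empty_iff prod.inject simp_thms if_True if_False three_distinct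
      mult_zero_left mult_1 mult_minus1 add_0_left add_0_right)

lemma curl_symbol_antisym: "curl_symbol s j i = - curl_symbol s i j"
proof -
  have "\<forall>i j. curl_symbol s j i = - curl_symbol s i j"
    unfolding forall_3 curl_symbol_explicit by simp
  then show ?thesis by blast
qed

lemma cnj_curl_symbol: "cnj (curl_symbol s i j) = curl_symbol s i j"
proof -
  have "\<forall>i j. cnj (curl_symbol s i j) = curl_symbol s i j"
    unfolding forall_3 curl_symbol_explicit by simp
  then show ?thesis by blast
qed

lemma curl_symbol_normal: "(\<Sum>i\<in>UNIV. complex_of_real (vec_nth s i) * curl_symbol s i j) = 0"
proof -
  have "\<forall>j. (\<Sum>i\<in>UNIV. complex_of_real (vec_nth s i) * curl_symbol s i j) = 0"
    unfolding forall_3 sum_3 curl_symbol_explicit by simp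
  then show ?thesis by blast
qed

lemma sum_component_sq:
  assumes "norm (s :: real^3) = 1"
  shows "(\<Sum>i\<in>UNIV. complex_of_real (vec_nth s i) * complex_of_real (vec_nth s i)) = 1"
proof -
  have "(\<Sum>i\<in>UNIV. vec_nth s i * vec_nth s i) = 1"
    using assms by (simp add: norm_eq_1 inner_vec_def)
  then have "complex_of_real (\<Sum>i\<in>UNIV. vec_nth s i * vec_nth s i) = 1" by simp
  then show ?thesis by simp
qed

text \<open>The double cross product
  \<open>s \<times> (s \<times> y) = s (s \<bullet> y) - y\<close> for a unit vector: minus the
  tangential projection.\<close>

lemma curl_symbol_sq:
  assumes "norm s = 1"
  shows "(\<Sum>j\<in>UNIV. curl_symbol s i j * (\<Sum>k\<in>UNIV. curl_symbol s j k * y k)) =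
    complex_of_real (vec_nth s i) * (\<Sum>k\<in>UNIV. complex_of_real (vec_nth s k) * y k) - y i"
proof -
  define a b c where abc: "a = complex_of_real (vec_nth s 1)" "b = complex_of_real (vec_nth s 2)"
    "c = complex_of_real (vec_nth s 3)"
  have 1: "a * a + b * b + c * c = 1"
    using sum_component_sq[OF assms] unfolding sum_3 abc by simp
  \<comment> \<open>With the square of the norm of \<open>s\<close> written out as a coefficient of
    \<open>y i\<close>, this is a polynomial identity for arbitrary components; the norm is inserted
    afterwards.\<close>
  have "\<forall>i. (\<Sum>j\<in>UNIV. curl_symbol s i j * (\<Sum>k\<in>UNIV. curl_symbol s j k * y k)) =
    complex_of_real (vec_nth s i) * (\<Sum>k\<in>UNIV. complex_of_real (vec_nth s k) * y k) -
      (a * a + b * b + c * c) * y i"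
    unfolding forall_3 sum_3 curl_symbol_explicit abc[symmetric] by (simp add: algebra_simps)
  then show ?thesis unfolding 1 by simp
qed

text \<open>The symbol of the curl reduction is \<open>J W + R\<close>, where \<open>J\<close> is the matrix of \<open>grad_embed\<close>;
  \<open>Z\<close> projects onto \<open>v\<^sup>0\<close>, on which the symbol vanishes.\<close>

definition sym_R :: "nat \<Rightarrow> real \<Rightarrow> real^3 \<Rightarrow> nat \<Rightarrow> nat \<Rightarrow> nat \<Rightarrow> nat \<Rightarrow> complex" where
  "sym_R n l s \<kappa> a =
     regrouped n (\<lambda>_ _ _. 0)
       (\<lambda>i a. regrouped n (\<lambda>_. 0) (\<lambda>j b. if a = b then \<i> * l * curl_symbol s i j else 0) (\<lambda>_. 0) (\<lambda>_ _. 0))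
       (\<lambda>_ _ _. 0) (\<lambda>_ _ _ _. 0) \<kappa> a"

text \<open>A position is decoded into the spatial index and component of \<open>d\<close>, if it
  lies in that part. In this form the row and the column of \<open>sym_R\<close> are treated alike,
  and its Hermitian symmetry becomes visible.\<close>

lemma slot_const_eq_case:
  "slot n (\<lambda>_. z) F (\<lambda>_. z) a =
     (case slot n (\<lambda>_. None) (\<lambda>i c. Some (i, c)) (\<lambda>_. None) a of None \<Rightarrow> z | Some (i, c) \<Rightarrow> F i c)"
  by (simp add: slot_def)

lemma cnj_sym_R: "cnj (sym_R n l s \<nu> b \<kappa> a) = sym_R n l s \<kappa> a \<nu> b"
proof -
  define D where "D a = slot n (\<lambda>_. None) (\<lambda>i c. Some (i, c)) (\<lambda>_. None) a" for a
  have R: "sym_R n l s \<kappa> a \<nu> b =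
      (if \<kappa> = 0 \<and> \<nu> = 0
       then case D a of None \<Rightarrow> 0 | Some (i, c) \<Rightarrow> (case D b of None \<Rightarrow> 0 | Some (j, d) \<Rightarrow>
         (if c = d then \<i> * l * curl_symbol s i j else 0))
       else 0)" for \<kappa> a \<nu> b
    unfolding sym_R_def regrouped_def slot_const_eq_case[where n = n, folded D_def] by (simp split: option.split prod.split)
  have "cnj (\<i> * l * curl_symbol s j i) = \<i> * l * curl_symbol s i j" for i j
    by (simp add: cnj_curl_symbol curl_symbol_antisym[of s j i])
  then show ?thesis
    unfolding R by (auto split: option.split simp del: complex_cnj_mult)
qed

definition sym_Z :: "nat \<Rightarrow> nat \<Rightarrow> nat \<Rightarrow> nat \<Rightarrow> nat \<Rightarrow> complex" where
  "sym_Z n \<kappa> a \<nu> b = (if \<kappa> = 0 \<and> a < n \<and> 0 = \<nu> \<and> a = b then 1 else 0)"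

text \<open>Row 0 contains no derivative: it is the leading part of the equation of
  \<open>v^0\<close> with \<open>d\<close> in place of the gradient, and \<open>J\<close> supplies
  the factor \<open>s_i\<close> of its derivative in the equation of \<open>d i\<close>. A row
  \<open>\<mu> > 0\<close> lies in the block of the reduction that contains \<open>v^\<mu>\<close>,
  which gives the order \<open>\<mu> - \<nu>\<close>.\<close>

definition sym_W :: "ft_system \<Rightarrow> real^3 \<Rightarrow> nat \<Rightarrow> nat \<Rightarrow> nat \<Rightarrow> nat \<Rightarrow> complex" where
  "sym_W S s \<mu> a \<nu> b =
     (if \<mu> = 0
      then regrouped (ncomp S 0) (\<lambda>_. 0) (\<lambda>j b. coefA S 0 0 [j] $$ (a, b)) (\<lambda>b. coefA S 0 1 [] $$ (a, b)) (\<lambda>_ _. 0) \<nu> b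
      else if \<nu> \<le> \<mu>
      then \<Sum>ks\<in>multi_indices (\<mu> - \<nu>). row_v S \<mu> a \<nu> ks b * complex_of_real (\<Prod>k\<leftarrow>ks. vec_nth s k)
      else 0)"

text \<open>Leading terms of the equation of \<open>d i\<close> are derivatives along
  \<open>i\<close> of a common expression, hence proportional to \<open>s_i\<close>, except for the
  curl. So all but the curl lies in the range of \<open>J\<close>.\<close>

lemma symbol_block_curl_reduction:
  assumes \<kappa>: "\<kappa> < N - 1" and a: "a < reduced_comp S \<kappa>" and \<nu>: "\<nu> < N - 1" and b: "b < reduced_comp S \<nu>"
  shows "symbol_block (curl_reduction S l) s \<kappa> \<nu> a b =
    grad_embed (ncomp S 0) s (\<lambda>\<mu> c. sym_W S s \<mu> c \<nu> b) \<kappa> a + sym_R (ncomp S 0) l s \<kappa> a \<nu> b"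
proof -
  define G where "G c = (if \<nu> \<le> \<kappa> + 1 then \<Sum>ks\<in>multi_indices (\<kappa> + 1 - \<nu>).
      c \<nu> ks b * complex_of_real (\<Prod>k\<leftarrow>ks. vec_nth s k) else 0)" for c :: "nat \<Rightarrow> 3 list \<Rightarrow> nat \<Rightarrow> complex"
  have sym: "symbol_block (curl_reduction S l) s \<kappa> \<nu> a b = G (reduced_coef S l \<kappa> a)"
    unfolding curl_reduction_def G_def by (rule symbol_block_mk_system) (fact a, fact b)
  show ?thesis
  proof (cases "\<kappa> = 0")
    case False
    then show ?thesis unfolding sym by (simp add: G_def reduced_coef_def grad_embed_def sym_W_def sym_R_def regrouped_def)
  next
    case True
    let ?n = "ncomp S 0"
    let ?g = "\<lambda>i c. regrouped ?n (\<lambda>_. 0) (\<lambda>j b. if c = b then \<i> * l * curl_symbol s i j else 0) (\<lambda>_. 0) (\<lambda>_ _. 0)"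
    have a': "a < 4 * ?n + ncomp S 1" using True a by (simp add: reduced_comp_def)
    have rc: "reduced_coef S l \<kappa> a = slot ?n (row_v0 S) (row_d S l) (row_v S 1) a"
      using True by (simp add: reduced_coef_def)
    have "grad_embed ?n s (\<lambda>\<mu> c. sym_W S s \<mu> c \<nu> b) \<kappa> a + sym_R ?n l s \<kappa> a \<nu> b =
        slot ?n (\<lambda>_. 0) (\<lambda>i c. complex_of_real (vec_nth s i) * sym_W S s 0 c \<nu> b + ?g i c \<nu> b)
          (\<lambda>c. sym_W S s 1 c \<nu> b) a"
      using True by (simp add: grad_embed_def sym_R_def regrouped_def[of _ "\<lambda>_ _ _. 0"] slot_def)
    also have "\<dots> = slot ?n (\<lambda>c. G (row_v0 S c)) (\<lambda>i c. G (row_d S l i c)) (\<lambda>c. G (row_v S 1 c)) a"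
    proof (rule slot_cong[OF a'])
      fix c
      have "row_v0 S c \<nu> ks b = 0" if "ks \<in> multi_indices (\<kappa> + 1 - \<nu>)" for ks
        using that by (cases "\<nu> = 0") (auto simp: row_v0_def multi_indices_def)
      then show "0 = G (row_v0 S c)" by (simp add: G_def)
    next
      fix c
      show "sym_W S s 1 c \<nu> b = G (row_v S 1 c)" using True by (simp add: sym_W_def G_def)
    next
      fix i :: 3 and c
      show "complex_of_real (vec_nth s i) * sym_W S s 0 c \<nu> b + ?g i c \<nu> b = G (row_d S l i c)"
      proof (cases "\<nu> = 0")
        case False
        then show ?thesis by (simp add: G_def row_d_def sym_W_def regrouped_def)
      next
        case \<nu>0: True
        have "G (row_d S l i c) = (\<Sum>k\<in>UNIV. row_d S l i c 0 [k] b * complex_of_real (vec_nth s k))"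
          using True \<nu>0 by (simp add: G_def sum_multi_indices_snoc)
        also have "\<dots> = slot ?n (\<lambda>b. 0)
            (\<lambda>j b. \<Sum>k\<in>UNIV. ((if k = i then coefA S 0 0 [j] $$ (c, b) else 0) +
              (if c = b then \<i> * l * levi_civita i k j else 0)) * complex_of_real (vec_nth s k))
            (\<lambda>b. \<Sum>k\<in>UNIV. (if k = i then coefA S 0 1 [] $$ (c, b) else 0) * complex_of_real (vec_nth s k)) b"
          by (simp add: row_d_def slot_def cong: if_cong)
        also have "\<dots> = slot ?n (\<lambda>b. 0)
            (\<lambda>j b. complex_of_real (vec_nth s i) * coefA S 0 0 [j] $$ (c, b) +
              (if c = b then \<i> * l * curl_symbol s i j else 0))
            (\<lambda>b. complex_of_real (vec_nth s i) * coefA S 0 1 [] $$ (c, b)) b"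
        proof -
          have d: "(\<Sum>k\<in>UNIV. (if k = i then x else 0) * complex_of_real (vec_nth s k)) = complex_of_real (vec_nth s i) * x"
            for x
          proof -
            have "(\<Sum>k\<in>UNIV. (if k = i then x else 0) * complex_of_real (vec_nth s k)) =
                (\<Sum>k\<in>UNIV. if k = i then complex_of_real (vec_nth s i) * x else 0)"
              by (intro sum.cong) auto
            then show ?thesis by simp
          qed
          have "(\<Sum>k\<in>UNIV. (if c = b then \<i> * l * levi_civita i k j else 0) * complex_of_real (vec_nth s k)) =
              (if c = b then \<i> * l * curl_symbol s i j else 0)" for b j
            by (simp add: curl_symbol_def sum_distrib_left mult.assoc)
          then show ?thesis by (simp only: distrib_right sum.distrib d)
        qed
        finally show ?thesis using \<nu>0 by (simp add: sym_W_def regrouped_def slot_def)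
      qed
    qed
    also have "\<dots> = G (reduced_coef S l \<kappa> a)" unfolding rc by (rule slot_comp[where f = G, symmetric])
    finally show ?thesis unfolding sym ..
  qed
qed

lemma block_apply_sym_R:
  assumes N: "N \<ge> 2" and \<kappa>: "\<kappa> < N - 1" and a: "a < reduced_comp S \<kappa>"
  shows "block_apply (N - 1) (reduced_comp S) (sym_R (ncomp S 0) l s) (regrouped (ncomp S 0) x y z w) \<kappa> a =
    regrouped (ncomp S 0) (\<lambda>_. 0) (\<lambda>i a. \<i> * l * (\<Sum>j\<in>UNIV. curl_symbol s i j * y j a)) (\<lambda>_. 0) (\<lambda>_ _. 0) \<kappa> a"
proof -
  let ?n = "ncomp S 0"
  let ?A = "\<lambda>h. \<Sum>\<nu><N - 1. \<Sum>b<reduced_comp S \<nu>. h \<nu> b * regrouped ?n x y z w \<nu> b"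
  have "block_apply (N - 1) (reduced_comp S) (sym_R ?n l s) (regrouped ?n x y z w) \<kappa> a = ?A (sym_R ?n l s \<kappa> a)"
    by (simp add: block_apply_def)
  also have "\<dots> = regrouped ?n (\<lambda>_. 0)
       (\<lambda>i a. ?A (regrouped ?n (\<lambda>_. 0) (\<lambda>j b. if a = b then \<i> * l * curl_symbol s i j else 0) (\<lambda>_. 0) (\<lambda>_ _. 0)))
       (\<lambda>_. 0) (\<lambda>_ _. 0) \<kappa> a"
    unfolding sym_R_def regrouped_comp[where f = ?A] by simp
  also have "\<dots> = regrouped ?n (\<lambda>_. 0) (\<lambda>i a. \<i> * l * (\<Sum>j\<in>UNIV. curl_symbol s i j * y j a)) (\<lambda>_. 0) (\<lambda>_ _. 0) \<kappa> a"
  proof (rule regrouped_cong[OF \<kappa> a])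
    fix i :: 3 and c assume c: "c < ncomp S 0"
    have d: "(\<Sum>b<?n. (if c = b then q else 0) * y j b) = q * y j c" for q j
    proof -
      have "(\<Sum>b<?n. (if c = b then q else 0) * y j b) = (\<Sum>b<?n. if c = b then q * y j c else 0)"
        by (intro sum.cong) auto
      then show ?thesis using c by simp
    qed
    show "?A (regrouped ?n (\<lambda>_. 0) (\<lambda>j b. if c = b then \<i> * l * curl_symbol s i j else 0) (\<lambda>_. 0) (\<lambda>_ _. 0)) =
        \<i> * l * (\<Sum>j\<in>UNIV. curl_symbol s i j * y j c)"
      by (simp only: regrouped_comp2[where f = "(*)"] sum_regrouped[OF N] d)
        (simp add: sum_distrib_left mult.assoc)
  qed auto
  finally show ?thesis .
qed

lemma block_apply_sym_Z:
  assumes \<kappa>: "\<kappa> < N - 1" and a: "a < reduced_comp S \<kappa>"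
  shows "block_apply (N - 1) (reduced_comp S) (sym_Z (ncomp S 0)) (regrouped (ncomp S 0) x y z w) \<kappa> a =
    regrouped (ncomp S 0) x (\<lambda>_ _. 0) (\<lambda>_. 0) (\<lambda>_ _. 0) \<kappa> a"
proof (cases "\<kappa> = 0 \<and> a < ncomp S 0")
  case True
  then have "block_apply (N - 1) (reduced_comp S) (sym_Z (ncomp S 0)) (regrouped (ncomp S 0) x y z w) \<kappa> a =
      regrouped (ncomp S 0) x y z w 0 a"
    using sum_block_delta[where N = "N - 1" and n = "reduced_comp S" and \<mu>\<^sub>0 = 0 and c\<^sub>0 = a
        and u = "regrouped (ncomp S 0) x y z w"] \<kappa> a
    by (simp add: block_apply_def sym_Z_def)
  then show ?thesis using True by (simp add: regrouped_def slot_def)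
next
  case False
  then show ?thesis by (auto simp: block_apply_def sym_Z_def regrouped_def slot_def)
qed

text \<open>\<open>row_v\<close> admits \<open>v^0\<close> only below the principal order, and row 0
  of \<open>sym_W\<close> does not contain it. Together with the form of \<open>sym_R\<close> this
  decouples \<open>v^0\<close> from the symbol.\<close>

lemma block_apply_sym_W:
  "block_apply (N - 1) (reduced_comp S) (sym_W S s) (regrouped (ncomp S 0) x (\<lambda>_ _. 0) (\<lambda>_. 0) (\<lambda>_ _. 0)) \<mu> a = 0"
proof -
  have "sym_W S s \<mu> a 0 b = 0" if "b < ncomp S 0" for b
    using that by (auto simp: sym_W_def regrouped_def slot_def row_v_def multi_indices_def intro!: sum.neutral)
  then have "sym_W S s \<mu> a \<nu> b * regrouped (ncomp S 0) x (\<lambda>_ _. 0) (\<lambda>_. 0) (\<lambda>_ _. 0) \<nu> b = 0" for \<nu> b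
    by (simp add: regrouped_def slot_def)
  then show ?thesis by (simp add: block_apply_def)
qed


section \<open>Transfer of strong hyperbolicity in both directions\<close>

lemma ncomp_reduction:
  assumes N: "N \<ge> 2" and "is_ft_reduction N S S'"
  shows "ncomp S' \<kappa> = reduced_comp S \<kappa> \<or> \<not> \<kappa> < N - 1"
  using assms by (auto simp: is_ft_reduction_def reduced_comp_def)

text \<open>A reduction fixes \<open>ncomp S'\<close> only for block numbers below
  \<open>N - 1\<close>, so \<open>ncomp S'\<close> and \<open>reduced_comp S\<close> may differ as
  functions. Dimension and symbol use only blocks on which they agree.\<close>

lemma reduction_block_mat:
  assumes N: "N \<ge> 2" and red: "is_ft_reduction N S S'"
  shows "total_dim (N - 1) S' = (\<Sum>\<kappa><N - 1. reduced_comp S \<kappa>)"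
    and "principal_symbol (N - 1) S' s = block_mat (N - 1) (reduced_comp S) (N - 1) (reduced_comp S)
      (\<lambda>\<kappa> a \<nu> b. symbol_block S' s \<kappa> \<nu> a b)"
proof -
  have eq: "ncomp S' \<kappa> = reduced_comp S \<kappa>" if "\<kappa> < N - 1" for \<kappa>
    using ncomp_reduction[OF assms] that by blast
  have dim: "(\<Sum>\<kappa><N - 1. ncomp S' \<kappa>) = (\<Sum>\<kappa><N - 1. reduced_comp S \<kappa>)" using eq by simp
  have "block_indices (N - 1) (ncomp S') = block_indices (N - 1) (reduced_comp S)"
    unfolding block_indices_def by (intro arg_cong[where f = concat] map_cong refl) (simp add: eq)
  then show "principal_symbol (N - 1) S' s = block_mat (N - 1) (reduced_comp S) (N - 1) (reduced_comp S)
      (\<lambda>\<kappa> a \<nu> b. symbol_block S' s \<kappa> \<nu> a b)"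
    unfolding principal_symbol_eq_block_mat block_mat_def dim by simp
  show "total_dim (N - 1) S' = (\<Sum>\<kappa><N - 1. reduced_comp S \<kappa>)" using dim by (simp add: total_dim_def)
qed

lemma reduction_embedding:
  fixes s :: "real^3"
  assumes N: "N \<ge> 2" and S: "is_ft_system N S" and red: "is_ft_reduction N S S'" and s: "norm s = 1"
  defines "J \<equiv> block_mat (N - 1) (reduced_comp S) N (ncomp S) (grad_embed_entry (ncomp S 0) s)"
  shows "J \<in> carrier_mat (total_dim (N - 1) S') (total_dim N S)"
    and "mat_adjoint J * J = 1\<^sub>m (total_dim N S)"
    and "principal_symbol (N - 1) S' s * J = J * principal_symbol N S s"
proof -
  let ?K = "N - 1" and ?m = "reduced_comp S" and ?n = "ncomp S"
  note dims = reduction_block_mat[OF N red]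
  let ?M = "block_mat ?K ?m ?K ?m (\<lambda>\<kappa> a \<nu> b. symbol_block S' s \<kappa> \<nu> a b)"
  let ?P = "block_mat N ?n N ?n (\<lambda>\<mu> a \<nu> b. symbol_block S s \<mu> \<nu> a b)"
  show "J \<in> carrier_mat (total_dim ?K S') (total_dim N S)"
    unfolding dims(1) unfolding total_dim_def J_def by (rule block_mat_carrier)
  have Ju: "J *\<^sub>v block_vec N ?n u = block_vec ?K ?m (grad_embed (?n 0) s u)" for u
    unfolding J_def block_mat_mult_vec by (intro block_vec_cong block_apply_grad_embed_entry[OF N])
  have Jc: "J \<in> carrier_mat (\<Sum>\<kappa><?K. ?m \<kappa>) (\<Sum>\<mu><N. ?n \<mu>)"
    unfolding J_def by (rule block_mat_carrier)
  have Jh: "mat_adjoint J *\<^sub>v block_vec ?K ?m (regrouped (?n 0) x y z w) = block_vec N ?n (grad_embed_adj s y z w)" for x y z w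
    unfolding J_def mat_adjoint_block_mat block_mat_mult_vec
    by (intro block_vec_cong block_apply_grad_embed_entry_adjoint[OF N])
  show "mat_adjoint J * J = 1\<^sub>m (total_dim N S)"
    unfolding total_dim_def
  proof (rule mat_eqI_mult_vec)
    fix u
    have "(mat_adjoint J * J) *\<^sub>v block_vec N ?n u = mat_adjoint J *\<^sub>v (J *\<^sub>v block_vec N ?n u)"
      by (rule assoc_mult_mat_vec[OF carrier_mat_adjoint[OF Jc] Jc block_vec_carrier])
    also have "\<dots> = block_vec N ?n u"
      unfolding Ju grad_embed_eq_regrouped Jh
    proof (rule block_vec_cong)
      fix \<mu> a
      show "grad_embed_adj s (\<lambda>i b. complex_of_real (vec_nth s i) * u 0 b) (u 1) u \<mu> a = u \<mu> a"
        \<comment> \<open>The normal component of \<open>s_i u^0\<close> is \<open>u^0\<close>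
          because \<open>s\<close> is a unit vector; this is what makes \<open>J\<close>
          isometric.\<close>
        using sum_component_sq[OF s] by (simp add: grad_embed_adj_def mult.assoc[symmetric] sum_distrib_right[symmetric])
    qed
    finally show "(mat_adjoint J * J) *\<^sub>v block_vec N ?n u = 1\<^sub>m (\<Sum>\<mu><N. ?n \<mu>) *\<^sub>v block_vec N ?n u"
      by simp
  qed (use Jc in auto)
  show "principal_symbol ?K S' s * J = J * principal_symbol N S s"
    unfolding dims(2) principal_symbol_eq_block_mat[of N S]
  proof (rule mat_eqI_mult_vec)
    fix u
    have "(?M * J) *\<^sub>v block_vec N ?n u = ?M *\<^sub>v (J *\<^sub>v block_vec N ?n u)"
      by (rule assoc_mult_mat_vec[OF block_mat_carrier Jc block_vec_carrier])
    also have "\<dots> = block_vec ?K ?m (block_apply ?K ?m (\<lambda>\<kappa> a \<nu> b. symbol_block S' s \<kappa> \<nu> a b) (grad_embed (?n 0) s u))"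
      unfolding Ju block_mat_mult_vec ..
    also have "\<dots> = block_vec ?K ?m (grad_embed (?n 0) s (symbol_apply N S s u))"
    proof (rule block_vec_cong)
      fix \<kappa> a assume \<kappa>: "\<kappa> < ?K" and a: "a < ?m \<kappa>"
      have eq: "ncomp S' \<kappa> = ?m \<kappa>" if "\<kappa> < N - 1" for \<kappa>
        using ncomp_reduction[OF N red] that by blast
      have "block_apply ?K ?m (\<lambda>\<kappa> a \<nu> b. symbol_block S' s \<kappa> \<nu> a b) (grad_embed (?n 0) s u) \<kappa> a =
          symbol_apply ?K S' s (grad_embed (?n 0) s u) \<kappa> a"
        unfolding block_apply_def symbol_apply_def using eq by simp
      then show "block_apply ?K ?m (\<lambda>\<kappa> a \<nu> b. symbol_block S' s \<kappa> \<nu> a b) (grad_embed (?n 0) s u) \<kappa> a =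
          grad_embed (?n 0) s (symbol_apply N S s u) \<kappa> a"
        using reduction_symbol_intertwines[OF N S red \<kappa>] eq[OF \<kappa>] a by simp
    qed
    also have "\<dots> = J *\<^sub>v (?P *\<^sub>v block_vec N ?n u)"
      unfolding block_mat_mult_vec Ju symbol_apply_eq_block_apply ..
    also have "\<dots> = (J * ?P) *\<^sub>v block_vec N ?n u"
      by (rule assoc_mult_mat_vec[OF Jc block_mat_carrier block_vec_carrier, symmetric])
    finally show "(?M * J) *\<^sub>v block_vec N ?n u = (J * ?P) *\<^sub>v block_vec N ?n u" .
  next
    show "?M * J \<in> carrier_mat (\<Sum>\<kappa><?K. ?m \<kappa>) (\<Sum>\<mu><N. ?n \<mu>)"
      by (rule mult_carrier_mat[OF block_mat_carrier Jc])
    show "J * ?P \<in> carrier_mat (\<Sum>\<kappa><?K. ?m \<kappa>) (\<Sum>\<mu><N. ?n \<mu>)"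
      by (rule mult_carrier_mat[OF Jc block_mat_carrier])
  qed
qed

lemma strongly_hyperbolic_of_reduction:
  assumes N: "N \<ge> 2" and S: "is_ft_system N S" and red: "is_ft_reduction N S S'"
    and sh: "strongly_hyperbolic (N - 1) S'"
  shows "strongly_hyperbolic N S"
proof -
  obtain C where C: "C > 0"
    and H: "\<And>s. norm s = 1 \<Longrightarrow> \<exists>H. symmetrizer (total_dim (N - 1) S') C (principal_symbol (N - 1) S' s) H"
    using sh unfolding strongly_hyperbolic_iff_symmetrizer by blast
  have P: "principal_symbol M T s \<in> carrier_mat (total_dim M T) (total_dim M T)" for M T s
    by (simp add: principal_symbol_def)
  have "\<exists>H. symmetrizer (total_dim N S) C (principal_symbol N S s) H" if s: "norm s = 1" for s
    using symmetrizer_restrict[OF P P reduction_embedding[OF N S red s]] H[OF s] by blast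
  then show ?thesis
    unfolding strongly_hyperbolic_iff_symmetrizer using C by blast
qed

lemma curl_reduction_symmetrizer:
  fixes s :: "real^3"
  assumes N: "N \<ge> 2" and S: "is_ft_system N S" and s: "norm s = 1" and l: "l\<^sup>2 = p\<^sup>2 + 1"
    and p: "\<And>v. v \<in> carrier_vec (total_dim N S) \<Longrightarrow> vnorm (principal_symbol N S s *\<^sub>v v) \<le> p * vnorm v" and p0: "0 \<le> p"
    and k: "\<And>v. v \<in> carrier_vec (total_dim (N - 1) (curl_reduction S l)) \<Longrightarrow>
      vnorm (principal_symbol (N - 1) (curl_reduction S l) s *\<^sub>v v) \<le> k * vnorm v" and k0: "0 \<le> k"
    and H: "symmetrizer (total_dim N S) C (principal_symbol N S s) H" and C: "0 < C"
    and c_def: "c = p * (k + p) + (k + p) * (2 * k)"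
    and K_def: "K = C * (1 + c)\<^sup>2 + 2 * C + 2 * c\<^sup>2 + 1"
  shows "\<exists>H'. symmetrizer (total_dim (N - 1) (curl_reduction S l)) K (principal_symbol (N - 1) (curl_reduction S l) s) H'"
proof -
  let ?K = "N - 1" and ?m = "reduced_comp S" and ?n = "ncomp S" and ?S' = "curl_reduction S l"
  let ?D = "\<Sum>\<kappa><?K. ?m \<kappa>"
  have red: "is_ft_reduction N S ?S'" by (rule is_ft_reduction_curl[OF N S])
  note dims = reduction_block_mat[OF N red]
  define J where "J = block_mat ?K ?m N ?n (grad_embed_entry (?n 0) s)"
  define W where "W = block_mat N ?n ?K ?m (sym_W S s)"
  define R where "R = block_mat ?K ?m ?K ?m (sym_R (?n 0) l s)"
  define Z where "Z = block_mat ?K ?m ?K ?m (sym_Z (?n 0))"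
  let ?Jh = "mat_adjoint J"
  have P: "principal_symbol N S s \<in> carrier_mat (total_dim N S) (total_dim N S)"
    and M: "principal_symbol ?K ?S' s \<in> carrier_mat (total_dim ?K ?S') (total_dim ?K ?S')"
    by (simp_all add: principal_symbol_def)
  note J = reduction_embedding[OF N S red s, folded J_def]
  have W: "W \<in> carrier_mat (total_dim N S) (total_dim ?K ?S')"
    unfolding dims(1) unfolding total_dim_def W_def by (rule block_mat_carrier)
  have R: "R \<in> carrier_mat (total_dim ?K ?S') (total_dim ?K ?S')"
    and Z: "Z \<in> carrier_mat (total_dim ?K ?S') (total_dim ?K ?S')"
    unfolding dims(1) R_def Z_def by (rule block_mat_carrier)+
  have Jhc: "?Jh \<in> carrier_mat (total_dim N S) (total_dim ?K ?S')" using J(1) by simp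
  have Jhv: "?Jh *\<^sub>v block_vec ?K ?m (regrouped (?n 0) x y z w) = block_vec N ?n (grad_embed_adj s y z w)" for x y z w
    unfolding J_def mat_adjoint_block_mat block_mat_mult_vec
    by (intro block_vec_cong block_apply_grad_embed_entry_adjoint[OF N])
  have Jv: "J *\<^sub>v block_vec N ?n u = block_vec ?K ?m (grad_embed (?n 0) s u)" for u
    unfolding J_def block_mat_mult_vec by (intro block_vec_cong block_apply_grad_embed_entry[OF N])
  have Rv: "R *\<^sub>v block_vec ?K ?m (regrouped (?n 0) x y z w) = block_vec ?K ?m
      (regrouped (?n 0) (\<lambda>_. 0) (\<lambda>i a. \<i> * l * (\<Sum>j\<in>UNIV. curl_symbol s i j * y j a)) (\<lambda>_. 0) (\<lambda>_ _. 0))" for x y z w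
    unfolding R_def block_mat_mult_vec by (intro block_vec_cong block_apply_sym_R[OF N])
  have Zv: "Z *\<^sub>v block_vec ?K ?m (regrouped (?n 0) x y z w) =
      block_vec ?K ?m (regrouped (?n 0) x (\<lambda>_ _. 0) (\<lambda>_. 0) (\<lambda>_ _. 0))" for x y z w
    unfolding Z_def block_mat_mult_vec by (intro block_vec_cong block_apply_sym_Z)
  have bv: "block_vec ?K ?m u \<in> carrier_vec (total_dim ?K ?S')" for u
    unfolding dims(1) by (rule block_vec_carrier)
  \<comment> \<open>On regrouped vectors \<open>J\<close>, its adjoint, \<open>R\<close> and
    \<open>Z\<close> act by explicit formulas in each slot, so the relations required by the
    extension lemma are checked there.\<close>
  have eqI: "A = B" if A: "A \<in> carrier_mat q (total_dim ?K ?S')" and B: "B \<in> carrier_mat q (total_dim ?K ?S')"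
    and eq: "\<And>x y z w. A *\<^sub>v block_vec ?K ?m (regrouped (?n 0) x y z w) = B *\<^sub>v block_vec ?K ?m (regrouped (?n 0) x y z w)"
    for A B q
  proof (rule mat_eqI_mult_vec[of A q ?m ?K B])
    fix u :: "nat \<Rightarrow> nat \<Rightarrow> complex"
    obtain x y z w where "\<And>\<kappa> a. \<kappa> < ?K \<Longrightarrow> a < ?m \<kappa> \<Longrightarrow> u \<kappa> a = regrouped (?n 0) x y z w \<kappa> a"
      using regrouped_surj[where N = N and S = S and u = u] by blast
    then have "block_vec ?K ?m u = block_vec ?K ?m (regrouped (?n 0) x y z w)" by (intro block_vec_cong)
    then show "A *\<^sub>v block_vec ?K ?m u = B *\<^sub>v block_vec ?K ?m u" using eq by simp
  qed (use A B dims(1) in auto)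
  have MW: "principal_symbol ?K ?S' s = J * W + R"
    unfolding dims(2) J_def W_def R_def block_mat_mult block_mat_add
  proof (rule block_mat_cong)
    fix \<kappa> a \<nu> b assume *: "\<kappa> < ?K" "a < ?m \<kappa>" "\<nu> < ?K" "b < ?m \<nu>"
    show "symbol_block ?S' s \<kappa> \<nu> a b =
        block_apply N ?n (grad_embed_entry (?n 0) s) (\<lambda>\<kappa> c. sym_W S s \<kappa> c \<nu> b) \<kappa> a + sym_R (?n 0) l s \<kappa> a \<nu> b"
      unfolding block_apply_grad_embed_entry[OF N *(1,2)] by (rule symbol_block_curl_reduction[OF *])
  qed
  have zero_mult: "0\<^sub>m q (total_dim ?K ?S') *\<^sub>v block_vec ?K ?m u = 0\<^sub>v q" for q u
    using bv[of u] by (intro eq_vecI) auto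
  have JR: "?Jh * R = 0\<^sub>m (total_dim N S) (total_dim ?K ?S')"
  proof (rule eqI)
    fix x y z w
    have "(?Jh * R) *\<^sub>v block_vec ?K ?m (regrouped (?n 0) x y z w) = block_vec N ?n (grad_embed_adj s
        (\<lambda>i a. \<i> * l * (\<Sum>j\<in>UNIV. curl_symbol s i j * y j a)) (\<lambda>_. 0) (\<lambda>_ _. 0))"
      unfolding assoc_mult_mat_vec[OF Jhc R bv] Rv Jhv ..
    also have "\<dots> = block_vec N ?n (\<lambda>_ _. 0)"
    proof (rule block_vec_cong)
      fix \<mu> a
      have "(\<Sum>i\<in>UNIV. complex_of_real (vec_nth s i) * (\<i> * l * (\<Sum>j\<in>UNIV. curl_symbol s i j * y j a))) =
          (\<Sum>j\<in>UNIV. \<i> * l * y j a * (\<Sum>i\<in>UNIV. complex_of_real (vec_nth s i) * curl_symbol s i j))"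
        by (simp add: sum_distrib_left mult_ac) (rule sum.swap)
      then show "grad_embed_adj s (\<lambda>i a. \<i> * l * (\<Sum>j\<in>UNIV. curl_symbol s i j * y j a)) (\<lambda>_. 0) (\<lambda>_ _. 0) \<mu> a = 0"
        by (simp add: grad_embed_adj_def curl_symbol_normal)
    qed
    finally show "(?Jh * R) *\<^sub>v block_vec ?K ?m (regrouped (?n 0) x y z w) =
        0\<^sub>m (total_dim N S) (total_dim ?K ?S') *\<^sub>v block_vec ?K ?m (regrouped (?n 0) x y z w)"
      unfolding zero_mult block_vec_zero by (simp add: total_dim_def)
  qed (use Jhc R in auto)
  have Rh: "mat_adjoint R = R"
    unfolding R_def mat_adjoint_block_mat
    by (simp only: cnj_sym_R)
  have JZ: "?Jh * Z = 0\<^sub>m (total_dim N S) (total_dim ?K ?S')"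
  proof (rule eqI)
    fix x y z w
    have "(?Jh * Z) *\<^sub>v block_vec ?K ?m (regrouped (?n 0) x y z w) =
        block_vec N ?n (grad_embed_adj s (\<lambda>_ _. 0) (\<lambda>_. 0) (\<lambda>_ _. 0))"
      unfolding assoc_mult_mat_vec[OF Jhc Z bv] Zv Jhv ..
    also have "\<dots> = block_vec N ?n (\<lambda>_ _. 0)" by (intro block_vec_cong) (simp add: grad_embed_adj_def)
    finally show "(?Jh * Z) *\<^sub>v block_vec ?K ?m (regrouped (?n 0) x y z w) =
        0\<^sub>m (total_dim N S) (total_dim ?K ?S') *\<^sub>v block_vec ?K ?m (regrouped (?n 0) x y z w)"
      unfolding zero_mult block_vec_zero by (simp add: total_dim_def)
  qed (use Jhc Z in auto)
  have WZ: "W * Z = 0\<^sub>m (total_dim N S) (total_dim ?K ?S')"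
  proof (rule eqI)
    fix x y z w
    have "(W * Z) *\<^sub>v block_vec ?K ?m (regrouped (?n 0) x y z w) = block_vec N ?n (\<lambda>_ _. 0)"
      unfolding assoc_mult_mat_vec[OF W Z bv] Zv unfolding W_def block_mat_mult_vec
      by (intro block_vec_cong block_apply_sym_W)
    then show "(W * Z) *\<^sub>v block_vec ?K ?m (regrouped (?n 0) x y z w) =
        0\<^sub>m (total_dim N S) (total_dim ?K ?S') *\<^sub>v block_vec ?K ?m (regrouped (?n 0) x y z w)"
      unfolding zero_mult block_vec_zero by (simp add: total_dim_def)
  qed (use W Z in auto)
  \<comment> \<open>What remains after removing the range of \<open>J\<close> and \<open>v^0\<close>
    is the tangential part of \<open>d\<close>. There the curl symbol squares to -1, and the square
    of \<open>\<i> * l\<close> turns this into \<open>l^2 = p^2 + 1\<close>.\<close>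
  have RR: "R * R = complex_of_real (p\<^sup>2 + 1) \<cdot>\<^sub>m (1\<^sub>m (total_dim ?K ?S') - (J * ?Jh + Z))"
  proof (rule eqI)
    fix x z :: "nat \<Rightarrow> complex" and y :: "3 \<Rightarrow> nat \<Rightarrow> complex" and w :: "nat \<Rightarrow> nat \<Rightarrow> complex"
    let ?u = "regrouped (?n 0) x y z w"
    let ?y = "\<lambda>i a. complex_of_real (vec_nth s i) * (\<Sum>k\<in>UNIV. complex_of_real (vec_nth s k) * y k a)"
    have JJh: "J * ?Jh \<in> carrier_mat (total_dim ?K ?S') (total_dim ?K ?S')" using J(1) Jhc by auto
    have c: "J * ?Jh + Z \<in> carrier_mat (total_dim ?K ?S') (total_dim ?K ?S')" using JJh Z by auto
    have smult: "(d \<cdot>\<^sub>m A) *\<^sub>v v = d \<cdot>\<^sub>v (A *\<^sub>v v)"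
      if "A \<in> carrier_mat q q" "v \<in> carrier_vec q" for d :: complex and A v q
      using that by (intro eq_vecI) (auto simp: smult_scalar_prod_distrib[of _ q])
    have "(J * ?Jh) *\<^sub>v block_vec ?K ?m ?u = block_vec ?K ?m (regrouped (?n 0) (\<lambda>_. 0) ?y z w)"
      unfolding assoc_mult_mat_vec[OF J(1) Jhc bv] Jhv Jv grad_embed_eq_regrouped
      by (intro block_vec_cong) (auto simp: regrouped_def slot_def grad_embed_adj_def)
    then have "(J * ?Jh + Z) *\<^sub>v block_vec ?K ?m ?u = block_vec ?K ?m (regrouped (?n 0) x ?y z w)"
      unfolding add_mult_distrib_mat_vec[OF JJh Z bv] Zv
      by (simp add: block_vec_add regrouped_comp2[where f = "(+)"])
    then have "(1\<^sub>m (total_dim ?K ?S') - (J * ?Jh + Z)) *\<^sub>v block_vec ?K ?m ?u =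
        block_vec ?K ?m (regrouped (?n 0) (\<lambda>_. 0) (\<lambda>i a. y i a - ?y i a) (\<lambda>_. 0) (\<lambda>_ _. 0))"
      using bv[of ?u] c
      by (simp add: minus_mult_distrib_mat_vec[of _ "total_dim ?K ?S'" "total_dim ?K ?S'"] block_vec_minus
          regrouped_comp2[where f = "(-)"])
    then have rhs: "(complex_of_real (p\<^sup>2 + 1) \<cdot>\<^sub>m (1\<^sub>m (total_dim ?K ?S') - (J * ?Jh + Z))) *\<^sub>v block_vec ?K ?m ?u =
        block_vec ?K ?m (regrouped (?n 0) (\<lambda>_. 0) (\<lambda>i a. complex_of_real (p\<^sup>2 + 1) * (y i a - ?y i a)) (\<lambda>_. 0) (\<lambda>_ _. 0))"
      unfolding smult[OF minus_carrier_mat[OF c] bv]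
      by (simp only: block_vec_smult) (intro block_vec_cong, simp add: regrouped_def slot_def)
    have ll: "\<i> * l * (\<i> * l) = - complex_of_real (p\<^sup>2 + 1)"
    proof -
      have "\<i> * l * (\<i> * l) = (\<i> * \<i>) * complex_of_real (l * l)" by (simp only: of_real_mult mult_ac)
      also have "\<dots> = - complex_of_real (l\<^sup>2)" by (simp add: power2_eq_square)
      finally show ?thesis by (simp only: l)
    qed
    have "\<i> * l * (\<Sum>j\<in>UNIV. curl_symbol s i j * (\<i> * l * (\<Sum>k\<in>UNIV. curl_symbol s j k * y k a))) =
        complex_of_real (p\<^sup>2 + 1) * (y i a - ?y i a)" for i a
    proof -
      have "\<i> * l * (\<Sum>j\<in>UNIV. curl_symbol s i j * (\<i> * l * (\<Sum>k\<in>UNIV. curl_symbol s j k * y k a))) =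
          (\<i> * l * (\<i> * l)) * (\<Sum>j\<in>UNIV. curl_symbol s i j * (\<Sum>k\<in>UNIV. curl_symbol s j k * y k a))"
        unfolding sum_distrib_left[of "\<i> * l * (\<i> * l)"] sum_distrib_left[of "\<i> * l"]
        by (intro sum.cong refl) (simp add: mult_ac sum_distrib_left)
      also have "\<dots> = complex_of_real (p\<^sup>2 + 1) * (y i a - ?y i a)"
        unfolding curl_symbol_sq[OF s, where y = "\<lambda>k. y k a"] ll by (simp add: algebra_simps)
      finally show ?thesis .
    qed
    then show "(R * R) *\<^sub>v block_vec ?K ?m ?u =
        (complex_of_real (p\<^sup>2 + 1) \<cdot>\<^sub>m (1\<^sub>m (total_dim ?K ?S') - (J * ?Jh + Z))) *\<^sub>v block_vec ?K ?m ?u"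
      unfolding rhs assoc_mult_mat_vec[OF R R bv] Rv by simp
  qed (use R J(1) Z in auto)
  show ?thesis
    by (rule symmetrizer_extend[OF P M J(1) W R Z J(2,3) MW JR Rh JZ WZ RR p p0 k k0 H C c_def K_def])
qed

lemma strongly_hyperbolic_reduction_exists:
  assumes N: "N \<ge> 2" and S: "is_ft_system N S" and sh: "strongly_hyperbolic N S"
  obtains S' where "is_ft_reduction N S S'" "strongly_hyperbolic (N - 1) S'"
proof -
  obtain C where C: "C > 0" and H: "\<And>s. norm s = 1 \<Longrightarrow> \<exists>H. symmetrizer (total_dim N S) C (principal_symbol N S s) H"
    using sh unfolding strongly_hyperbolic_iff_symmetrizer by blast
  obtain p where p0: "0 \<le> p" and p: "\<And>s v. norm s = 1 \<Longrightarrow> v \<in> carrier_vec (total_dim N S) \<Longrightarrow>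
      vnorm (principal_symbol N S s *\<^sub>v v) \<le> p * vnorm v"
    using principal_symbol_bounded by blast
  \<comment> \<open>The order of the constants avoids circularity: \<open>p\<close> bounds the given
    symbol, \<open>l\<close> and thereby the reduction depend on \<open>p\<close>, and only then is
    the bound \<open>k\<close> of the new symbol taken. None of them depends on
    \<open>s\<close>.\<close>
  define l where "l = sqrt (p\<^sup>2 + 1)"
  have l: "l\<^sup>2 = p\<^sup>2 + 1" by (simp add: l_def add_nonneg_nonneg)
  let ?S' = "curl_reduction S l"
  obtain k where k0: "0 \<le> k" and k: "\<And>s v. norm s = 1 \<Longrightarrow> v \<in> carrier_vec (total_dim (N - 1) ?S') \<Longrightarrow>
      vnorm (principal_symbol (N - 1) ?S' s *\<^sub>v v) \<le> k * vnorm v"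
    using principal_symbol_bounded by blast
  define c where "c = p * (k + p) + (k + p) * (2 * k)"
  define K where "K = C * (1 + c)\<^sup>2 + 2 * C + 2 * c\<^sup>2 + 1"
  have "K > 0" using C by (simp add: K_def add_nonneg_pos add_pos_nonneg)
  moreover have "\<exists>H'. symmetrizer (total_dim (N - 1) ?S') K (principal_symbol (N - 1) ?S' s) H'"
    if s: "norm s = 1" for s
  proof -
    obtain H where "symmetrizer (total_dim N S) C (principal_symbol N S s) H" using H[OF s] by blast
    from curl_reduction_symmetrizer[OF N S s l p[OF s] p0 k[OF s] k0 this C c_def K_def] show ?thesis .
  qed
  ultimately have "strongly_hyperbolic (N - 1) ?S'"
    unfolding strongly_hyperbolic_iff_symmetrizer by blast
  then show ?thesis using that is_ft_reduction_curl[OF N S] by blast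
qed

section \<open>Iteration down to first order\<close>

lemma iterated_reduction_exists:
  assumes "N \<ge> 1" and "is_ft_system N S" and "strongly_hyperbolic N S"
  shows "\<exists>T. is_iterated_reduction N S T \<and> strongly_hyperbolic 1 T"
  using assms
proof (induction N arbitrary: S rule: nat_induct_at_least)
  case base
  have "is_iterated_reduction 1 S S"
    unfolding is_iterated_reduction_def by (intro exI[of _ "\<lambda>_. S"]) simp
  with base show ?case by blast
next
  case (Suc N)
  then obtain S' where S': "is_ft_reduction (Suc N) S S'" "strongly_hyperbolic (Suc N - 1) S'"
    using strongly_hyperbolic_reduction_exists[of "Suc N" S] by auto
  have "is_ft_system N S'" using S'(1) by (simp add: is_ft_reduction_def)
  with Suc.IH S'(2) obtain T where "is_iterated_reduction N S' T" "strongly_hyperbolic 1 T" by auto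
  then obtain \<Sigma> where T: "strongly_hyperbolic 1 T" "\<Sigma> N = S'" "\<Sigma> 1 = T"
    "\<And>M. M \<in> {2..N} \<Longrightarrow> is_ft_reduction M (\<Sigma> M) (\<Sigma> (M - 1))"
    unfolding is_iterated_reduction_def by blast
  have "is_iterated_reduction (Suc N) S T"
    unfolding is_iterated_reduction_def
  \<comment> \<open>The chain obtained for the reduction \<open>S'\<close> is extended at the top by
    \<open>S\<close>; all lower members are unchanged.\<close>
  proof (intro exI[of _ "\<Sigma>(Suc N := S)"] conjI ballI)
    fix M assume M: "M \<in> {2..Suc N}"
    show "is_ft_reduction M ((\<Sigma>(Suc N := S)) M) ((\<Sigma>(Suc N := S)) (M - 1))"
    proof (cases "M = Suc N")
      case True
      then show ?thesis using S'(1) T(2) by simp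
    next
      case False
      then have "M \<in> {2..N}" "M - 1 \<noteq> Suc N" using M by auto
      then show ?thesis using T(4) False by simp
    qed
  qed (use T(3) \<open>1 \<le> N\<close> in auto)
  with T(1) show ?case by blast
qed

lemma strongly_hyperbolic_of_iterated_reduction:
  assumes N: "N \<ge> 1" and S: "is_ft_system N S" and it: "is_iterated_reduction N S T"
    and sh: "strongly_hyperbolic 1 T"
  shows "strongly_hyperbolic N S"
proof -
  obtain \<Sigma> where \<Sigma>: "\<Sigma> N = S" "\<Sigma> 1 = T"
    "\<And>M. M \<in> {2..N} \<Longrightarrow> is_ft_reduction M (\<Sigma> M) (\<Sigma> (M - 1))"
    using it unfolding is_iterated_reduction_def by blast
  \<comment> \<open>The transfer lemma needs a well-formed system at each level. Below the top this
    holds because the member is itself a reduction of the next one.\<close>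
  have sys: "is_ft_system M (\<Sigma> M)" if "1 \<le> M" "M \<le> N" for M
  proof (cases "M = N")
    case True
    then show ?thesis using S \<Sigma>(1) by simp
  next
    case False
    then have "is_ft_reduction (M + 1) (\<Sigma> (M + 1)) (\<Sigma> M)" using \<Sigma>(3)[of "M + 1"] that by simp
    then show ?thesis by (simp add: is_ft_reduction_def)
  qed
  have "strongly_hyperbolic M (\<Sigma> M)" if "1 \<le> M" "M \<le> N" for M
    using that
  proof (induction M rule: nat_induct_at_least)
    case base
    then show ?case using sh \<Sigma>(2) by simp
  next
    case (Suc M)
    then show ?case
      using strongly_hyperbolic_of_reduction[of "Suc M" "\<Sigma> (Suc M)" "\<Sigma> M"] sys[of "Suc M"] \<Sigma>(3)[of "Suc M"]
      by simp
  qed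
  then show ?thesis using N \<Sigma>(1) by blast
qed

theorem mainTheorem1:
  fixes N :: nat and S :: ft_system
  assumes "N \<ge> 2" and "is_ft_system N S"
  shows "(strongly_hyperbolic N S \<longleftrightarrow>
            (\<exists>S'. is_ft_reduction N S S' \<and> strongly_hyperbolic (N - 1) S')) \<and>
         (strongly_hyperbolic N S \<longleftrightarrow>
            (\<exists>T. is_iterated_reduction N S T \<and> strongly_hyperbolic 1 T))"
proof (intro conjI iffI)
  assume "strongly_hyperbolic N S"
  then show "\<exists>S'. is_ft_reduction N S S' \<and> strongly_hyperbolic (N - 1) S'"
    using strongly_hyperbolic_reduction_exists[OF assms] by metis
next
  assume "\<exists>S'. is_ft_reduction N S S' \<and> strongly_hyperbolic (N - 1) S'"
  then show "strongly_hyperbolic N S"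
    using strongly_hyperbolic_of_reduction[OF assms] by blast
next
  assume "strongly_hyperbolic N S"
  then show "\<exists>T. is_iterated_reduction N S T \<and> strongly_hyperbolic 1 T"
    using iterated_reduction_exists[of N S] assms by auto
next
  assume "\<exists>T. is_iterated_reduction N S T \<and> strongly_hyperbolic 1 T"
  then show "strongly_hyperbolic N S"
    using strongly_hyperbolic_of_iterated_reduction[of N S] assms by auto
qed

end
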